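(* Let $(X,\pi)$ be a holomorphic Poisson manifold, $\pi=\pi_R+i\pi_I$ with $\pi_R,\pi_I$ real bivector fields. Then the complex Lie algebroid $T^{0,1}X\bowtie(T^{1,0}X)^*_\pi$ is isomorphic to the Dirac structure $L_{4\pi}$, the $-i$-eigenbundle of the generalized complex structure $$\mathbb J_{4\pi}=\begin{pmatrix}J&4\pi_I^\sharp\\0&-J^*\end{pmatrix}$$ on $X$, where $J$ is the almost complex structure of $X$.
   Context: A holomorphic Poisson structure is $\pi\in\Gamma(\wedge^2T^{1,0}X)$ with $\bar\partial\pi=0$, $[\pi,\pi]=0$. For a bivector field $P$, $\langle\beta,P^\sharp\alpha\rangle=P(\alpha,\beta)$; $J^*\alpha=\alpha\circ J$. $(T^{1,0}X)^*_\pi$ is the complex Lie algebroid on the bundle $(T^{1,0}X)^*$ with anchor $\pi^\sharp:(T^{1,0}X)^*\to T^{1,0}X\subset T_{\mathbb C}X$ and bracket on $\Omega^{1,0}(X)$ given by $[\xi,\eta]=\mathcal L_{\pi^\sharp\xi}\eta-\mathcal L_{\pi^\sharp\eta}\xi-d(\pi(\xi,\eta))$. (It is the complex Lie algebroid $A^{1,0}$ associated with the holomorphic cotangent Lie algebroid $A=(T^*X)_\pi$.) $T^{0,1}X\bowtie(T^{1,0}X)^*_\pi$ is the complex Lie algebroid on $T^{0,1}X\oplus(T^{1,0}X)^*$ with anchor $(Z,\xi)\mapsto Z+\pi^\sharp\xi$ and bracket $$[(Z_1,\xi_1),(Z_2,\xi_2)]=\big([Z_1,Z_2]+\nabla_{\xi_1}Z_2-\nabla_{\xi_2}Z_1,\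 [\xi_1,\xi_2]+\nabla_{Z_1}\xi_2-\nabla_{Z_2}\xi_1\big),$$ where, for $Z\in\Gamma(T^{0,1}X)$ and $\xi\in\Omega^{1,0}(X)$, $\nabla_Z\xi$ is the unique flat $T^{0,1}X$-connection on $(T^{1,0}X)^*$ vanishing on local holomorphic 1-forms (equivalently $\nabla_Z\xi=\mathcal L_Z\xi$), and $\nabla_\xi Z=\mathrm{pr}^{0,1}[\pi^\sharp\xi,Z]$, with $\mathrm{pr}^{0,1}:T_{\mathbb C}X\to T^{0,1}X$ the projection along $T^{1,0}X$. $\mathbb J_{4\pi}$ is an endomorphism of $TX\oplus T^*X$; it is a generalized complex structure. $L_{4\pi}\subset(TX\oplus T^*X)\otimes\mathbb C$ is its $-i$-eigenbundle, a complex Lie algebroid with anchor the projection to $T_{\mathbb C}X$ and bracket the restriction of the ($\mathbb C$-bilinearly extended) Courant bracket $[\![V+\xi,W+\eta]\!]=[V,W]+\mathcal L_V\eta-\mathcal L_W\xi+\frac12d(\xi(W)-\eta(V))$. *)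

theory Defs
  imports "HOL-Analysis.Analysis" "HOL-Library.Function_Algebras"
begin

section \<open>Smooth functions on open subsets of a normed space\<close>

text \<open>For open \<open>S\<close> in a finite-dimensional space, \<open>Ck_on k S f\<close> says that \<open>f\<close> is of class
  \<open>C^k\<close> on \<open>S\<close> in the real sense.\<close>

primrec Ck_on :: "nat \<Rightarrow> 'b::real_normed_vector set \<Rightarrow> ('b \<Rightarrow> 'c::real_normed_vector) \<Rightarrow> bool" where
  "Ck_on 0 S f \<longleftrightarrow> continuous_on S f"
| "Ck_on (Suc k) S f \<longleftrightarrow> (\<forall>x\<in>S. f differentiable (at x)) \<and>
     (\<forall>v. Ck_on k S (\<lambda>x. frechet_derivative f (at x) v))"

definition smooth_on :: "'b::real_normed_vector set \<Rightarrow> ('b \<Rightarrow> 'c::real_normed_vector) \<Rightarrow> bool" where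
  "smooth_on S f \<longleftrightarrow> (\<forall>k. Ck_on k S f)"

text \<open>Holomorphic means smooth with complex linear differential (Cauchy--Riemann).\<close>

definition holomorphic_map_on ::
    "(complex ^ 'n::finite) set \<Rightarrow> (complex ^ 'n \<Rightarrow> complex ^ 'n) \<Rightarrow> bool" where
  "holomorphic_map_on S f \<longleftrightarrow> smooth_on S f \<and>
     (\<forall>x\<in>S. \<forall>c v. frechet_derivative f (at x) (c *s v) = c *s frechet_derivative f (at x) v)"

section \<open>Complex manifolds\<close>

text \<open>The manifold is a whole type; a chart is a pair \<open>(V, \<phi>)\<close> of a domain and a coordinate map,
  of which only the values on \<open>V\<close> matter.\<close>

type_synonym ('a, 'n) atlas = "('a set \<times> ('a \<Rightarrow> complex ^ 'n)) set"

definition complex_atlas :: "('a::topological_space, 'n::finite) atlas \<Rightarrow> bool" where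
  "complex_atlas A \<longleftrightarrow>
     (\<forall>(V, \<phi>)\<in>A. open V \<and> open (\<phi> ` V) \<and> homeomorphism V (\<phi> ` V) \<phi> (inv_into V \<phi>)) \<and>
     (\<Union>(V, \<phi>)\<in>A. V) = UNIV \<and>
     (\<forall>(V, \<phi>)\<in>A. \<forall>(W, \<psi>)\<in>A. holomorphic_map_on (\<phi> ` (V \<inter> W)) (\<psi> \<circ> inv_into V \<phi>))"

definition smooth_fun :: "('a::topological_space, 'n::finite) atlas \<Rightarrow> 'a set \<Rightarrow> ('a \<Rightarrow> complex) \<Rightarrow> bool" where
  "smooth_fun A U f \<longleftrightarrow> (\<forall>(V, \<phi>)\<in>A. smooth_on (\<phi> ` (U \<inter> V)) (f \<circ> inv_into V \<phi>))"

definition smooth_at :: "('a::topological_space, 'n::finite) atlas \<Rightarrow> 'a \<Rightarrow> ('a \<Rightarrow> complex) \<Rightarrow> bool" where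
  "smooth_at A p f \<longleftrightarrow> (\<exists>U. open U \<and> p \<in> U \<and> smooth_fun A U f)"

section \<open>The complexified tangent and cotangent bundles\<close>

text \<open>A complex tangent vector at \<open>p\<close> is a \<open>\<complex>\<close>-linear derivation of the algebra of germs at \<open>p\<close>
  of complex-valued smooth functions; this is the fibre of \<open>T_\<complex>X = TX \<otimes> \<complex>\<close>. Vectors and covectors are
  total functions with value \<open>0\<close> outside their domain, so that the pointwise
  operations \<open>+\<close>, \<open>-\<close>, \<open>0\<close> on functions are the vector space operations.\<close>

type_synonym 'a tvec = "('a \<Rightarrow> complex) \<Rightarrow> complex"
type_synonym 'a covec = "'a tvec \<Rightarrow> complex"

definition tangent :: "('a::topological_space, 'n::finite) atlas \<Rightarrow> 'a \<Rightarrow> 'a tvec set" where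
  "tangent A p = {v.
     (\<forall>f. \<not> smooth_at A p f \<longrightarrow> v f = 0) \<and>
     (\<forall>f g. smooth_at A p f \<and> smooth_at A p g \<and> (\<forall>\<^sub>F q in nhds p. f q = g q) \<longrightarrow> v f = v g) \<and>
     (\<forall>f g. smooth_at A p f \<and> smooth_at A p g \<longrightarrow>
        v (\<lambda>q. f q + g q) = v f + v g \<and> v (\<lambda>q. f q * g q) = f p * v g + g p * v f) \<and>
     (\<forall>c f. smooth_at A p f \<longrightarrow> v (\<lambda>q. c * f q) = c * v f)}"

definition cotangent :: "('a::topological_space, 'n::finite) atlas \<Rightarrow> 'a \<Rightarrow> 'a covec set" where
  "cotangent A p = {\<alpha>.
     (\<forall>v. v \<notin> tangent A p \<longrightarrow> \<alpha> v = 0) \<and>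
     (\<forall>v\<in>tangent A p. \<forall>w\<in>tangent A p. \<alpha> (v + w) = \<alpha> v + \<alpha> w) \<and>
     (\<forall>c. \<forall>v\<in>tangent A p. \<alpha> (\<lambda>f. c * v f) = c * \<alpha> v)}"

text \<open>Complex conjugation on \<open>T_\<complex>X\<close> and its dual; the real bundles are the fixed points.\<close>

definition cnj_vec :: "'a tvec \<Rightarrow> 'a tvec" where
  "cnj_vec v = (\<lambda>f. cnj (v (\<lambda>q. cnj (f q))))"

definition cnj_covec :: "'a covec \<Rightarrow> 'a covec" where
  "cnj_covec \<alpha> = (\<lambda>v. cnj (\<alpha> (cnj_vec v)))"

text \<open>Smooth sections over an open set \<open>U\<close>. As with all local sections below, only the values
  on \<open>U\<close> are constrained.\<close>

definition vector_field :: "('a::topological_space, 'n::finite) atlas \<Rightarrow> 'a set \<Rightarrow> ('a \<Rightarrow> 'a tvec) \<Rightarrow> bool" where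
  "vector_field A U Z \<longleftrightarrow> (\<forall>p\<in>U. Z p \<in> tangent A p) \<and>
     (\<forall>V f. open V \<and> V \<subseteq> U \<and> smooth_fun A V f \<longrightarrow> smooth_fun A V (\<lambda>p. Z p f))"

definition one_form :: "('a::topological_space, 'n::finite) atlas \<Rightarrow> 'a set \<Rightarrow> ('a \<Rightarrow> 'a covec) \<Rightarrow> bool" where
  "one_form A U \<alpha> \<longleftrightarrow> (\<forall>p\<in>U. \<alpha> p \<in> cotangent A p) \<and>
     (\<forall>V W. open V \<and> V \<subseteq> U \<and> vector_field A V W \<longrightarrow> smooth_fun A V (\<lambda>p. \<alpha> p (W p)))"

definition differential ::
    "('a::topological_space, 'n::finite) atlas \<Rightarrow> ('a \<Rightarrow> complex) \<Rightarrow> 'a \<Rightarrow> 'a covec" where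
  "differential A f p = (\<lambda>v. if v \<in> tangent A p then v f else 0)"

definition vf_bracket :: "('a::topological_space, 'n::finite) atlas \<Rightarrow>
    ('a \<Rightarrow> 'a tvec) \<Rightarrow> ('a \<Rightarrow> 'a tvec) \<Rightarrow> 'a \<Rightarrow> 'a tvec" where
  "vf_bracket A Z W p = (\<lambda>f. if smooth_at A p f
     then Z p (\<lambda>q. W q f) - W p (\<lambda>q. Z q f) else 0)"

text \<open>The Lie derivative of a 1-form: \<open>(L_Z \<eta>)(W) = Z(\<eta>(W)) - \<eta>([Z,W])\<close> for local vector fields
  \<open>W\<close>, which determines the covector \<open>(L_Z \<eta>)_p\<close>.\<close>

definition lie_deriv :: "('a::topological_space, 'n::finite) atlas \<Rightarrow>
    ('a \<Rightarrow> 'a tvec) \<Rightarrow> ('a \<Rightarrow> 'a covec) \<Rightarrow> 'a \<Rightarrow> 'a covec" where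
  "lie_deriv A Z \<eta> p = (THE \<alpha>. \<alpha> \<in> cotangent A p \<and>
     (\<forall>U W. open U \<and> p \<in> U \<and> vector_field A U W \<longrightarrow>
        \<alpha> (W p) = Z p (\<lambda>q. \<eta> q (W q)) - \<eta> p (vf_bracket A Z W p)))"

section \<open>The almost complex structure and types\<close>

text \<open>The complex linear extension of the almost complex structure: in a holomorphic chart with
  coordinates \<open>z_k = x_k + i y_k\<close>, \<open>dx_k \<circ> J = - dy_k\<close> and \<open>dy_k \<circ> J = dx_k\<close>, that is
  \<open>J(\<partial>/\<partial>x_k) = \<partial>/\<partial>y_k\<close>.\<close>

definition Jmap :: "('a::topological_space, 'n::finite) atlas \<Rightarrow> 'a \<Rightarrow> 'a tvec \<Rightarrow> 'a tvec" where
  "Jmap A p v = (THE u. u \<in> tangent A p \<and>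
     (\<forall>(V, \<phi>)\<in>A. p \<in> V \<longrightarrow> (\<forall>k.
        u (\<lambda>q. of_real (Re (\<phi> q $ k))) = - v (\<lambda>q. of_real (Im (\<phi> q $ k))) \<and>
        u (\<lambda>q. of_real (Im (\<phi> q $ k))) = v (\<lambda>q. of_real (Re (\<phi> q $ k))))))"

definition Jdual :: "('a::topological_space, 'n::finite) atlas \<Rightarrow> 'a \<Rightarrow> 'a covec \<Rightarrow> 'a covec" where
  "Jdual A p \<alpha> = (\<lambda>v. if v \<in> tangent A p then \<alpha> (Jmap A p v) else 0)"

definition T10 :: "('a::topological_space, 'n::finite) atlas \<Rightarrow> 'a \<Rightarrow> 'a tvec set" where
  "T10 A p = {v \<in> tangent A p. Jmap A p v = (\<lambda>f. \<i> * v f)}"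

definition T01 :: "('a::topological_space, 'n::finite) atlas \<Rightarrow> 'a \<Rightarrow> 'a tvec set" where
  "T01 A p = {v \<in> tangent A p. Jmap A p v = (\<lambda>f. - \<i> * v f)}"

definition pr01 :: "('a::topological_space, 'n::finite) atlas \<Rightarrow> 'a \<Rightarrow> 'a tvec \<Rightarrow> 'a tvec" where
  "pr01 A p v = (THE z. z \<in> T01 A p \<and> v - z \<in> T10 A p)"

text \<open>The dual of \<open>T10\<close>, as the covectors of type (1,0) inside the complexified
  cotangent space.\<close>

definition T10_dual :: "('a::topological_space, 'n::finite) atlas \<Rightarrow> 'a \<Rightarrow> 'a covec set" where
  "T10_dual A p = {\<alpha> \<in> cotangent A p. \<forall>z\<in>T01 A p. \<alpha> z = 0}"

section \<open>Bivector fields and holomorphic Poisson structures\<close>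

text \<open>A complex bivector at \<open>p\<close> is an alternating bilinear form on the complexified cotangent space;
  only its values on that space are relevant.\<close>

type_synonym 'a bivector = "'a \<Rightarrow> 'a covec \<Rightarrow> 'a covec \<Rightarrow> complex"

definition bivector_field :: "('a::topological_space, 'n::finite) atlas \<Rightarrow> 'a bivector \<Rightarrow> bool" where
  "bivector_field A P \<longleftrightarrow>
     (\<forall>p. \<forall>\<alpha>\<in>cotangent A p.
        P p \<alpha> \<alpha> = 0 \<and>
        (\<forall>\<beta>\<in>cotangent A p. P p \<beta> \<alpha> = - P p \<alpha> \<beta> \<and>
           (\<forall>c. P p \<alpha> (\<lambda>v. c * \<beta> v) = c * P p \<alpha> \<beta>) \<and>
           (\<forall>\<gamma>\<in>cotangent A p. P p \<alpha> (\<beta> + \<gamma>) = P p \<alpha> \<beta> + P p \<alpha> \<gamma>))) \<and>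
     (\<forall>U \<alpha> \<beta>. open U \<and> one_form A U \<alpha> \<and> one_form A U \<beta> \<longrightarrow>
        smooth_fun A U (\<lambda>p. P p (\<alpha> p) (\<beta> p)))"

definition real_bivector_field :: "('a::topological_space, 'n::finite) atlas \<Rightarrow> 'a bivector \<Rightarrow> bool" where
  "real_bivector_field A P \<longleftrightarrow> bivector_field A P \<and>
     (\<forall>p. \<forall>\<alpha>\<in>cotangent A p. \<forall>\<beta>\<in>cotangent A p.
        P p (cnj_covec \<alpha>) (cnj_covec \<beta>) = cnj (P p \<alpha> \<beta>))"

text \<open>\<open>P\<close> is a section of \<open>\<Lambda>\<^sup>2 T10\<close> iff it is annihilated by contraction with covectors
  of type (0,1).\<close>

definition bivector_field_20 :: "('a::topological_space, 'n::finite) atlas \<Rightarrow> 'a bivector \<Rightarrow> bool" where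
  "bivector_field_20 A P \<longleftrightarrow> bivector_field A P \<and>
     (\<forall>p. \<forall>\<alpha>\<in>cotangent A p. \<forall>\<beta>\<in>cotangent A p. (\<forall>v\<in>T10 A p. \<alpha> v = 0) \<longrightarrow> P p \<alpha> \<beta> = 0)"

definition sharp :: "('a::topological_space, 'n::finite) atlas \<Rightarrow> 'a bivector \<Rightarrow> 'a \<Rightarrow> 'a covec \<Rightarrow> 'a tvec" where
  "sharp A P p \<alpha> = (THE v. v \<in> tangent A p \<and> (\<forall>\<beta>\<in>cotangent A p. \<beta> v = P p \<alpha> \<beta>))"

text \<open>The Schouten bracket of two bivector fields, as a trivector evaluated on \<open>df, dg, dh\<close>
  at \<open>p\<close>: with \<open>{f,g}_P = P(df,dg)\<close> it is the cyclic sum of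
  \<open>{{f,g}_P, h}_Q + {{f,g}_Q, h}_P\<close>.\<close>

definition schouten :: "('a::topological_space, 'n::finite) atlas \<Rightarrow> 'a bivector \<Rightarrow> 'a bivector \<Rightarrow>
    'a \<Rightarrow> ('a \<Rightarrow> complex) \<Rightarrow> ('a \<Rightarrow> complex) \<Rightarrow> ('a \<Rightarrow> complex) \<Rightarrow> complex" where
  "schouten A P Q p f g h =
     (let d = differential A;
          br = (\<lambda>R f g q. R q (d f q) (d g q));
          comp = (\<lambda>R S f g h. br R (br S f g) h p)
      in comp Q P f g h + comp Q P g h f + comp Q P h f g
         + comp P Q f g h + comp P Q g h f + comp P Q h f g)"

text \<open>The flat \<open>T01\<close>-connection on (1,0)-forms, which kills local holomorphic 1-forms, and the
  induced Dolbeault operator on sections of \<open>\<Lambda>\<^sup>2 T10\<close>, i.e. \<open>(\<partial>bar_Z P)(\<xi>,\<eta>)\<close>.\<close>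

definition nabla_vec_form :: "('a::topological_space, 'n::finite) atlas \<Rightarrow>
    ('a \<Rightarrow> 'a tvec) \<Rightarrow> ('a \<Rightarrow> 'a covec) \<Rightarrow> 'a \<Rightarrow> 'a covec" where
  "nabla_vec_form A Z \<xi> = lie_deriv A Z \<xi>"

definition dbar_bivector :: "('a::topological_space, 'n::finite) atlas \<Rightarrow> 'a bivector \<Rightarrow>
    ('a \<Rightarrow> 'a tvec) \<Rightarrow> ('a \<Rightarrow> 'a covec) \<Rightarrow> ('a \<Rightarrow> 'a covec) \<Rightarrow> 'a \<Rightarrow> complex" where
  "dbar_bivector A P Z \<xi> \<eta> p =
     Z p (\<lambda>q. P q (\<xi> q) (\<eta> q))
     - P p (nabla_vec_form A Z \<xi> p) (\<eta> p) - P p (\<xi> p) (nabla_vec_form A Z \<eta> p)"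

definition holomorphic_poisson :: "('a::topological_space, 'n::finite) atlas \<Rightarrow> 'a bivector \<Rightarrow> bool" where
  "holomorphic_poisson A P \<longleftrightarrow> bivector_field_20 A P \<and>
     (\<forall>U Z \<xi> \<eta>. open U \<and> vector_field A U Z \<and> one_form A U \<xi> \<and> one_form A U \<eta> \<and>
        (\<forall>q\<in>U. Z q \<in> T01 A q \<and> \<xi> q \<in> T10_dual A q \<and> \<eta> q \<in> T10_dual A q) \<longrightarrow>
        (\<forall>p\<in>U. dbar_bivector A P Z \<xi> \<eta> p = 0)) \<and>
     (\<forall>p f g h. smooth_at A p f \<and> smooth_at A p g \<and> smooth_at A p h \<longrightarrow> schouten A P P p f g h = 0)"

section \<open>Complex Lie algebroids\<close>

text \<open>Fibres live in a common ambient type and share its addition; scalar multiplication is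
  part of the data. The smooth structure of the bundle is given by its sheaf of smooth
  sections.\<close>

record ('a, 'e) cvb =
  fibre :: "'a \<Rightarrow> 'e set"
  scal :: "complex \<Rightarrow> 'e \<Rightarrow> 'e"
  smooth_sec :: "'a set \<Rightarrow> ('a \<Rightarrow> 'e) \<Rightarrow> bool"

record ('a, 'e) lie_algebroid = "('a, 'e) cvb" +
  anchor :: "'a \<Rightarrow> 'e \<Rightarrow> 'a tvec"
  brack :: "('a \<Rightarrow> 'e) \<Rightarrow> ('a \<Rightarrow> 'e) \<Rightarrow> 'a \<Rightarrow> 'e"

definition complex_vector_bundle ::
    "('a::topological_space, 'n::finite) atlas \<Rightarrow> ('a, 'e::ab_group_add, 'z) cvb_scheme \<Rightarrow> bool" where
  "complex_vector_bundle A E \<longleftrightarrow>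
     (\<forall>p. 0 \<in> fibre E p \<and>
        (\<forall>x\<in>fibre E p. \<forall>c d. scal E c x \<in> fibre E p \<and> scal E 1 x = x \<and>
           scal E (c + d) x = scal E c x + scal E d x \<and> scal E (c * d) x = scal E c (scal E d x) \<and>
           (\<forall>y\<in>fibre E p. x + y \<in> fibre E p \<and> scal E c (x + y) = scal E c x + scal E c y))) \<and>
     (\<forall>U s. open U \<longrightarrow> smooth_sec E U s \<longleftrightarrow>
        (\<forall>p\<in>U. s p \<in> fibre E p \<and> (\<exists>V. open V \<and> p \<in> V \<and> V \<subseteq> U \<and> smooth_sec E V s))) \<and>
     (\<forall>p. \<exists>U (r::nat) e. open U \<and> p \<in> U \<and>
        (\<forall>q\<in>U. (\<forall>i<r. e i q \<in> fibre E q) \<and>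
           (\<forall>x\<in>fibre E q. \<exists>!c. (\<forall>i\<ge>r. c i = 0) \<and> x = (\<Sum>i<r. scal E (c i) (e i q)))) \<and>
        (\<forall>V s. open V \<and> V \<subseteq> U \<longrightarrow> smooth_sec E V s \<longleftrightarrow>
           (\<exists>c. (\<forall>i<r. smooth_fun A V (c i)) \<and>
                (\<forall>q\<in>V. s q = (\<Sum>i<r. scal E (c i q) (e i q))))))"

abbreviation global_sections :: "('a, 'e, 'z) cvb_scheme \<Rightarrow> ('a \<Rightarrow> 'e) set" where
  "global_sections E \<equiv> {s. smooth_sec E UNIV s}"

definition complex_lie_algebroid ::
    "('a::topological_space, 'n::finite) atlas \<Rightarrow> ('a, 'e::ab_group_add) lie_algebroid \<Rightarrow> bool" where
  "complex_lie_algebroid A E \<longleftrightarrow>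
     complex_vector_bundle A E \<and>
     (\<forall>p. \<forall>x\<in>fibre E p. anchor E p x \<in> tangent A p \<and>
        (\<forall>c. anchor E p (scal E c x) = (\<lambda>f. c * anchor E p x f)) \<and>
        (\<forall>y\<in>fibre E p. anchor E p (x + y) = anchor E p x + anchor E p y)) \<and>
     (\<forall>U s. open U \<and> smooth_sec E U s \<longrightarrow> vector_field A U (\<lambda>p. anchor E p (s p))) \<and>
     (\<forall>s\<in>global_sections E. \<forall>t\<in>global_sections E.
        brack E s t \<in> global_sections E \<and>
        brack E t s = - brack E s t \<and>
        (\<forall>c. brack E s (\<lambda>p. scal E c (t p)) = (\<lambda>p. scal E c (brack E s t p))) \<and>
        (\<forall>u\<in>global_sections E.
           brack E s (t + u) = brack E s t + brack E s u \<and>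
           brack E s (brack E t u) + brack E t (brack E u s) + brack E u (brack E s t) = 0) \<and>
        (\<forall>f. smooth_fun A UNIV f \<longrightarrow>
           brack E s (\<lambda>p. scal E (f p) (t p)) =
             (\<lambda>p. scal E (f p) (brack E s t p) + scal E (anchor E p (s p) f) (t p))) \<and>
        (\<forall>p. anchor E p (brack E s t p) =
           vf_bracket A (\<lambda>q. anchor E q (s q)) (\<lambda>q. anchor E q (t q)) p))"

definition lie_algebroid_iso ::
    "('a::topological_space, 'e::ab_group_add) lie_algebroid \<Rightarrow> ('a, 'f::ab_group_add) lie_algebroid \<Rightarrow>
     ('a \<Rightarrow> 'e \<Rightarrow> 'f) \<Rightarrow> bool" where
  "lie_algebroid_iso E F \<Phi> \<longleftrightarrow>
     (\<forall>p. bij_betw (\<Phi> p) (fibre E p) (fibre F p) \<and>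
        (\<forall>x\<in>fibre E p. (\<forall>c. \<Phi> p (scal E c x) = scal F c (\<Phi> p x)) \<and>
           (\<forall>y\<in>fibre E p. \<Phi> p (x + y) = \<Phi> p x + \<Phi> p y) \<and>
           anchor F p (\<Phi> p x) = anchor E p x)) \<and>
     (\<forall>U s. open U \<and> (\<forall>p\<in>U. s p \<in> fibre E p) \<longrightarrow>
        smooth_sec F U (\<lambda>p. \<Phi> p (s p)) = smooth_sec E U s) \<and>
     (\<forall>s\<in>global_sections E. \<forall>t\<in>global_sections E.
        (\<lambda>p. \<Phi> p (brack E s t p)) = brack F (\<lambda>p. \<Phi> p (s p)) (\<lambda>p. \<Phi> p (t p)))"

definition isomorphic_lie_algebroids :: "('a::topological_space, 'n::finite) atlas \<Rightarrow>
    ('a, 'e::ab_group_add) lie_algebroid \<Rightarrow> ('a, 'f::ab_group_add) lie_algebroid \<Rightarrow> bool" where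
  "isomorphic_lie_algebroids A E F \<longleftrightarrow>
     complex_lie_algebroid A E \<and> complex_lie_algebroid A F \<and> (\<exists>\<Phi>. lie_algebroid_iso E F \<Phi>)"

section \<open>The complexified generalized tangent bundle\<close>

type_synonym 'a gvec = "'a tvec \<times> 'a covec"

definition gscale :: "complex \<Rightarrow> 'a gvec \<Rightarrow> 'a gvec" where
  "gscale c x = ((\<lambda>f. c * fst x f), (\<lambda>v. c * snd x v))"

definition gfibre :: "('a::topological_space, 'n::finite) atlas \<Rightarrow> 'a \<Rightarrow> 'a gvec set" where
  "gfibre A p = tangent A p \<times> cotangent A p"

definition gsection :: "('a::topological_space, 'n::finite) atlas \<Rightarrow> 'a set \<Rightarrow> ('a \<Rightarrow> 'a gvec) \<Rightarrow> bool" where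
  "gsection A U s \<longleftrightarrow> vector_field A U (\<lambda>p. fst (s p)) \<and> one_form A U (\<lambda>p. snd (s p))"

definition gcnj :: "'a gvec \<Rightarrow> 'a gvec" where
  "gcnj x = (cnj_vec (fst x), cnj_covec (snd x))"

definition gpairing :: "'a gvec \<Rightarrow> 'a gvec \<Rightarrow> complex" where
  "gpairing x y = (snd x (fst y) + snd y (fst x)) / 2"

definition courant_bracket :: "('a::topological_space, 'n::finite) atlas \<Rightarrow>
    ('a \<Rightarrow> 'a gvec) \<Rightarrow> ('a \<Rightarrow> 'a gvec) \<Rightarrow> 'a \<Rightarrow> 'a gvec" where
  "courant_bracket A s t p =
     (let V = (\<lambda>q. fst (s q)); \<xi> = (\<lambda>q. snd (s q)); W = (\<lambda>q. fst (t q)); \<eta> = (\<lambda>q. snd (t q))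
      in (vf_bracket A V W p,
          lie_deriv A V \<eta> p - lie_deriv A W \<xi> p
          + (\<lambda>v. 1 / 2 * differential A (\<lambda>q. \<xi> q (W q) - \<eta> q (V q)) p v)))"

text \<open>A subbundle \<open>L\<close> of the complexified generalized tangent bundle, with the projection to the
  tangent bundle and the restricted Courant bracket.\<close>

definition courant_algebroid_of ::
    "('a::topological_space, 'n::finite) atlas \<Rightarrow> ('a \<Rightarrow> 'a gvec set) \<Rightarrow> ('a, 'a gvec) lie_algebroid" where
  "courant_algebroid_of A L =
     \<lparr> fibre = L,
       scal = gscale,
       smooth_sec = (\<lambda>U s. gsection A U s \<and> (\<forall>p\<in>U. s p \<in> L p)),
       anchor = (\<lambda>p x. fst x),
       brack = courant_bracket A \<rparr>"

definition dirac_structure ::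
    "('a::topological_space, 'n::finite) atlas \<Rightarrow> ('a \<Rightarrow> 'a gvec set) \<Rightarrow> bool" where
  "dirac_structure A L \<longleftrightarrow>
     complex_vector_bundle A (courant_algebroid_of A L) \<and>
     (\<forall>p. L p = {x \<in> gfibre A p. \<forall>y\<in>L p. gpairing x y = 0}) \<and>
     (\<forall>s\<in>global_sections (courant_algebroid_of A L).
        \<forall>t\<in>global_sections (courant_algebroid_of A L).
        courant_bracket A s t \<in> global_sections (courant_algebroid_of A L))"

definition minus_i_eigenbundle :: "('a::topological_space, 'n::finite) atlas \<Rightarrow>
    ('a \<Rightarrow> 'a gvec \<Rightarrow> 'a gvec) \<Rightarrow> 'a \<Rightarrow> 'a gvec set" where
  "minus_i_eigenbundle A JJ p = {x \<in> gfibre A p. JJ p x = gscale (- \<i>) x}"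

text \<open>The endomorphism is given by its complex linear extension; commuting with \<open>gcnj\<close> says that
  it comes from the real bundle \<open>TX \<oplus> T*X\<close>. For such endomorphisms involutivity of the
  \<open>-i\<close>-eigenbundle and of the \<open>+i\<close>-eigenbundle are equivalent.\<close>

definition generalized_complex_structure :: "('a::topological_space, 'n::finite) atlas \<Rightarrow>
    ('a \<Rightarrow> 'a gvec \<Rightarrow> 'a gvec) \<Rightarrow> bool" where
  "generalized_complex_structure A JJ \<longleftrightarrow>
     (\<forall>p. \<forall>x\<in>gfibre A p.
        JJ p x \<in> gfibre A p \<and>
        JJ p (gcnj x) = gcnj (JJ p x) \<and>
        JJ p (JJ p x) = - x \<and>
        (\<forall>c. JJ p (gscale c x) = gscale c (JJ p x)) \<and>
        (\<forall>y\<in>gfibre A p. JJ p (x + y) = JJ p x + JJ p y \<and>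
           gpairing (JJ p x) (JJ p y) = gpairing x y)) \<and>
     (\<forall>U s. open U \<and> gsection A U s \<longrightarrow> gsection A U (\<lambda>p. JJ p (s p))) \<and>
     (let L = courant_algebroid_of A (minus_i_eigenbundle A JJ)
      in \<forall>s\<in>global_sections L. \<forall>t\<in>global_sections L. courant_bracket A s t \<in> global_sections L)"

section \<open>The two Lie algebroids of a holomorphic Poisson structure\<close>

definition JJ4 :: "('a::topological_space, 'n::finite) atlas \<Rightarrow> 'a bivector \<Rightarrow> 'a \<Rightarrow> 'a gvec \<Rightarrow> 'a gvec" where
  "JJ4 A PI p x =
     (Jmap A p (fst x) + (\<lambda>f. 4 * sharp A PI p (snd x) f), - Jdual A p (snd x))"

text \<open>The bracket of \<open>(T10 X)*\<close> with its Lie algebroid structure induced by \<open>P\<close>.\<close>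

definition poisson_bracket_forms :: "('a::topological_space, 'n::finite) atlas \<Rightarrow> 'a bivector \<Rightarrow>
    ('a \<Rightarrow> 'a covec) \<Rightarrow> ('a \<Rightarrow> 'a covec) \<Rightarrow> 'a \<Rightarrow> 'a covec" where
  "poisson_bracket_forms A P \<xi> \<eta> =
     lie_deriv A (\<lambda>q. sharp A P q (\<xi> q)) \<eta> - lie_deriv A (\<lambda>q. sharp A P q (\<eta> q)) \<xi>
     - differential A (\<lambda>q. P q (\<xi> q) (\<eta> q))"

definition nabla_form_vec :: "('a::topological_space, 'n::finite) atlas \<Rightarrow> 'a bivector \<Rightarrow>
    ('a \<Rightarrow> 'a covec) \<Rightarrow> ('a \<Rightarrow> 'a tvec) \<Rightarrow> 'a \<Rightarrow> 'a tvec" where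
  "nabla_form_vec A P \<xi> Z p = pr01 A p (vf_bracket A (\<lambda>q. sharp A P q (\<xi> q)) Z p)"

definition matched_pair_algebroid ::
    "('a::topological_space, 'n::finite) atlas \<Rightarrow> 'a bivector \<Rightarrow> ('a, 'a tvec \<times> 'a covec) lie_algebroid" where
  "matched_pair_algebroid A P =
     \<lparr> fibre = (\<lambda>p. T01 A p \<times> T10_dual A p),
       scal = gscale,
       smooth_sec = (\<lambda>U s. gsection A U s \<and> (\<forall>p\<in>U. s p \<in> T01 A p \<times> T10_dual A p)),
       anchor = (\<lambda>p x. fst x + sharp A P p (snd x)),
       brack = (\<lambda>s t.
         let Z1 = (\<lambda>q. fst (s q)); \<xi>1 = (\<lambda>q. snd (s q));
             Z2 = (\<lambda>q. fst (t q)); \<xi>2 = (\<lambda>q. snd (t q))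
         in (\<lambda>p. (vf_bracket A Z1 Z2 p + nabla_form_vec A P \<xi>1 Z2 p - nabla_form_vec A P \<xi>2 Z1 p,
                  poisson_bracket_forms A P \<xi>1 \<xi>2 p
                  + nabla_vec_form A Z1 \<xi>2 p - nabla_vec_form A Z2 \<xi>1 p))) \<rparr>"

end

theory Submission
  imports Defs
begin

text \<open>
  The isomorphism is \<open>(Z, \<xi>) \<mapsto> (Z + \<pi>\<^sup>\<sharp>\<xi>, \<xi>)\<close>. It lands in the right bundle for the
  following reason. As \<open>\<pi>\<^sub>I = (\<pi> - cnj \<pi>) / 2i\<close> and the conjugate of \<open>\<pi>\<close> annihilates (1,0)-forms, on
  such forms \<open>4 \<pi>\<^sub>I\<^sup>\<sharp> = - 2i \<pi>\<^sup>\<sharp>\<close>. The equation \<open>J\<^sup>*\<xi> = i \<xi>\<close> says that \<open>\<xi>\<close> has type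
  (1,0), and \<open>J v + 4 \<pi>\<^sub>I\<^sup>\<sharp>\<xi> = - i v\<close> then says that \<open>v - \<pi>\<^sup>\<sharp>\<xi>\<close> has type (0,1). So the
  eigenbundle is the bundle \<open>L\<close> of all \<open>(Z + \<pi>\<^sup>\<sharp>\<xi>, \<xi>)\<close> with \<open>Z\<close> of type (0,1) and \<open>\<xi>\<close> of
  type (1,0) (lemma \<open>JJ4_eigenbundle\<close>).

  That \<open>L\<close> is isotropic is the antisymmetry of \<open>\<pi>\<close>. On sections \<open>s\<close>, \<open>t\<close> that are orthogonal to each
  other the Courant bracket obeys the Leibniz rule \<open>[s, f t] = f [s, t] + (V f) t\<close>, where \<open>V\<close> is the
  vector part of \<open>s\<close> (lemma \<open>courant_gcomb\<close>); this reduces the involutivity of \<open>L\<close> to the brackets of the local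
  frame consisting of \<open>(\<partial>/\<partial>cnj z\<^sub>k, 0)\<close> and \<open>(\<pi>\<^sup>\<sharp>dz\<^sub>k, dz\<^sub>k)\<close>. These brackets lie in \<open>L\<close> because the
  functions \<open>\<pi>(dz\<^sub>k, dz\<^sub>l)\<close> are holomorphic, which is \<open>\<partial>bar \<pi> = 0\<close>, and because the bracket of two
  Hamiltonian fields is Hamiltonian, which is \<open>[\<pi>, \<pi>] = 0\<close> (lemma \<open>L_involutive\<close>). On isotropic
  involutive bundles the Courant bracket satisfies the Jacobi identity (lemma \<open>courant_jacobi\<close>), so \<open>L\<close> is
  a Lie algebroid.

  The form parts of the two brackets agree by direct computation. For the vector parts, \<open>L\<close> being
  involutive means that the vector part of a bracket of sections of \<open>L\<close> is \<open>\<pi>\<^sup>\<sharp>\<close> of its form part plus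
  its (0,1)-component, and that component is exactly the vector part of the bracket of the matched pair
  (lemma \<open>to_L_brack\<close>). The Lie algebroid axioms of the matched pair are then transported from \<open>L\<close>
  along the isomorphism instead of being verified.

  Tangent vectors are derivations of germs. The only analysis about them is Hadamard's lemma,
  which shows that in a chart they are combinations of the Wirtinger derivatives (lemma
  \<open>tangent_expand\<close>). After that the arguments use only the product rule, locality, the
  Cauchy--Riemann equations of the coordinate changes, and the values on coordinate functions and
  frames.
\<close>

section \<open>Calculus of functions of class C^k\<close>

lemma has_frechet_derivative:
  "f differentiable (at x) \<Longrightarrow> (f has_derivative frechet_derivative f (at x)) (at x)"
  by (simp add: frechet_derivative_works)

lemma frechet_derivative_eq:
  "(f has_derivative f') (at x) \<Longrightarrow> frechet_derivative f (at x) = f'"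
  by (rule frechet_derivative_at[symmetric])

lemma Ck_on_cong:
  assumes "open S" "\<And>x. x \<in> S \<Longrightarrow> f x = g x" "Ck_on k S f"
  shows "Ck_on k S g"
  using assms(2,3)
proof (induction k arbitrary: f g)
  case 0
  then show ?case by (simp cong: continuous_on_cong)
next
  case (Suc k)
  have d: "(g has_derivative frechet_derivative f (at x)) (at x)" if "x \<in> S" for x
    using Suc.prems that assms(1)
    by (intro has_derivative_transform_within_open[OF has_frechet_derivative]) auto
  have "Ck_on k S (\<lambda>x. frechet_derivative g (at x) v)" for v
    by (rule Suc.IH[of "\<lambda>x. frechet_derivative f (at x) v"])
      (use Suc.prems in \<open>simp_all add: frechet_derivative_eq[OF d]\<close>)
  then show ?case using d by (auto simp: differentiable_def)
qed

text \<open>The class \<open>C^(k+1)\<close> is defined through the Frechet derivative selected by choice; this form allows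
  any explicitly computed derivative.\<close>

lemma Ck_on_SucI:
  assumes "open S" "\<And>x. x \<in> S \<Longrightarrow> (f has_derivative f' x) (at x)"
    and "\<And>v. Ck_on k S (\<lambda>x. f' x v)"
  shows "Ck_on (Suc k) S f"
proof -
  have "Ck_on k S (\<lambda>x. frechet_derivative f (at x) v)" for v
    by (rule Ck_on_cong[OF assms(1) _ assms(3)[of v]]) (simp add: frechet_derivative_eq[OF assms(2)])
  then show ?thesis using assms(2) by (auto simp: differentiable_def)
qed

lemma Ck_on_Suc_derivative:
  assumes "Ck_on (Suc k) S f" "x \<in> S"
  shows "(f has_derivative frechet_derivative f (at x)) (at x)"
  using assms by (auto intro: has_frechet_derivative)

lemma Ck_on_subset: "T \<subseteq> S \<Longrightarrow> Ck_on k S f \<Longrightarrow> Ck_on k T f"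
  by (induction k arbitrary: f) (auto intro: continuous_on_subset)

lemma Ck_on_SucD: "Ck_on (Suc k) S f \<Longrightarrow> Ck_on k S f"
proof (induction k arbitrary: f)
  case 0
  then show ?case
    by (auto intro!: continuous_at_imp_continuous_on differentiable_imp_continuous_within)
next
  case (Suc k)
  from Suc.prems show ?case
    unfolding Ck_on.simps(2)[of "Suc k"] Ck_on.simps(2)[of k] using Suc.IH
    by (metis Ck_on.simps(2))
qed

lemma Ck_on_continuous: "Ck_on k S f \<Longrightarrow> continuous_on S f"
proof (induction k)
  case (Suc k)
  then show ?case using Ck_on_SucD by blast
qed simp

lemma Ck_on_local:
  assumes "\<And>x. x \<in> S \<Longrightarrow> \<exists>T. open T \<and> x \<in> T \<and> Ck_on k T f"
  shows "Ck_on k S f"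
  using assms
proof (induction k arbitrary: f)
  case 0
  then show ?case
    by (metis Ck_on.simps(1) continuous_at_imp_continuous_on continuous_on_eq_continuous_at)
next
  case (Suc k)
  have "Ck_on k S (\<lambda>x. frechet_derivative f (at x) v)" for v
    by (rule Suc.IH) (use Suc.prems in fastforce)
  moreover have "f differentiable (at x)" if "x \<in> S" for x
    using Suc.prems[OF that] by auto
  ultimately show ?case by simp
qed

lemma Ck_on_const: "open S \<Longrightarrow> Ck_on k S (\<lambda>x. c)"
proof (induction k arbitrary: c)
  case (Suc k)
  then show ?case by (intro Ck_on_SucI[where f' = "\<lambda>x v. 0"]) auto
qed simp

lemma Ck_on_linear:
  assumes "bounded_linear L" "open S" "Ck_on k S f"
  shows "Ck_on k S (\<lambda>x. L (f x))"
  using assms(3)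
proof (induction k arbitrary: f)
  case 0
  then show ?case using assms(1) by (simp add: bounded_linear.continuous_on)
next
  case (Suc k)
  show ?case
  proof (rule Ck_on_SucI[OF assms(2)])
    show "((\<lambda>x. L (f x)) has_derivative (\<lambda>v. L (frechet_derivative f (at x) v))) (at x)"
      if "x \<in> S" for x
      using Ck_on_Suc_derivative[OF Suc.prems that] assms(1) bounded_linear.has_derivative by blast
  qed (use Suc in auto)
qed

lemma Ck_on_id: "open S \<Longrightarrow> Ck_on k S (\<lambda>x. x)"
  by (cases k) (auto intro!: Ck_on_SucI[where f' = "\<lambda>x v. v"] Ck_on_const)

lemma Ck_on_add:
  assumes "open S" "Ck_on k S f" "Ck_on k S g"
  shows "Ck_on k S (\<lambda>x. f x + g x)"
  using assms(2,3)
proof (induction k arbitrary: f g)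
  case 0
  then show ?case by (auto intro: continuous_intros)
next
  case (Suc k)
  show ?case
  proof (rule Ck_on_SucI[OF assms(1)])
    show "((\<lambda>x. f x + g x) has_derivative
        (\<lambda>v. frechet_derivative f (at x) v + frechet_derivative g (at x) v)) (at x)"
      if "x \<in> S" for x
      using Suc.prems that by (intro has_derivative_add Ck_on_Suc_derivative)
  qed (use Suc in auto)
qed

lemma Ck_on_sum:
  assumes "open S" "\<And>i. i \<in> I \<Longrightarrow> Ck_on k S (f i)"
  shows "Ck_on k S (\<lambda>x. \<Sum>i\<in>I. f i x)"
  using assms(2) by (induction I rule: infinite_finite_induct)
    (auto intro: Ck_on_const Ck_on_add assms(1))

lemma Ck_on_bilinear:
  assumes "bounded_bilinear B" "open S" "Ck_on k S f" "Ck_on k S g"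
  shows "Ck_on k S (\<lambda>x. B (f x) (g x))"
  using assms(3,4)
proof (induction k arbitrary: f g)
  case 0
  then show ?case using assms(1) by (simp add: bounded_bilinear.continuous_on)
next
  case (Suc k)
  show ?case
  proof (rule Ck_on_SucI[OF assms(2)])
    show "((\<lambda>x. B (f x) (g x)) has_derivative
        (\<lambda>v. B (f x) (frechet_derivative g (at x) v) + B (frechet_derivative f (at x) v) (g x))) (at x)"
      if "x \<in> S" for x
      using Suc.prems that assms(1)
      by (intro bounded_bilinear.FDERIV Ck_on_Suc_derivative)
    have "Ck_on k S f" "Ck_on k S g" using Suc.prems by (auto intro: Ck_on_SucD simp del: Ck_on.simps)
    then show "Ck_on k S (\<lambda>x. B (f x) (frechet_derivative g (at x) v) +
        B (frechet_derivative f (at x) v) (g x))" for v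
      using Suc.prems by (intro Ck_on_add Suc.IH assms(2)) auto
  qed
qed

lemma has_derivative_Basis_expand:
  fixes f :: "'b::euclidean_space \<Rightarrow> 'c::real_normed_vector"
  assumes "(f has_derivative f') F"
  shows "f' v = (\<Sum>b\<in>Basis. (v \<bullet> b) *\<^sub>R f' b)"
proof -
  have "f' v = f' (\<Sum>b\<in>Basis. (v \<bullet> b) *\<^sub>R b)"
    by (simp add: euclidean_representation)
  also have "\<dots> = (\<Sum>b\<in>Basis. (v \<bullet> b) *\<^sub>R f' b)"
    using has_derivative_linear[OF assms] by (simp add: linear_sum linear_scale o_def)
  finally show ?thesis .
qed

text \<open>The chain rule involves the derivative of \<open>g\<close> in a direction that varies with the point. Expanding that
  direction in a basis leaves products of functions to which the induction hypothesis and
  \<open>Ck_on_bilinear\<close> apply; this is where the finite dimension of the middle space enters.\<close>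

lemma Ck_on_compose:
  fixes f :: "'b::real_normed_vector \<Rightarrow> 'c::euclidean_space" and g :: "'c \<Rightarrow> 'd::real_normed_vector"
  assumes "open S" "Ck_on k S f" "Ck_on k T g" "f ` S \<subseteq> T"
  shows "Ck_on k S (\<lambda>x. g (f x))"
  using assms(2-)
proof (induction k arbitrary: g)
  case 0
  then show ?case
    using continuous_on_compose2 by (metis Ck_on.simps(1))
next
  case (Suc k)
  let ?Df = "\<lambda>x. frechet_derivative f (at x)" and ?Dg = "\<lambda>x. frechet_derivative g (at x)"
  show ?case
  proof (rule Ck_on_SucI[OF assms(1)])
    show "((\<lambda>x. g (f x)) has_derivative (\<lambda>v. \<Sum>b\<in>Basis. (?Df x v \<bullet> b) *\<^sub>R ?Dg (f x) b)) (at x)"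
      if "x \<in> S" for x
    proof -
      have f: "(f has_derivative ?Df x) (at x)" using Suc.prems that by (intro Ck_on_Suc_derivative)
      have g: "(g has_derivative ?Dg (f x)) (at (f x))"
        using Suc.prems that by (intro Ck_on_Suc_derivative[of k T]) auto
      have "((\<lambda>x. g (f x)) has_derivative (\<lambda>v. ?Dg (f x) (?Df x v))) (at x)"
        using has_derivative_compose[OF f g] .
      then show ?thesis by (subst (asm) has_derivative_Basis_expand[OF g])
    qed
    show "Ck_on k S (\<lambda>x. \<Sum>b\<in>Basis. (?Df x v \<bullet> b) *\<^sub>R ?Dg (f x) b)" for v
    proof (intro Ck_on_sum Ck_on_bilinear[OF bounded_bilinear_scaleR] assms(1))
      fix b :: 'c
      show "Ck_on k S (\<lambda>x. ?Df x v \<bullet> b)"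
        using Suc.prems assms(1)
        by (intro Ck_on_linear[where L = "\<lambda>x. x \<bullet> b"] bounded_linear_inner_left) auto
      have "Ck_on k S f" using Suc.prems(1) by (rule Ck_on_SucD)
      then show "Ck_on k S (\<lambda>x. ?Dg (f x) b)"
        using Suc.prems by (intro Suc.IH) auto
    qed
  qed
qed

lemma smooth_on_derivative:
  "smooth_on S f \<Longrightarrow> smooth_on S (\<lambda>x. frechet_derivative f (at x) v)"
  unfolding smooth_on_def by (metis Ck_on.simps(2))

lemma smooth_on_has_derivative:
  "smooth_on S f \<Longrightarrow> x \<in> S \<Longrightarrow> (f has_derivative frechet_derivative f (at x)) (at x)"
  unfolding smooth_on_def using Ck_on_Suc_derivative by blast

subsection \<open>Parameter integrals and Hadamard's lemma\<close>

lemma ray_in_ball: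
  fixes x :: "'b::real_normed_vector"
  assumes "x \<in> ball a r" "t \<in> {0..1}"
  shows "a + t *\<^sub>R (x - a) \<in> ball a r"
proof -
  have "norm (t *\<^sub>R (x - a)) \<le> norm (x - a)"
    using assms by (simp add: mult_left_le_one_le)
  then show ?thesis using assms by (simp add: dist_norm norm_minus_commute)
qed

text \<open>Differentiating under the integral sign turns \<open>f\<close> into its derivative and produces one more
  factor \<open>t\<close>. The weight \<open>t^m\<close> makes the class of integrals closed under differentiation, so that the
  induction on \<open>k\<close> goes through.\<close>

lemma Ck_on_ray_integral:
  fixes f :: "'b::euclidean_space \<Rightarrow> 'c::euclidean_space"
  assumes "Ck_on k (ball a r) f"
  shows "Ck_on k (ball a r) (\<lambda>x. integral {0..1} (\<lambda>t. t ^ m *\<^sub>R f (a + t *\<^sub>R (x - a))))"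
  using assms
proof (induction k arbitrary: f m)
  case (0 f m)
  have "continuous_on (ball a r \<times> cbox 0 1) (\<lambda>(x, t). t ^ m *\<^sub>R f (a + t *\<^sub>R (x - a)))"
    unfolding split_beta
    by (intro continuous_intros continuous_on_compose2[OF "0"[simplified]]) (auto intro: ray_in_ball)
  from integral_continuous_on_param[OF this] show ?case by simp
next
  case (Suc k f m)
  let ?Df = "\<lambda>x. frechet_derivative f (at x)"
  \<comment> \<open>the derivative of the integrand as a bounded operator that depends continuously on \<open>(x, t)\<close>\<close>
  let ?D = "\<lambda>x t. \<Sum>b\<in>Basis. 
              blinfun_scaleR_left (t ^ Suc m *\<^sub>R ?Df (a + t *\<^sub>R (x - a)) b) o\<^sub>L blinfun_inner_left b"
  have cont_Df: "continuous_on (ball a r) (\<lambda>x. ?Df x v)" for v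
    by (rule Ck_on_continuous[of k]) (use Suc.prems in simp)
  have cont_f: "continuous_on (ball a r) f"
    using Suc.prems by (rule Ck_on_continuous)
  have D: "blinfun_apply (?D x t) v = t ^ Suc m *\<^sub>R ?Df (a + t *\<^sub>R (x - a)) v"
    if "x \<in> ball a r" "t \<in> {0..1}" for x t v
    using has_derivative_Basis_expand[OF Ck_on_Suc_derivative[OF Suc.prems ray_in_ball[OF that]], of v]
    by (simp add: blinfun.sum_left scaleR_sum_right inner_commute mult.commute)
  show ?case
  proof (rule Ck_on_SucI[OF open_ball])
    fix x assume x: "x \<in> ball a r"
    have "((\<lambda>x. integral (cbox 0 1) (\<lambda>t. t ^ m *\<^sub>R f (a + t *\<^sub>R (x - a)))) has_derivative
        integral (cbox 0 1) (?D x)) (at x within ball a r)"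
    proof (rule leibniz_rule)
      fix y t assume y: "y \<in> ball a r" and t: "t \<in> cbox 0 (1::real)"
      have "((\<lambda>y. a + t *\<^sub>R (y - a)) has_derivative (\<lambda>v. t *\<^sub>R v)) (at y)"
        by (auto intro!: derivative_eq_intros)
      from has_derivative_compose[OF this Ck_on_Suc_derivative[OF Suc.prems ray_in_ball]] y t
      have *: "((\<lambda>y. f (a + t *\<^sub>R (y - a))) has_derivative (\<lambda>v. ?Df (a + t *\<^sub>R (y - a)) (t *\<^sub>R v))) (at y)"
        by simp
      have "((\<lambda>y. t ^ m *\<^sub>R f (a + t *\<^sub>R (y - a))) has_derivative
          (\<lambda>v. t ^ m *\<^sub>R ?Df (a + t *\<^sub>R (y - a)) (t *\<^sub>R v))) (at y)"
        by (rule has_derivative_scaleR_right[OF *])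
      also have "(\<lambda>v. t ^ m *\<^sub>R ?Df (a + t *\<^sub>R (y - a)) (t *\<^sub>R v)) = blinfun_apply (?D y t)"
      proof
        fix v
        have "linear (?Df (a + t *\<^sub>R (y - a)))"
          by (rule has_derivative_linear[OF Ck_on_Suc_derivative[OF Suc.prems ray_in_ball]])
            (use y t in auto)
        then show "t ^ m *\<^sub>R ?Df (a + t *\<^sub>R (y - a)) (t *\<^sub>R v) = blinfun_apply (?D y t) v"
          using y t by (subst D) (auto simp: linear_scale mult.commute)
      qed
      finally show "((\<lambda>y. t ^ m *\<^sub>R f (a + t *\<^sub>R (y - a))) has_derivative blinfun_apply (?D y t))
          (at y within ball a r)"
        by (rule has_derivative_at_withinI)
    next
      show "(\<lambda>t. t ^ m *\<^sub>R f (a + t *\<^sub>R (y - a))) integrable_on cbox 0 1" if "y \<in> ball a r" for y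
        by (intro integrable_continuous continuous_intros continuous_on_compose2[OF cont_f])
          (auto intro: ray_in_ball[OF that])
      show "continuous_on (ball a r \<times> cbox 0 1) (\<lambda>(x, t). ?D x t)"
        unfolding split_beta
        by (intro continuous_intros continuous_on_compose2[OF cont_Df]
            bounded_bilinear.continuous_on[OF bounded_bilinear_blinfun_compose]
            bounded_linear.continuous_on[OF bounded_linear_blinfun_scaleR_left])
          (auto intro: ray_in_ball)
    qed (use x in auto)
    then have *: "((\<lambda>x. integral {0..1} (\<lambda>t. t ^ m *\<^sub>R f (a + t *\<^sub>R (x - a)))) has_derivative
        blinfun_apply (integral {0..1} (?D x))) (at x)"
      using x by (simp add: at_within_open[OF _ open_ball])
    have int_D: "?D x integrable_on {0..1}"
      unfolding interval_cbox
      by (intro integrable_continuous continuous_intros continuous_on_compose2[OF cont_Df]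
            bounded_bilinear.continuous_on[OF bounded_bilinear_blinfun_compose]
            bounded_linear.continuous_on[OF bounded_linear_blinfun_scaleR_left])
        (use x in \<open>auto intro: ray_in_ball\<close>)
    have "blinfun_apply (integral {0..1} (?D x)) v =
        integral {0..1} (\<lambda>t. t ^ Suc m *\<^sub>R ?Df (a + t *\<^sub>R (x - a)) v)" for v
    proof -
      have "blinfun_apply (integral {0..1} (?D x)) v = integral {0..1} (\<lambda>t. blinfun_apply (?D x t) v)"
        using integral_linear[OF int_D, of "\<lambda>B. blinfun_apply B v"]
        by (simp add: o_def bounded_linear_blinfun_apply blinfun.bounded_linear_left)
      also have "\<dots> = integral {0..1} (\<lambda>t. t ^ Suc m *\<^sub>R ?Df (a + t *\<^sub>R (x - a)) v)"
        by (rule integral_cong) (rule D[OF x])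
      finally show ?thesis .
    qed
    then have "blinfun_apply (integral {0..1} (?D x)) =
        (\<lambda>v. integral {0..1} (\<lambda>t. t ^ Suc m *\<^sub>R ?Df (a + t *\<^sub>R (x - a)) v))" by blast
    with * show "((\<lambda>x. integral {0..1} (\<lambda>t. t ^ m *\<^sub>R f (a + t *\<^sub>R (x - a)))) has_derivative
        (\<lambda>v. integral {0..1} (\<lambda>t. t ^ Suc m *\<^sub>R ?Df (a + t *\<^sub>R (x - a)) v))) (at x)" by simp
  next
    show "Ck_on k (ball a r) (\<lambda>x. integral {0..1} (\<lambda>t. t ^ Suc m *\<^sub>R ?Df (a + t *\<^sub>R (x - a)) v))" for v
      by (rule Suc.IH) (use Suc.prems in simp)
  qed
qed

text \<open>Integrate the derivative of \<open>f\<close> along the segment from \<open>a\<close> to \<open>x\<close>. The factors \<open>g b\<close> are the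
  averages of the partial derivatives over that segment.\<close>

lemma Hadamard_lemma:
  fixes f :: "'b::euclidean_space \<Rightarrow> 'c::euclidean_space"
  assumes f: "smooth_on (ball a r) f" and r: "r > 0"
  obtains g where "\<And>b. smooth_on (ball a r) (g b)"
    and "\<And>x. x \<in> ball a r \<Longrightarrow> f x = f a + (\<Sum>b\<in>Basis. ((x - a) \<bullet> b) *\<^sub>R g b x)"
    and "\<And>b. g b a = frechet_derivative f (at a) b"
proof
  let ?Df = "\<lambda>x. frechet_derivative f (at x)"
  let ?g = "\<lambda>b x. integral {0..1} (\<lambda>t. ?Df (a + t *\<^sub>R (x - a)) b)"
  show "smooth_on (ball a r) (?g b)" for b
    using Ck_on_ray_integral[where m = 0 and f = "\<lambda>x. ?Df x b"] smooth_on_derivative[OF f, of b]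
    by (simp add: smooth_on_def)
  show "?g b a = ?Df a b" for b
    by simp
  show "f x = f a + (\<Sum>b\<in>Basis. ((x - a) \<bullet> b) *\<^sub>R ?g b x)" if x: "x \<in> ball a r" for x
  proof -
    note ray_in_ball = ray_in_ball[OF x]
    have Df: "(f has_derivative ?Df (a + t *\<^sub>R (x - a))) (at (a + t *\<^sub>R (x - a)))" if "t \<in> {0..1}" for t
      using smooth_on_has_derivative[OF f ray_in_ball[OF that]] .
    have vd: "((\<lambda>t. f (a + t *\<^sub>R (x - a))) has_vector_derivative ?Df (a + t *\<^sub>R (x - a)) (x - a))
        (at t within {0..1})" if "t \<in> {0..1}" for t
    proof -
      have "((\<lambda>t. a + t *\<^sub>R (x - a)) has_derivative (\<lambda>s. s *\<^sub>R (x - a))) (at t within {0..1})"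
        by (auto intro!: derivative_eq_intros)
      from has_derivative_compose[OF this Df[OF that]]
      show ?thesis
        using has_derivative_linear[OF Df[OF that]]
        by (simp add: has_vector_derivative_def linear_scale)
    qed
    have "((\<lambda>t. ?Df (a + t *\<^sub>R (x - a)) (x - a)) has_integral f x - f a) {0..1}"
      using fundamental_theorem_of_calculus[OF _ vd] by simp
    then have 1: "f x = f a + integral {0..1} (\<lambda>t. ?Df (a + t *\<^sub>R (x - a)) (x - a))"
      by (simp add: integral_unique)
    have cont: "continuous_on (ball a r) (\<lambda>x. ?Df x b)" for b
      using smooth_on_derivative[OF f, of b] unfolding smooth_on_def by (metis Ck_on.simps(1))
    have int: "(\<lambda>t. ?Df (a + t *\<^sub>R (x - a)) b) integrable_on {0..1}" for b
      unfolding interval_cbox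
      by (intro integrable_continuous continuous_intros continuous_on_compose2[OF cont])
        (use ray_in_ball in auto)
    have "integral {0..1} (\<lambda>t. ?Df (a + t *\<^sub>R (x - a)) (x - a)) =
        integral {0..1} (\<lambda>t. \<Sum>b\<in>Basis. ((x - a) \<bullet> b) *\<^sub>R ?Df (a + t *\<^sub>R (x - a)) b)"
      by (rule integral_cong) (rule has_derivative_Basis_expand[OF Df])
    also have "\<dots> = (\<Sum>b\<in>Basis. ((x - a) \<bullet> b) *\<^sub>R ?g b x)"
      using int by (subst integral_sum) (auto intro: integrable_cmul)
    finally show ?thesis using 1 by simp
  qed
qed

lemma smooth_on_cong:
  "open S \<Longrightarrow> (\<And>x. x \<in> S \<Longrightarrow> f x = g x) \<Longrightarrow> smooth_on S f \<Longrightarrow> smooth_on S g"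
  unfolding smooth_on_def using Ck_on_cong by blast

lemma smooth_on_subset: "T \<subseteq> S \<Longrightarrow> smooth_on S f \<Longrightarrow> smooth_on T f"
  unfolding smooth_on_def using Ck_on_subset by blast

lemma smooth_on_compose:
  fixes f :: "'b::real_normed_vector \<Rightarrow> 'c::euclidean_space" and g :: "'c \<Rightarrow> 'd::real_normed_vector"
  shows "open S \<Longrightarrow> smooth_on S f \<Longrightarrow> smooth_on T g \<Longrightarrow> f ` S \<subseteq> T \<Longrightarrow> smooth_on S (\<lambda>x. g (f x))"
  unfolding smooth_on_def using Ck_on_compose by blast

section \<open>Smooth functions on a complex manifold\<close>

locale complex_manifold =
  fixes A :: "('a::topological_space, 'n::finite) atlas"
  assumes atlas: "complex_atlas A"
begin

lemma chart_open: "(V, \<phi>) \<in> A \<Longrightarrow> open V"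
  and chart_homeomorphism: "(V, \<phi>) \<in> A \<Longrightarrow> homeomorphism V (\<phi> ` V) \<phi> (inv_into V \<phi>)"
  and chart_range_open: "(V, \<phi>) \<in> A \<Longrightarrow> open (\<phi> ` V)"
  using atlas unfolding complex_atlas_def by auto

lemma transition_holomorphic:
  "(V, \<phi>) \<in> A \<Longrightarrow> (W, \<psi>) \<in> A \<Longrightarrow> holomorphic_map_on (\<phi> ` (V \<inter> W)) (\<psi> \<circ> inv_into V \<phi>)"
  using atlas unfolding complex_atlas_def by fast

lemma chart_exists: obtains V \<phi> where "(V, \<phi>) \<in> A" "p \<in> V"
proof -
  have "p \<in> (\<Union>(V, \<phi>)\<in>A. V)" using atlas unfolding complex_atlas_def by auto
  then show thesis using that by blast
qed

lemma chart_inv: "(V, \<phi>) \<in> A \<Longrightarrow> p \<in> V \<Longrightarrow> inv_into V \<phi> (\<phi> p) = p"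
  using chart_homeomorphism by (auto simp: homeomorphism_def)

lemma chart_image_open:
  assumes "(V, \<phi>) \<in> A" "open U" shows "open (\<phi> ` (U \<inter> V))"
proof -
  have "openin (top_of_set (\<phi> ` V)) (\<phi> ` (U \<inter> V))"
    using assms openin_open_Int[of U V]
    by (intro homeomorphism_imp_open_map[OF chart_homeomorphism]) (auto simp: Int_commute)
  then show ?thesis using chart_range_open[OF assms(1)] openin_open_trans by blast
qed

lemma smooth_fun_subset: "smooth_fun A U f \<Longrightarrow> W \<subseteq> U \<Longrightarrow> smooth_fun A W f"
  unfolding smooth_fun_def
proof clarify
  fix V \<phi> assume "\<forall>(V, \<phi>)\<in>A. smooth_on (\<phi> ` (U \<inter> V)) (f \<circ> inv_into V \<phi>)" "(V, \<phi>) \<in> A" "W \<subseteq> U"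
  then show "smooth_on (\<phi> ` (W \<inter> V)) (f \<circ> inv_into V \<phi>)"
    by (intro smooth_on_subset[of "\<phi> ` (W \<inter> V)" "\<phi> ` (U \<inter> V)"] image_mono) auto
qed

lemma smooth_fun_cong:
  assumes "open U" "\<And>q. q \<in> U \<Longrightarrow> f q = g q" "smooth_fun A U f"
  shows "smooth_fun A U g"
  unfolding smooth_fun_def
proof clarify
  fix V \<phi> assume V: "(V, \<phi>) \<in> A"
  show "smooth_on (\<phi> ` (U \<inter> V)) (g \<circ> inv_into V \<phi>)"
  proof (rule smooth_on_cong[OF chart_image_open[OF V assms(1)]])
    show "smooth_on (\<phi> ` (U \<inter> V)) (f \<circ> inv_into V \<phi>)"
      using assms(3) V by (auto simp: smooth_fun_def)
  qed (use assms(2) V in \<open>auto simp: chart_inv\<close>)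
qed

lemma smooth_fun_local:
  assumes "\<And>p. p \<in> U \<Longrightarrow> \<exists>W. open W \<and> p \<in> W \<and> smooth_fun A W f"
  shows "smooth_fun A U f"
  unfolding smooth_fun_def smooth_on_def
proof (clarify intro!: Ck_on_local)
  fix V \<phi> k p assume V: "(V, \<phi>) \<in> A" "p \<in> U" "p \<in> V"
  obtain W where W: "open W" "p \<in> W" "smooth_fun A W f" using assms[OF V(2)] by blast
  then have "Ck_on k (\<phi> ` (W \<inter> V)) (f \<circ> inv_into V \<phi>)"
    using V by (auto simp: smooth_fun_def smooth_on_def)
  then show "\<exists>T. open T \<and> \<phi> p \<in> T \<and> Ck_on k T (f \<circ> inv_into V \<phi>)"
    using W V chart_image_open[of V \<phi> W] by blast
qed

text \<open>Coordinate changes are smooth, so inside one chart domain the other charts impose no further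
  condition.\<close>

lemma smooth_fun_chart:
  assumes V: "(V, \<phi>) \<in> A" and U: "open U" "U \<subseteq> V"
  shows "smooth_fun A U f \<longleftrightarrow> smooth_on (\<phi> ` U) (f \<circ> inv_into V \<phi>)"
proof
  assume "smooth_fun A U f"
  then show "smooth_on (\<phi> ` U) (f \<circ> inv_into V \<phi>)"
    using V U(2) unfolding smooth_fun_def by (auto simp: Int_absorb2)
next
  assume f: "smooth_on (\<phi> ` U) (f \<circ> inv_into V \<phi>)"
  show "smooth_fun A U f"
    unfolding smooth_fun_def
  proof clarify
    fix W \<psi> assume W: "(W, \<psi>) \<in> A"
    have op: "open (\<psi> ` (U \<inter> W))" using chart_image_open[OF W U(1)] .
    have "smooth_on (\<psi> ` (W \<inter> V)) (\<phi> \<circ> inv_into W \<psi>)"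
      using transition_holomorphic[OF W V] by (simp add: holomorphic_map_on_def)
    then have "smooth_on (\<psi> ` (U \<inter> W)) (\<phi> \<circ> inv_into W \<psi>)"
      by (rule smooth_on_subset[rotated]) (use U in auto)
    then have "smooth_on (\<psi> ` (U \<inter> W)) (\<lambda>x. (f \<circ> inv_into V \<phi>) ((\<phi> \<circ> inv_into W \<psi>) x))"
      by (rule smooth_on_compose[OF op _ f]) (use W in \<open>auto simp: chart_inv\<close>)
    then show "smooth_on (\<psi> ` (U \<inter> W)) (f \<circ> inv_into W \<psi>)"
      by (rule smooth_on_cong[OF op, rotated]) (use U V W in \<open>auto simp: chart_inv subset_iff\<close>)
  qed
qed

lemma smooth_fun_const [simp]: "open U \<Longrightarrow> smooth_fun A U (\<lambda>q. c)"
  unfolding smooth_fun_def smooth_on_def o_def by (auto intro!: Ck_on_const chart_image_open)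

lemma smooth_fun_add:
  "open U \<Longrightarrow> smooth_fun A U f \<Longrightarrow> smooth_fun A U g \<Longrightarrow> smooth_fun A U (\<lambda>q. f q + g q)"
  unfolding smooth_fun_def smooth_on_def o_def by (auto intro!: Ck_on_add chart_image_open)

lemma smooth_fun_mult:
  "open U \<Longrightarrow> smooth_fun A U f \<Longrightarrow> smooth_fun A U g \<Longrightarrow> smooth_fun A U (\<lambda>q. f q * g q)"
  unfolding smooth_fun_def smooth_on_def o_def
  by (auto intro!: Ck_on_bilinear[OF bounded_bilinear_mult] chart_image_open)

lemma smooth_fun_cnj: "open U \<Longrightarrow> smooth_fun A U f \<Longrightarrow> smooth_fun A U (\<lambda>q. cnj (f q))"
  unfolding smooth_fun_def smooth_on_def o_def
  by (auto intro!: Ck_on_linear[OF bounded_linear_cnj] chart_image_open)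

lemma smooth_fun_cmult: "open U \<Longrightarrow> smooth_fun A U f \<Longrightarrow> smooth_fun A U (\<lambda>q. c * f q)"
  by (intro smooth_fun_mult smooth_fun_const)

lemma smooth_fun_minus: "open U \<Longrightarrow> smooth_fun A U f \<Longrightarrow> smooth_fun A U (\<lambda>q. - f q)"
  using smooth_fun_cmult[of U f "-1"] by simp

lemma smooth_fun_diff:
  "open U \<Longrightarrow> smooth_fun A U f \<Longrightarrow> smooth_fun A U g \<Longrightarrow> smooth_fun A U (\<lambda>q. f q - g q)"
  using smooth_fun_add[OF _ _ smooth_fun_minus] by fastforce

lemma smooth_fun_sum:
  "open U \<Longrightarrow> (\<And>i. i \<in> I \<Longrightarrow> smooth_fun A U (f i)) \<Longrightarrow> smooth_fun A U (\<lambda>q. \<Sum>i\<in>I. f i q)"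
  by (induction I rule: infinite_finite_induct) (auto intro!: smooth_fun_add)

lemma smooth_atI: "open U \<Longrightarrow> p \<in> U \<Longrightarrow> smooth_fun A U f \<Longrightarrow> smooth_at A p f"
  unfolding smooth_at_def by blast

lemma smooth_atE:
  assumes "smooth_at A p f" "open W" "p \<in> W"
  obtains U where "open U" "p \<in> U" "U \<subseteq> W" "smooth_fun A U f"
proof -
  obtain U where "open U" "p \<in> U" "smooth_fun A U f" using assms unfolding smooth_at_def by blast
  then show thesis using that[of "U \<inter> W"] assms smooth_fun_subset[of U f "U \<inter> W"] by blast
qed

lemma smooth_at_common:
  assumes "smooth_at A p f" "smooth_at A p g" "open W" "p \<in> W"
  obtains U where "open U" "p \<in> U" "U \<subseteq> W" "smooth_fun A U f" "smooth_fun A U g"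
proof -
  obtain U1 where U1: "open U1" "p \<in> U1" "U1 \<subseteq> W" "smooth_fun A U1 f"
    using smooth_atE[OF assms(1,3,4)] .
  obtain U2 where "open U2" "p \<in> U2" "U2 \<subseteq> U1" "smooth_fun A U2 g"
    using smooth_atE[OF assms(2) U1(1,2)] .
  then show thesis using that[of U2] U1 smooth_fun_subset[of U1 f U2] by blast
qed

lemma smooth_at_add: "smooth_at A p f \<Longrightarrow> smooth_at A p g \<Longrightarrow> smooth_at A p (\<lambda>q. f q + g q)"
  by (rule smooth_at_common[of p f g UNIV]) (auto intro: smooth_atI smooth_fun_add)

lemma smooth_at_mult: "smooth_at A p f \<Longrightarrow> smooth_at A p g \<Longrightarrow> smooth_at A p (\<lambda>q. f q * g q)"
  by (rule smooth_at_common[of p f g UNIV]) (auto intro: smooth_atI smooth_fun_mult)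

lemma smooth_at_const [simp]: "smooth_at A p (\<lambda>q. c)"
  using smooth_atI[OF open_UNIV] by simp

lemma smooth_at_cmult: "smooth_at A p f \<Longrightarrow> smooth_at A p (\<lambda>q. c * f q)"
  by (intro smooth_at_mult smooth_at_const)

lemma smooth_at_cnj: "smooth_at A p f \<Longrightarrow> smooth_at A p (\<lambda>q. cnj (f q))"
  unfolding smooth_at_def using smooth_fun_cnj by blast

lemma smooth_at_cnj_iff: "smooth_at A p (\<lambda>q. cnj (f q)) \<longleftrightarrow> smooth_at A p f"
  using smooth_at_cnj[of p "\<lambda>q. cnj (f q)"] smooth_at_cnj[of p f] by auto

lemma smooth_at_sum: "(\<And>i. i \<in> I \<Longrightarrow> smooth_at A p (f i)) \<Longrightarrow> smooth_at A p (\<lambda>q. \<Sum>i\<in>I. f i q)"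
  by (induction I rule: infinite_finite_induct) (auto intro!: smooth_at_add)

section \<open>Tangent vectors as derivations\<close>

lemma tangent_nonsmooth: "v \<in> tangent A p \<Longrightarrow> \<not> smooth_at A p f \<Longrightarrow> v f = 0"
  unfolding tangent_def by blast

lemma tangent_germ':
  "v \<in> tangent A p \<Longrightarrow> smooth_at A p f \<Longrightarrow> smooth_at A p g \<Longrightarrow> \<forall>\<^sub>F q in nhds p. f q = g q \<Longrightarrow> v f = v g"
  by (simp add: tangent_def)

lemma tangent_germ:
  "v \<in> tangent A p \<Longrightarrow> open U \<Longrightarrow> p \<in> U \<Longrightarrow> smooth_fun A U f \<Longrightarrow> (\<And>q. q \<in> U \<Longrightarrow> f q = g q) \<Longrightarrow> v f = v g"
proof -
  assume *: "v \<in> tangent A p" "open U" "p \<in> U" "smooth_fun A U f" "\<And>q. q \<in> U \<Longrightarrow> f q = g q"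
  have "smooth_at A p f" "smooth_at A p g"
    using smooth_atI[OF *(2,3,4)] smooth_atI[OF *(2,3) smooth_fun_cong[OF *(2,5,4)]] by auto
  moreover have "\<forall>\<^sub>F q in nhds p. f q = g q"
    unfolding eventually_nhds using *(2,3,5) by (intro exI[of _ U]) simp
  ultimately show ?thesis by (rule tangent_germ'[OF *(1)])
qed

lemma tangent_add_fun:
  "v \<in> tangent A p \<Longrightarrow> smooth_at A p f \<Longrightarrow> smooth_at A p g \<Longrightarrow> v (\<lambda>q. f q + g q) = v f + v g"
  and tangent_mult_fun:
  "v \<in> tangent A p \<Longrightarrow> smooth_at A p f \<Longrightarrow> smooth_at A p g \<Longrightarrow>
     v (\<lambda>q. f q * g q) = f p * v g + g p * v f"
  and tangent_cmult_fun: "v \<in> tangent A p \<Longrightarrow> smooth_at A p f \<Longrightarrow> v (\<lambda>q. c * f q) = c * v f"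
  unfolding tangent_def mem_Collect_eq by (elim conjE, iprover)+

lemma tangent_const_fun:
  assumes "v \<in> tangent A p" shows "v (\<lambda>q. c) = 0"
proof -
  have "v (\<lambda>q. 1 * 1) = 1 * v (\<lambda>q. 1) + 1 * v (\<lambda>q. 1)"
    using tangent_mult_fun[OF assms, of "\<lambda>q. 1" "\<lambda>q. 1"] by simp
  then have "v (\<lambda>q. 1) = 0" by simp
  then show ?thesis using tangent_cmult_fun[OF assms, of "\<lambda>q. 1" c] by simp
qed

lemma tangent_minus_fun: "v \<in> tangent A p \<Longrightarrow> smooth_at A p f \<Longrightarrow> v (\<lambda>q. - f q) = - v f"
  using tangent_cmult_fun[of v p f "-1"] by simp

lemma tangent_diff_fun:
  "v \<in> tangent A p \<Longrightarrow> smooth_at A p f \<Longrightarrow> smooth_at A p g \<Longrightarrow> v (\<lambda>q. f q - g q) = v f - v g"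
  using tangent_add_fun[of v p f "\<lambda>q. -1 * g q"] smooth_at_cmult[of p g "-1"] tangent_minus_fun[of v p g]
  by simp

lemma tangent_sum_fun:
  assumes "v \<in> tangent A p" "\<And>i. i \<in> I \<Longrightarrow> smooth_at A p (f i)"
  shows "v (\<lambda>q. \<Sum>i\<in>I. f i q) = (\<Sum>i\<in>I. v (f i))"
  using assms(2)
  by (induction I rule: infinite_finite_induct)
    (auto simp: tangent_const_fun[OF assms(1)] tangent_add_fun[OF assms(1)] smooth_at_sum)

lemma tangentI:
  assumes "\<And>f. \<not> smooth_at A p f \<Longrightarrow> v f = 0"
    and "\<And>f g. smooth_at A p f \<Longrightarrow> smooth_at A p g \<Longrightarrow> \<forall>\<^sub>F q in nhds p. f q = g q \<Longrightarrow> v f = v g"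
    and "\<And>f g. smooth_at A p f \<Longrightarrow> smooth_at A p g \<Longrightarrow> v (\<lambda>q. f q + g q) = v f + v g"
    and "\<And>f g. smooth_at A p f \<Longrightarrow> smooth_at A p g \<Longrightarrow> v (\<lambda>q. f q * g q) = f p * v g + g p * v f"
    and "\<And>c f. smooth_at A p f \<Longrightarrow> v (\<lambda>q. c * f q) = c * v f"
  shows "v \<in> tangent A p"
  unfolding tangent_def
  by (intro CollectI conjI allI impI; (elim conjE)?; rule assms; assumption)

lemma tangent_sum:
  assumes "\<And>i. i \<in> I \<Longrightarrow> v i \<in> tangent A p"
  shows "(\<lambda>f. \<Sum>i\<in>I. c i * v i f) \<in> tangent A p"
proof -
  note v = assms
  show ?thesis
  proof (rule tangentI)
    fix f g assume fg: "smooth_at A p f" "smooth_at A p g"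
    show "(\<Sum>i\<in>I. c i * v i f) = (\<Sum>i\<in>I. c i * v i g)" if "\<forall>\<^sub>F q in nhds p. f q = g q"
      by (intro sum.cong refl arg_cong[where f = "\<lambda>x. c _ * x"] tangent_germ'[OF v fg that])
    show "(\<Sum>i\<in>I. c i * v i (\<lambda>q. f q + g q)) = (\<Sum>i\<in>I. c i * v i f) + (\<Sum>i\<in>I. c i * v i g)"
      by (simp add: tangent_add_fun[OF v fg] distrib_left sum.distrib cong: sum.cong)
    show "(\<Sum>i\<in>I. c i * v i (\<lambda>q. f q * g q)) = f p * (\<Sum>i\<in>I. c i * v i g) + g p * (\<Sum>i\<in>I. c i * v i f)"
      by (simp add: tangent_mult_fun[OF v fg] algebra_simps sum.distrib sum_distrib_left cong: sum.cong)
    show "(\<Sum>i\<in>I. c i * v i (\<lambda>q. d * f q)) = d * (\<Sum>i\<in>I. c i * v i f)" for d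
      by (simp add: tangent_cmult_fun[OF v fg(1)] algebra_simps sum_distrib_left cong: sum.cong)
  qed (simp add: tangent_nonsmooth[OF v])
qed

lemma tangent_lin2:
  assumes "v \<in> tangent A p" "w \<in> tangent A p"
  shows "(\<lambda>f. c * v f + d * w f) \<in> tangent A p"
  using tangent_sum[of "UNIV::bool set" "\<lambda>b. if b then v else w" p "\<lambda>b. if b then c else d"] assms
  by (simp add: UNIV_bool add.commute)

lemma tangent_add: "v \<in> tangent A p \<Longrightarrow> w \<in> tangent A p \<Longrightarrow> v + w \<in> tangent A p"
  using tangent_lin2[of v p w 1 1] by (simp add: plus_fun_def)

lemma tangent_scale: "v \<in> tangent A p \<Longrightarrow> (\<lambda>f. c * v f) \<in> tangent A p"
  using tangent_lin2[of v p v c 0] by simp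

lemma tangent_zero: "0 \<in> tangent A p"
  using tangent_sum[of "{}" _ p] by (simp add: zero_fun_def)

lemma tangent_uminus: "v \<in> tangent A p \<Longrightarrow> - v \<in> tangent A p"
  using tangent_scale[of v p "-1"] by (simp add: fun_Compl_def)

lemma tangent_diff: "v \<in> tangent A p \<Longrightarrow> w \<in> tangent A p \<Longrightarrow> v - w \<in> tangent A p"
  using tangent_add[OF _ tangent_uminus] by fastforce

lemma tangent_cnj:
  assumes v: "v \<in> tangent A p" shows "cnj_vec v \<in> tangent A p"
  unfolding cnj_vec_def
proof (rule tangentI)
  fix f g assume fg: "smooth_at A p f" "smooth_at A p g"
  note fg' = smooth_at_cnj[OF fg(1)] smooth_at_cnj[OF fg(2)]
  show "cnj (v (\<lambda>q. cnj (f q))) = cnj (v (\<lambda>q. cnj (g q)))" if "\<forall>\<^sub>F q in nhds p. f q = g q"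
    by (rule arg_cong[OF tangent_germ'[OF v fg']]) (rule eventually_mono[OF that], simp)
  show "cnj (v (\<lambda>q. cnj (c * f q))) = c * cnj (v (\<lambda>q. cnj (f q)))" for c
    using tangent_cmult_fun[OF v fg'(1), of "cnj c"] by simp
qed (simp_all add: smooth_at_cnj smooth_at_cnj_iff tangent_nonsmooth[OF v] tangent_add_fun[OF v]
      tangent_mult_fun[OF v])

section \<open>Coordinate frames\<close>

text \<open>The functions \<open>z\<^sub>k\<close> and their conjugates serve as coordinates for the complexified tangent
  bundle; the index type is a sum of two copies of the index type of the chart, the left one for \<open>z\<^sub>k\<close>
  and the right one for its conjugate.\<close>

definition coord :: "('a \<Rightarrow> complex ^ 'n) \<Rightarrow> 'n + 'n \<Rightarrow> 'a \<Rightarrow> complex" where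
  "coord \<phi> i q = (case i of Inl k \<Rightarrow> \<phi> q $ k | Inr k \<Rightarrow> cnj (\<phi> q $ k))"

definition directional ::
    "'a set \<Rightarrow> ('a \<Rightarrow> complex ^ 'n) \<Rightarrow> complex ^ 'n \<Rightarrow> 'a \<Rightarrow> 'a tvec" where
  "directional V \<phi> b p f =
     (if smooth_at A p f then frechet_derivative (f \<circ> inv_into V \<phi>) (at (\<phi> p)) b else 0)"

text \<open>The Wirtinger derivatives, dual to \<open>coord\<close>: one half of \<open>\<partial>/\<partial>x\<^sub>k - i \<partial>/\<partial>y\<^sub>k\<close> for \<open>Inl k\<close> and of
  \<open>\<partial>/\<partial>x\<^sub>k + i \<partial>/\<partial>y\<^sub>k\<close> for \<open>Inr k\<close>.\<close>

definition frame :: "'a set \<Rightarrow> ('a \<Rightarrow> complex ^ 'n) \<Rightarrow> 'n + 'n \<Rightarrow> 'a \<Rightarrow> 'a tvec" where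
  "frame V \<phi> i p f =
     (case i of
        Inl k \<Rightarrow> 1/2 * directional V \<phi> (axis k 1) p f + (- \<i>/2) * directional V \<phi> (axis k \<i>) p f
      | Inr k \<Rightarrow> 1/2 * directional V \<phi> (axis k 1) p f + \<i>/2 * directional V \<phi> (axis k \<i>) p f)"

lemma has_derivative_in_chart:
  assumes V: "(V, \<phi>) \<in> A" "p \<in> V" and f: "smooth_at A p f"
  shows "((f \<circ> inv_into V \<phi>) has_derivative frechet_derivative (f \<circ> inv_into V \<phi>) (at (\<phi> p))) (at (\<phi> p))"
proof -
  obtain U where U: "open U" "p \<in> U" "U \<subseteq> V" "smooth_fun A U f"
    using smooth_atE[OF f chart_open[OF V(1)] V(2)] .
  then have "smooth_on (\<phi> ` U) (f \<circ> inv_into V \<phi>)"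
    using smooth_fun_chart[OF V(1)] by blast
  then show ?thesis by (rule smooth_on_has_derivative) (use U in auto)
qed

lemma directional_eq:
  assumes V: "(V, \<phi>) \<in> A" "p \<in> V" and f: "smooth_at A p f"
    and "((f \<circ> inv_into V \<phi>) has_derivative D) (at (\<phi> p))"
  shows "directional V \<phi> b p f = D b"
  unfolding directional_def using f frechet_derivative_eq[OF assms(4)] by simp

lemma directional_tangent:
  assumes V: "(V, \<phi>) \<in> A" "p \<in> V"
  shows "directional V \<phi> b p \<in> tangent A p"
proof (rule tangentI)
  fix f assume "\<not> smooth_at A p f"
  then show "directional V \<phi> b p f = 0" by (simp add: directional_def)
next
  fix f g assume f: "smooth_at A p f" and g: "smooth_at A p g"
  let ?D = "\<lambda>f. frechet_derivative (f \<circ> inv_into V \<phi>) (at (\<phi> p))"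
  note Df = has_derivative_in_chart[OF V f] and Dg = has_derivative_in_chart[OF V g]
  note ef = directional_eq[OF V f Df] and eg = directional_eq[OF V g Dg]
  show "directional V \<phi> b p (\<lambda>q. f q + g q) = directional V \<phi> b p f + directional V \<phi> b p g"
    unfolding ef eg
    by (rule directional_eq[OF V smooth_at_add[OF f g], where D = "\<lambda>b. ?D f b + ?D g b"])
      (use has_derivative_add[OF Df Dg] in \<open>simp add: o_def\<close>)
  have p: "inv_into V \<phi> (\<phi> p) = p" using chart_inv[OF V] .
  show "directional V \<phi> b p (\<lambda>q. f q * g q) = f p * directional V \<phi> b p g + g p * directional V \<phi> b p f"
    unfolding ef eg
    by (rule directional_eq[OF V smooth_at_mult[OF f g], where D = "\<lambda>b. f p * ?D g b + g p * ?D f b"])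
      (use has_derivative_mult[OF Df Dg] in \<open>simp add: o_def p mult.commute\<close>)
  show "directional V \<phi> b p (\<lambda>q. c * f q) = c * directional V \<phi> b p f" for c
    unfolding ef
    by (rule directional_eq[OF V smooth_at_cmult[OF f], where D = "\<lambda>b. c * ?D f b"])
      (use has_derivative_mult_right[OF Df, of c] in \<open>simp add: o_def\<close>)
  show "directional V \<phi> b p f = directional V \<phi> b p g" if ev: "\<forall>\<^sub>F q in nhds p. f q = g q"
  proof -
    obtain U where U: "open U" "p \<in> U" "\<And>q. q \<in> U \<Longrightarrow> f q = g q"
      using ev unfolding eventually_nhds by blast
    have "((g \<circ> inv_into V \<phi>) has_derivative ?D f) (at (\<phi> p))"
      by (rule has_derivative_transform_within_open[OF Df chart_image_open[OF V(1) U(1)]])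
        (use U V in \<open>auto simp: chart_inv\<close>)
    from directional_eq[OF V g this] show ?thesis unfolding ef by simp
  qed
qed

lemma frame_tangent: "(V, \<phi>) \<in> A \<Longrightarrow> p \<in> V \<Longrightarrow> frame V \<phi> i p \<in> tangent A p"
  unfolding frame_def[abs_def]
  by (cases i; simp only: sum.case; rule tangent_lin2; rule directional_tangent; assumption)

lemma coord_smooth: assumes V: "(V, \<phi>) \<in> A" shows "smooth_fun A V (coord \<phi> i)"
proof -
  let ?L = "\<lambda>x::complex^'n. case i of Inl k \<Rightarrow> x $ k | Inr k \<Rightarrow> cnj (x $ k)"
  have "bounded_linear ?L"
    by (cases i) (auto intro: bounded_linear_vec_nth bounded_linear_compose[OF bounded_linear_cnj])
  then have "smooth_on (\<phi> ` V) ?L"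
    unfolding smooth_on_def using Ck_on_linear[OF _ chart_range_open[OF V] Ck_on_id[OF chart_range_open[OF V]]]
    by blast
  then have "smooth_on (\<phi> ` V) (coord \<phi> i \<circ> inv_into V \<phi>)"
    by (rule smooth_on_cong[OF chart_range_open[OF V], rotated])
      (auto simp: coord_def chart_inv[OF V] split: sum.splits)
  then show ?thesis using smooth_fun_chart[OF V chart_open[OF V]] by simp
qed

lemma coord_smooth_at: "(V, \<phi>) \<in> A \<Longrightarrow> p \<in> V \<Longrightarrow> smooth_at A p (coord \<phi> i)"
  using coord_smooth smooth_atI chart_open by blast

lemma directional_coord:
  assumes V: "(V, \<phi>) \<in> A" "p \<in> V"
  shows "directional V \<phi> b p (coord \<phi> i) = (case i of Inl k \<Rightarrow> b $ k | Inr k \<Rightarrow> cnj (b $ k))"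
proof -
  let ?L = "\<lambda>x::complex^'n. case i of Inl k \<Rightarrow> x $ k | Inr k \<Rightarrow> cnj (x $ k)"
  have "bounded_linear ?L"
    by (cases i) (auto intro: bounded_linear_vec_nth bounded_linear_compose[OF bounded_linear_cnj])
  then have "(?L has_derivative ?L) (at (\<phi> p))"
    by (rule bounded_linear_imp_has_derivative)
  then have "((coord \<phi> i \<circ> inv_into V \<phi>) has_derivative ?L) (at (\<phi> p))"
    by (rule has_derivative_transform_within_open[OF _ chart_range_open[OF V(1)]])
      (use V in \<open>auto simp: coord_def chart_inv split: sum.splits\<close>)
  then show ?thesis by (rule directional_eq[OF V coord_smooth_at[OF V]])
qed

lemma frame_coord:
  assumes V: "(V, \<phi>) \<in> A" "p \<in> V"
  shows "frame V \<phi> i p (coord \<phi> j) = (if i = j then 1 else 0)"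
  by (cases i; cases j) (auto simp: frame_def directional_coord[OF V] axis_def)

lemma directional_smooth:
  assumes V: "(V, \<phi>) \<in> A" and W: "open W" "W \<subseteq> V" and f: "smooth_fun A W f"
  shows "smooth_fun A W (\<lambda>p. directional V \<phi> b p f)"
proof -
  have op: "open (\<phi> ` W)" using chart_image_open[OF V W(1)] W(2) by (simp add: Int_absorb2)
  have "smooth_on (\<phi> ` W) (f \<circ> inv_into V \<phi>)" using f smooth_fun_chart[OF V W] by simp
  from smooth_on_derivative[OF this, of b]
  have "smooth_on (\<phi> ` W) ((\<lambda>p. directional V \<phi> b p f) \<circ> inv_into V \<phi>)"
  proof (rule smooth_on_cong[OF op, rotated])
    fix x assume "x \<in> \<phi> ` W"
    then obtain p where p: "p \<in> W" "x = \<phi> p" by auto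
    then have "smooth_at A p f" using f W smooth_atI by blast
    then show "frechet_derivative (f \<circ> inv_into V \<phi>) (at x) b =
        ((\<lambda>p. directional V \<phi> b p f) \<circ> inv_into V \<phi>) x"
      using p W chart_inv[OF V, of p] by (auto simp: directional_def)
  qed
  then show ?thesis using smooth_fun_chart[OF V W] by simp
qed

lemma frame_vector_field:
  assumes V: "(V, \<phi>) \<in> A" shows "vector_field A V (frame V \<phi> i)"
  unfolding vector_field_def
proof (intro conjI ballI allI impI; (elim conjE)?)
  fix W f assume W: "open W" "W \<subseteq> V" "smooth_fun A W f"
  show "smooth_fun A W (\<lambda>p. frame V \<phi> i p f)"
    unfolding frame_def using directional_smooth[OF V W] W(1)
    by (cases i; simp only: sum.case) (intro smooth_fun_add smooth_fun_cmult, assumption+)+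
qed (use V frame_tangent in auto)

lemma sum_Basis_complex_vec:
  "(\<Sum>b\<in>(Basis :: (complex ^ 'n) set). h b) = (\<Sum>k\<in>UNIV. h (axis k 1) + h (axis k \<i>))"
proof -
  have B: "(Basis :: (complex ^ 'n) set) = (\<lambda>(k, u). axis k u) ` (UNIV \<times> {1, \<i>})"
    by (auto simp: Basis_vec_def Basis_complex_def)
  have inj: "inj_on (\<lambda>(k, u). axis k u :: complex ^ 'n) (UNIV \<times> {1, \<i>})"
    by (auto simp: inj_on_def axis_eq_axis)
  have "sum h Basis = (\<Sum>(k, u)\<in>UNIV \<times> {1, \<i>}. h (axis k u))"
    unfolding B sum.reindex[OF inj] by (simp add: o_def split_beta)
  also have "\<dots> = (\<Sum>k\<in>UNIV. \<Sum>u\<in>{1, \<i>}. h (axis k u))"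
    by (rule sum.cartesian_product[symmetric])
  finally show ?thesis by (simp add: complex_eq_iff)
qed

text \<open>Near \<open>p\<close>, Hadamard's lemma gives \<open>f = f p + \<Sum>\<^sub>b X\<^sub>b G\<^sub>b\<close> with \<open>X\<^sub>b\<close> vanishing at \<open>p\<close>. A derivation kills the
  constant, and the product rule leaves only \<open>v X\<^sub>b\<close> times the value \<open>G\<^sub>b p\<close>, a partial derivative
  of \<open>f\<close>.\<close>

lemma tangent_expand_real:
  assumes V: "(V, \<phi>) \<in> A" "p \<in> V" and v: "v \<in> tangent A p" and f: "smooth_at A p f"
  shows "v f = (\<Sum>b\<in>Basis. v (\<lambda>q. of_real (\<phi> q \<bullet> b)) * directional V \<phi> b p f)"
proof -
  let ?F = "f \<circ> inv_into V \<phi>" and ?a = "\<phi> p"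
  obtain U where U: "open U" "p \<in> U" "U \<subseteq> V" "smooth_fun A U f"
    using smooth_atE[OF f chart_open[OF V(1)] V(2)] .
  have F: "smooth_on (\<phi> ` U) ?F" using smooth_fun_chart[OF V(1) U(1,3)] U(4) by simp
  have "open (\<phi> ` U)" using chart_image_open[OF V(1) U(1)] U(3) by (simp add: Int_absorb2)
  then obtain r where r: "r > 0" "ball ?a r \<subseteq> \<phi> ` U"
    using U(2) open_contains_ball by blast
  obtain g where g: "\<And>b. smooth_on (ball ?a r) (g b)"
      "\<And>x. x \<in> ball ?a r \<Longrightarrow> ?F x = ?F ?a + (\<Sum>b\<in>Basis. ((x - ?a) \<bullet> b) *\<^sub>R g b x)"
      "\<And>b. g b ?a = frechet_derivative ?F (at ?a) b"
    using Hadamard_lemma[OF smooth_on_subset[OF r(2) F] r(1)] by blast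
  define B where "B = V \<inter> \<phi> -` ball ?a r"
  have cont: "continuous_on V \<phi>" using chart_homeomorphism[OF V(1)] by (simp add: homeomorphism_def)
  have B: "open B" "p \<in> B" "B \<subseteq> V"
    unfolding B_def using continuous_open_preimage[OF cont chart_open[OF V(1)] open_ball] V(2) r(1) by auto
  have opB: "open (\<phi> ` B)" using chart_image_open[OF V(1) B(1)] B(3) by (simp add: Int_absorb2)
  have \<phi>B: "\<phi> ` B \<subseteq> ball ?a r" by (auto simp: B_def)
  define G where "G = (\<lambda>b q. g b (\<phi> q))"
  define X where "X = (\<lambda>b q. complex_of_real ((\<phi> q - ?a) \<bullet> b))"
  have G: "smooth_fun A B (G b)" for b
  proof -
    have "smooth_on (\<phi> ` B) (G b \<circ> inv_into V \<phi>)"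
      by (rule smooth_on_cong[OF opB _ smooth_on_subset[OF \<phi>B g(1)[of b]]])
        (use B in \<open>auto simp: G_def chart_inv[OF V(1)] subset_iff\<close>)
    then show ?thesis using smooth_fun_chart[OF V(1) B(1,3)] by simp
  qed
  have lin: "smooth_fun A B (\<lambda>q. complex_of_real (\<phi> q \<bullet> b))" for b
  proof -
    have "bounded_linear (\<lambda>x. complex_of_real (x \<bullet> b))"
      by (intro bounded_linear_compose[OF bounded_linear_of_real] bounded_linear_inner_left)
    then have "smooth_on (\<phi> ` B) (\<lambda>x. complex_of_real (x \<bullet> b))"
      unfolding smooth_on_def using Ck_on_linear[OF _ opB Ck_on_id[OF opB]] by blast
    then have "smooth_on (\<phi> ` B) ((\<lambda>q. complex_of_real (\<phi> q \<bullet> b)) \<circ> inv_into V \<phi>)"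
      by (rule smooth_on_cong[OF opB, rotated]) (use B in \<open>auto simp: chart_inv[OF V(1)] subset_iff\<close>)
    then show ?thesis using smooth_fun_chart[OF V(1) B(1,3)] by simp
  qed
  have X_eq: "X b = (\<lambda>q. complex_of_real (\<phi> q \<bullet> b) - complex_of_real (?a \<bullet> b))" for b
    by (simp add: X_def inner_diff_left)
  have X: "smooth_fun A B (X b)" for b
    unfolding X_eq by (intro smooth_fun_diff smooth_fun_const lin B)
  note sm = smooth_atI[OF B(1,2)]
  have sXG: "smooth_at A p (\<lambda>q. X b q * G b q)" for b
    by (intro smooth_at_mult sm X G)
  have vX: "v (X b) = v (\<lambda>q. complex_of_real (\<phi> q \<bullet> b))" for b
    unfolding X_eq
    using tangent_diff_fun[OF v sm[OF lin] smooth_at_const] tangent_const_fun[OF v] by simp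
  have vXG: "v (\<lambda>q. X b q * G b q) = v (\<lambda>q. complex_of_real (\<phi> q \<bullet> b)) * directional V \<phi> b p f" for b
    using tangent_mult_fun[OF v sm[OF X] sm[OF G], of b b] g(3)[of b] f
    by (simp add: vX) (simp add: X_def G_def directional_def)
  have f_eq: "f q = f p + (\<Sum>b\<in>Basis. X b q * G b q)" if "q \<in> B" for q
    using g(2)[of "\<phi> q"] that V(2)
    by (simp add: B_def X_def G_def chart_inv[OF V(1)] scaleR_conv_of_real)
  have "v f = v (\<lambda>q. f p + (\<Sum>b\<in>Basis. X b q * G b q))"
  proof (rule tangent_germ[OF v])
    show "open (B \<inter> U)" "p \<in> B \<inter> U" using B U by auto
    show "smooth_fun A (B \<inter> U) f" using U(4) by (rule smooth_fun_subset) auto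
  qed (use f_eq in auto)
  also have "\<dots> = (\<Sum>b\<in>Basis. v (\<lambda>q. X b q * G b q))"
    using tangent_add_fun[OF v smooth_at_const smooth_at_sum, of Basis "\<lambda>b q. X b q * G b q" "f p"]
      tangent_sum_fun[OF v, of Basis "\<lambda>b q. X b q * G b q"] sXG tangent_const_fun[OF v, of "f p"]
    by simp
  finally show ?thesis by (simp add: vXG)
qed

lemma of_real_coord:
  "(\<lambda>q. complex_of_real (Re (\<phi> q $ k))) = (\<lambda>q. 1/2 * (coord \<phi> (Inl k) q + coord \<phi> (Inr k) q))"
  "(\<lambda>q. complex_of_real (Im (\<phi> q $ k))) = (\<lambda>q. (- \<i>/2) * (coord \<phi> (Inl k) q - coord \<phi> (Inr k) q))"
  by (auto simp: coord_def complex_eq_iff)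

lemma tangent_Re_Im_coord:
  assumes V: "(V, \<phi>) \<in> A" "p \<in> V" and v: "v \<in> tangent A p"
  shows "v (\<lambda>q. complex_of_real (Re (\<phi> q $ k))) = 1/2 * (v (coord \<phi> (Inl k)) + v (coord \<phi> (Inr k)))"
    and "v (\<lambda>q. complex_of_real (Im (\<phi> q $ k))) = (- \<i>/2) * (v (coord \<phi> (Inl k)) - v (coord \<phi> (Inr k)))"
proof -
  note s = coord_smooth_at[OF V]
  show "v (\<lambda>q. complex_of_real (Re (\<phi> q $ k))) = 1/2 * (v (coord \<phi> (Inl k)) + v (coord \<phi> (Inr k)))"
    unfolding of_real_coord tangent_cmult_fun[OF v smooth_at_add[OF s s]] tangent_add_fun[OF v s s] ..
  have "smooth_at A p (\<lambda>q. coord \<phi> (Inl k) q - coord \<phi> (Inr k) q)"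
    using smooth_at_add[OF s smooth_at_cmult[OF s, of "-1"], of "Inl k" "Inr k"] by simp
  then show "v (\<lambda>q. complex_of_real (Im (\<phi> q $ k))) = (- \<i>/2) * (v (coord \<phi> (Inl k)) - v (coord \<phi> (Inr k)))"
    unfolding of_real_coord tangent_diff_fun[OF v s s, symmetric] by (rule tangent_cmult_fun[OF v])
qed

lemma sum_UNIV_Plus: "(\<Sum>i\<in>UNIV. h i) = (\<Sum>k\<in>UNIV. h (Inl k)) + (\<Sum>k\<in>UNIV. h (Inr k))"
  for h :: "'n + 'n \<Rightarrow> 'c::comm_monoid_add"
  by (subst UNIV_Plus_UNIV[symmetric], subst sum.Plus) auto

text \<open>The real expansion rewritten in Wirtinger derivatives. It makes the tangent space finite-dimensional, and
  all later uniqueness arguments rest on it: a tangent vector is determined by its values on the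
  coordinates.\<close>

lemma tangent_expand:
  assumes V: "(V, \<phi>) \<in> A" "p \<in> V" and v: "v \<in> tangent A p"
  shows "v = (\<lambda>f. \<Sum>i\<in>UNIV. v (coord \<phi> i) * frame V \<phi> i p f)"
proof
  fix f
  show "v f = (\<Sum>i\<in>UNIV. v (coord \<phi> i) * frame V \<phi> i p f)"
  proof (cases "smooth_at A p f")
    case False
    then show ?thesis
      using tangent_nonsmooth[OF v False] tangent_nonsmooth[OF frame_tangent[OF V] False] by simp
  next
    case True
    have "v f = (\<Sum>b\<in>Basis. v (\<lambda>q. of_real (\<phi> q \<bullet> b)) * directional V \<phi> b p f)"
      by (rule tangent_expand_real[OF V v True])
    also have "\<dots> = (\<Sum>k\<in>UNIV. v (\<lambda>q. of_real (Re (\<phi> q $ k))) * directional V \<phi> (axis k 1) p f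
        + v (\<lambda>q. of_real (Im (\<phi> q $ k))) * directional V \<phi> (axis k \<i>) p f)"
      by (simp add: sum_Basis_complex_vec inner_axis inner_complex_def)
    also have "\<dots> = (\<Sum>k\<in>UNIV. v (coord \<phi> (Inl k)) * frame V \<phi> (Inl k) p f +
        v (coord \<phi> (Inr k)) * frame V \<phi> (Inr k) p f)"
      unfolding tangent_Re_Im_coord[OF V v]
      by (intro sum.cong refl) (simp add: frame_def field_simps)
    finally show ?thesis by (simp add: sum_UNIV_Plus sum.distrib)
  qed
qed

lemma tangent_eqI:
  assumes V: "(V, \<phi>) \<in> A" "p \<in> V" and "v \<in> tangent A p" "w \<in> tangent A p"
    and "\<And>i. v (coord \<phi> i) = w (coord \<phi> i)"
  shows "v = w"
  using tangent_expand[OF V assms(3)] tangent_expand[OF V assms(4)] assms(5) by simp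

section \<open>Vector fields\<close>

lemma vf_tangent: "vector_field A U Z \<Longrightarrow> p \<in> U \<Longrightarrow> Z p \<in> tangent A p"
  unfolding vector_field_def by simp

lemma vf_smooth:
  "vector_field A U Z \<Longrightarrow> open W \<Longrightarrow> W \<subseteq> U \<Longrightarrow> smooth_fun A W f \<Longrightarrow> smooth_fun A W (\<lambda>p. Z p f)"
  unfolding vector_field_def by simp

lemma vector_fieldI:
  assumes "\<And>p. p \<in> U \<Longrightarrow> Z p \<in> tangent A p"
    and "\<And>W f. open W \<Longrightarrow> W \<subseteq> U \<Longrightarrow> smooth_fun A W f \<Longrightarrow> smooth_fun A W (\<lambda>p. Z p f)"
  shows "vector_field A U Z"
  unfolding vector_field_def using assms by simp

lemma vf_subset: "vector_field A U Z \<Longrightarrow> W \<subseteq> U \<Longrightarrow> vector_field A W Z"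
  by (rule vector_fieldI) (auto intro: vf_tangent vf_smooth)

lemma vf_cong:
  assumes "\<And>p. p \<in> U \<Longrightarrow> Z p = Z' p" "vector_field A U Z"
  shows "vector_field A U Z'"
proof (rule vector_fieldI)
  fix W f assume W: "open W" "W \<subseteq> U" "smooth_fun A W f"
  show "smooth_fun A W (\<lambda>p. Z' p f)"
    by (rule smooth_fun_cong[OF W(1) _ vf_smooth[OF assms(2) W]]) (use assms(1) W(2) in auto)
next
  fix p assume "p \<in> U"
  then show "Z' p \<in> tangent A p" using vf_tangent[OF assms(2)] assms(1) by metis
qed

lemma vf_local:
  assumes "\<And>p. p \<in> U \<Longrightarrow> \<exists>W. open W \<and> p \<in> W \<and> vector_field A W Z"
  shows "vector_field A U Z"
proof (rule vector_fieldI)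
  fix p assume "p \<in> U" then show "Z p \<in> tangent A p" using assms vf_tangent by blast
next
  fix T f assume T: "open T" "T \<subseteq> U" "smooth_fun A T f"
  show "smooth_fun A T (\<lambda>p. Z p f)"
  proof (rule smooth_fun_local)
    fix p assume p: "p \<in> T"
    then obtain W where W: "open W" "p \<in> W" "vector_field A W Z" using assms T by blast
    have "smooth_fun A (W \<inter> T) (\<lambda>p. Z p f)"
      using W T by (intro vf_smooth[OF W(3)]) (auto intro: smooth_fun_subset)
    then show "\<exists>W. open W \<and> p \<in> W \<and> smooth_fun A W (\<lambda>p. Z p f)"
      using W T p by (intro exI[of _ "W \<inter> T"]) auto
  qed
qed

lemma vf_sum:
  assumes "\<And>i. i \<in> I \<Longrightarrow> smooth_fun A U (g i)" "\<And>i. i \<in> I \<Longrightarrow> vector_field A U (Z i)"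
  shows "vector_field A U (\<lambda>p f. \<Sum>i\<in>I. g i p * Z i p f)"
proof (rule vector_fieldI)
  fix p assume "p \<in> U" then show "(\<lambda>f. \<Sum>i\<in>I. g i p * Z i p f) \<in> tangent A p"
    by (intro tangent_sum vf_tangent[OF assms(2)])
next
  fix W f assume W: "open W" "W \<subseteq> U" "smooth_fun A W f"
  show "smooth_fun A W (\<lambda>p. \<Sum>i\<in>I. g i p * Z i p f)"
    by (intro smooth_fun_sum smooth_fun_mult smooth_fun_subset[OF assms(1)] vf_smooth[OF assms(2)] W)
qed

lemma vf_lin2:
  assumes "smooth_fun A U g" "vector_field A U Z" "smooth_fun A U h" "vector_field A U W"
  shows "vector_field A U (\<lambda>p f. g p * Z p f + h p * W p f)"
  using vf_sum[of "UNIV :: bool set" U "\<lambda>b. if b then g else h" "\<lambda>b. if b then Z else W"] assms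
  by (simp add: UNIV_bool add.commute)

lemma vf_scale: "smooth_fun A U g \<Longrightarrow> vector_field A U Z \<Longrightarrow> vector_field A U (\<lambda>p f. g p * Z p f)"
  using vf_sum[of "{()}" U "\<lambda>_. g" "\<lambda>_. Z"] by simp

lemma vf_add:
  "open U \<Longrightarrow> vector_field A U Z \<Longrightarrow> vector_field A U W \<Longrightarrow> vector_field A U (\<lambda>p. Z p + W p)"
  using vf_lin2[of U "\<lambda>_. 1" Z "\<lambda>_. 1" W] by (simp add: plus_fun_def)

lemma vf_uminus: "open U \<Longrightarrow> vector_field A U Z \<Longrightarrow> vector_field A U (\<lambda>p. - Z p)"
  using vf_scale[of U "\<lambda>_. -1" Z] by (simp add: fun_Compl_def)

lemma vf_diff:
  "open U \<Longrightarrow> vector_field A U Z \<Longrightarrow> vector_field A U W \<Longrightarrow> vector_field A U (\<lambda>p. Z p - W p)"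
  using vf_add[OF _ _ vf_uminus, of U Z W] by simp

lemma vf_zero: "open U \<Longrightarrow> vector_field A U (\<lambda>p. 0)"
  using vf_sum[of "{}" U] by (simp add: zero_fun_def)

text \<open>Near each point the field is a combination of frame fields with these functions as
  coefficients.\<close>

lemma vf_components:
  assumes Z: "\<And>p. p \<in> U \<Longrightarrow> Z p \<in> tangent A p" and "open U"
    and "\<And>p. p \<in> U \<Longrightarrow> \<exists>(V, \<phi>)\<in>A. p \<in> V \<and> (\<forall>i. smooth_fun A (U \<inter> V) (\<lambda>q. Z q (coord \<phi> i)))"
  shows "vector_field A U Z"
proof (rule vf_local)
  fix p assume p: "p \<in> U"
  then obtain V \<phi> where V: "(V, \<phi>) \<in> A" "p \<in> V" "\<And>i. smooth_fun A (U \<inter> V) (\<lambda>q. Z q (coord \<phi> i))"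
    using assms(3) by blast
  have "vector_field A (U \<inter> V) (\<lambda>q f. \<Sum>i\<in>UNIV. Z q (coord \<phi> i) * frame V \<phi> i q f)"
    by (intro vf_sum V vf_subset[OF frame_vector_field[OF V(1)]]) auto
  then have "vector_field A (U \<inter> V) Z"
    by (rule vf_cong[rotated]) (use tangent_expand[OF V(1) _ Z] in auto)
  then show "\<exists>W. open W \<and> p \<in> W \<and> vector_field A W Z"
    using p V(2) chart_open[OF V(1)] \<open>open U\<close> by blast
qed

lemma vf_coord_smooth:
  "(V, \<phi>) \<in> A \<Longrightarrow> vector_field A U Z \<Longrightarrow> open U \<Longrightarrow> smooth_fun A (U \<inter> V) (\<lambda>q. Z q (coord \<phi> i))"
  by (rule vf_smooth) (auto intro: chart_open smooth_fun_subset[OF coord_smooth])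

lemma vf_smooth_at:
  assumes "open U" "p \<in> U" "vector_field A U Z" "smooth_at A p f"
  shows "smooth_at A p (\<lambda>q. Z q f)"
proof -
  obtain W where W: "open W" "p \<in> W" "W \<subseteq> U" "smooth_fun A W f"
    using smooth_atE[OF assms(4,1,2)] .
  show ?thesis by (rule smooth_atI[OF W(1,2) vf_smooth[OF assms(3) W(1,3,4)]])
qed

subsection \<open>The bracket of vector fields\<close>

lemma vf_bracket_apply:
  "smooth_at A p f \<Longrightarrow> vf_bracket A Z W p f = Z p (\<lambda>q. W q f) - W p (\<lambda>q. Z q f)"
  by (simp add: vf_bracket_def)

lemma vf_bracket_commute: "vf_bracket A W Z p = - vf_bracket A Z W p"
  by (auto simp: vf_bracket_def)

text \<open>In \<open>Z (W (f g)) - W (Z (f g))\<close> the mixed first-order terms cancel, so the commutator is again a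
  derivation. The inner equations hold on a whole neighbourhood of \<open>p\<close>, which is what the outer
  derivation needs.\<close>

lemma vf_bracket_tangent:
  assumes U: "open U" "p \<in> U" and Z: "vector_field A U Z" and W: "vector_field A U W"
  shows "vf_bracket A Z W p \<in> tangent A p"
proof (rule tangentI)
  fix f assume "\<not> smooth_at A p f"
  then show "vf_bracket A Z W p f = 0" by (simp add: vf_bracket_def)
next
  fix f g assume f: "smooth_at A p f" and g: "smooth_at A p g"
  note Zp = vf_tangent[OF Z U(2)] and Wp = vf_tangent[OF W U(2)]
  note sZ = vf_smooth_at[OF U Z] and sW = vf_smooth_at[OF U W]
  obtain T where T: "open T" "p \<in> T" "T \<subseteq> U" "smooth_fun A T f" "smooth_fun A T g"
    using smooth_at_common[OF f g U] .
  note s = smooth_atI[OF T(1)]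
  have add: "Y p (\<lambda>q. X q (\<lambda>q. f q + g q)) = Y p (\<lambda>q. X q f) + Y p (\<lambda>q. X q g)"
    if X: "vector_field A U X" and Y: "vector_field A U Y" for X Y
  proof -
    have "Y p (\<lambda>q. X q (\<lambda>q. f q + g q)) = Y p (\<lambda>q. X q f + X q g)"
    proof (rule tangent_germ[OF vf_tangent[OF Y U(2)] T(1,2)])
      show "smooth_fun A T (\<lambda>q. X q (\<lambda>q. f q + g q))"
        by (intro vf_smooth[OF X] smooth_fun_add T)
    qed (use T X in \<open>auto intro!: tangent_add_fun[OF vf_tangent] s\<close>)
    also have "\<dots> = Y p (\<lambda>q. X q f) + Y p (\<lambda>q. X q g)"
      by (intro tangent_add_fun[OF vf_tangent[OF Y U(2)]] vf_smooth_at[OF U X] f g)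
    finally show ?thesis .
  qed
  show "vf_bracket A Z W p (\<lambda>q. f q + g q) = vf_bracket A Z W p f + vf_bracket A Z W p g"
    unfolding vf_bracket_apply[OF f] vf_bracket_apply[OF g] vf_bracket_apply[OF smooth_at_add[OF f g]]
    by (simp add: add Z W)
  have mult: "Y p (\<lambda>q. X q (\<lambda>q. f q * g q)) =
      f p * Y p (\<lambda>q. X q g) + Y p f * X p g + (g p * Y p (\<lambda>q. X q f) + Y p g * X p f)"
    if X: "vector_field A U X" and Y: "vector_field A U Y" for X Y
  proof -
    note Yp = vf_tangent[OF Y U(2)]
    have "Y p (\<lambda>q. X q (\<lambda>q. f q * g q)) = Y p (\<lambda>q. f q * X q g + g q * X q f)"
    proof (rule tangent_germ[OF Yp T(1,2)])
      show "smooth_fun A T (\<lambda>q. X q (\<lambda>q. f q * g q))"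
        by (intro vf_smooth[OF X] smooth_fun_mult T)
    qed (use T X in \<open>auto intro!: tangent_mult_fun[OF vf_tangent] s\<close>)
    also have "\<dots> = Y p (\<lambda>q. f q * X q g) + Y p (\<lambda>q. g q * X q f)"
      by (intro tangent_add_fun[OF Yp] smooth_at_mult vf_smooth_at[OF U X] f g)
    also have "Y p (\<lambda>q. f q * X q g) = f p * Y p (\<lambda>q. X q g) + X p g * Y p f"
      by (intro tangent_mult_fun[OF Yp] vf_smooth_at[OF U X] f g)
    also have "Y p (\<lambda>q. g q * X q f) = g p * Y p (\<lambda>q. X q f) + X p f * Y p g"
      by (intro tangent_mult_fun[OF Yp] vf_smooth_at[OF U X] f g)
    finally show ?thesis by (simp add: mult.commute)
  qed
  show "vf_bracket A Z W p (\<lambda>q. f q * g q) = f p * vf_bracket A Z W p g + g p * vf_bracket A Z W p f"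
    unfolding vf_bracket_apply[OF f] vf_bracket_apply[OF g] vf_bracket_apply[OF smooth_at_mult[OF f g]]
      mult[OF W Z] mult[OF Z W] by (simp add: algebra_simps)
  have scale: "Y p (\<lambda>q. X q (\<lambda>q. c * f q)) = c * Y p (\<lambda>q. X q f)"
    if X: "vector_field A U X" and Y: "vector_field A U Y" for X Y c
  proof -
    have "Y p (\<lambda>q. X q (\<lambda>q. c * f q)) = Y p (\<lambda>q. c * X q f)"
    proof (rule tangent_germ[OF vf_tangent[OF Y U(2)] T(1,2)])
      show "smooth_fun A T (\<lambda>q. X q (\<lambda>q. c * f q))"
        by (intro vf_smooth[OF X] smooth_fun_cmult T)
    qed (use T X in \<open>auto intro!: tangent_cmult_fun[OF vf_tangent] s\<close>)
    also have "\<dots> = c * Y p (\<lambda>q. X q f)"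
      by (intro tangent_cmult_fun[OF vf_tangent[OF Y U(2)]] vf_smooth_at[OF U X] f)
    finally show ?thesis .
  qed
  show "vf_bracket A Z W p (\<lambda>q. c * f q) = c * vf_bracket A Z W p f" for c
    unfolding vf_bracket_apply[OF f] vf_bracket_apply[OF smooth_at_cmult[OF f]]
      scale[OF W Z] scale[OF Z W] by (simp add: algebra_simps)
  show "vf_bracket A Z W p f = vf_bracket A Z W p g" if ev: "\<forall>\<^sub>F q in nhds p. f q = g q"
  proof -
    obtain S where S: "open S" "p \<in> S" "\<And>q. q \<in> S \<Longrightarrow> f q = g q"
      using ev unfolding eventually_nhds by blast
    have ST: "open (S \<inter> T)" "p \<in> S \<inter> T" "S \<inter> T \<subseteq> U" "smooth_fun A (S \<inter> T) f"
      using S T smooth_fun_subset[OF T(4), of "S \<inter> T"] by auto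
    have germ: "Y p (\<lambda>q. X q f) = Y p (\<lambda>q. X q g)"
      if X: "vector_field A U X" and Y: "vector_field A U Y" for X Y
    proof (rule tangent_germ[OF vf_tangent[OF Y U(2)] ST(1,2) vf_smooth[OF X ST(1,3,4)]])
      fix q assume q: "q \<in> S \<inter> T"
      then show "X q f = X q g"
        by (intro tangent_germ[OF vf_tangent[OF X] ST(1) _ ST(4)]) (use ST S in auto)
    qed
    show ?thesis
      unfolding vf_bracket_apply[OF f] vf_bracket_apply[OF g] germ[OF W Z] germ[OF Z W] ..
  qed
qed

lemma vf_bracket_vf:
  assumes U: "open U" and Z: "vector_field A U Z" and W: "vector_field A U W"
  shows "vector_field A U (vf_bracket A Z W)"
proof (rule vector_fieldI)
  fix T f assume T: "open T" "T \<subseteq> U" "smooth_fun A T f"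
  have "smooth_fun A T (\<lambda>p. Z p (\<lambda>q. W q f) - W p (\<lambda>q. Z q f))"
    by (intro smooth_fun_diff vf_smooth[OF Z] vf_smooth[OF W] T)
  then show "smooth_fun A T (\<lambda>p. vf_bracket A Z W p f)"
    by (rule smooth_fun_cong[OF T(1), rotated]) (simp add: vf_bracket_apply smooth_atI[OF T(1) _ T(3)])
qed (rule vf_bracket_tangent[OF U _ Z W])

lemma vf_bracket_cong:
  assumes U: "open U" "p \<in> U" and Z: "vector_field A U Z" and W: "vector_field A U W"
    and eq: "\<And>q. q \<in> U \<Longrightarrow> Z q = Z' q" "\<And>q. q \<in> U \<Longrightarrow> W q = W' q"
  shows "vf_bracket A Z W p = vf_bracket A Z' W' p"
proof
  fix f
  show "vf_bracket A Z W p f = vf_bracket A Z' W' p f"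
  proof (cases "smooth_at A p f")
    case True
    obtain T where T: "open T" "p \<in> T" "T \<subseteq> U" "smooth_fun A T f"
      using smooth_atE[OF True U] .
    have "Y p (\<lambda>q. X q f) = Y p (\<lambda>q. X' q f)"
      if X: "vector_field A U X" "\<And>q. q \<in> U \<Longrightarrow> X q = X' q" and Y: "vector_field A U Y" for X X' Y
      by (rule tangent_germ[OF vf_tangent[OF Y U(2)] T(1,2) vf_smooth[OF X(1) T(1,3,4)]])
        (use T X(2) in auto)
    from this[OF Z eq(1) W] this[OF W eq(2) Z] show ?thesis
      unfolding vf_bracket_apply[OF True] using eq U(2) by simp
  qed (simp add: vf_bracket_def)
qed

text \<open>The Leibniz rule for finite combinations at once; the rules for a single multiple and for a sum are
  the cases of one and of two summands.\<close>

lemma vf_bracket_sum: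
  assumes U: "open U" "p \<in> U" and Z: "vector_field A U Z"
    and g: "\<And>i. i \<in> I \<Longrightarrow> smooth_fun A U (g i)" and W: "\<And>i. i \<in> I \<Longrightarrow> vector_field A U (W i)"
  shows "vf_bracket A Z (\<lambda>q f. \<Sum>i\<in>I. g i q * W i q f) p =
    (\<lambda>f. \<Sum>i\<in>I. g i p * vf_bracket A Z (W i) p f + Z p (g i) * W i p f)"
proof
  fix f
  show "vf_bracket A Z (\<lambda>q f. \<Sum>i\<in>I. g i q * W i q f) p f =
    (\<Sum>i\<in>I. g i p * vf_bracket A Z (W i) p f + Z p (g i) * W i p f)"
  proof (cases "smooth_at A p f")
    case False
    then show ?thesis
      using tangent_nonsmooth[OF vf_tangent[OF W U(2)] False] by (simp add: vf_bracket_def)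
  next
    case f: True
    note Zp = vf_tangent[OF Z U(2)]
    have s: "smooth_at A p (g i)" "smooth_at A p (\<lambda>q. W i q f)" if "i \<in> I" for i
      using g[OF that] W[OF that] U f by (auto intro: smooth_atI vf_smooth_at)
    have "Z p (\<lambda>q. \<Sum>i\<in>I. g i q * W i q f) = (\<Sum>i\<in>I. Z p (\<lambda>q. g i q * W i q f))"
      by (rule tangent_sum_fun[OF Zp]) (intro smooth_at_mult s)
    also have "\<dots> = (\<Sum>i\<in>I. g i p * Z p (\<lambda>q. W i q f) + W i p f * Z p (g i))"
      by (intro sum.cong refl tangent_mult_fun[OF Zp] s)
    finally show ?thesis
      unfolding vf_bracket_apply[OF f]
      by (simp add: algebra_simps sum.distrib sum_subtractf sum_distrib_left)
  qed
qed

lemma vf_bracket_scale: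
  assumes "open U" "p \<in> U" "vector_field A U Z" "smooth_fun A U g" "vector_field A U W"
  shows "vf_bracket A Z (\<lambda>q f. g q * W q f) p = (\<lambda>f. g p * vf_bracket A Z W p f + Z p g * W p f)"
  using vf_bracket_sum[of U p Z "{()}" "\<lambda>_. g" "\<lambda>_. W"] assms by simp

lemma vf_bracket_add:
  assumes "open U" "p \<in> U" "vector_field A U Z" "vector_field A U W" "vector_field A U X"
  shows "vf_bracket A Z (\<lambda>q. W q + X q) p = vf_bracket A Z W p + vf_bracket A Z X p"
  using vf_bracket_sum[of U p Z "UNIV::bool set" "\<lambda>_ _. 1" "\<lambda>b. if b then X else W"] assms
    tangent_const_fun[OF vf_tangent[OF assms(3,2)], of 1]
  by (simp add: UNIV_bool plus_fun_def)

lemma vf_bracket_add_left: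
  assumes "open U" "p \<in> U" "vector_field A U Z" "vector_field A U W" "vector_field A U X"
  shows "vf_bracket A (\<lambda>q. W q + X q) Z p = vf_bracket A W Z p + vf_bracket A X Z p"
  using vf_bracket_add[OF assms] by (simp add: vf_bracket_commute[of _ Z])

lemma vf_bracket_jacobi:
  assumes U: "open U" "p \<in> U"
    and Z: "vector_field A U Z" and W: "vector_field A U W" and X: "vector_field A U X"
  shows "vf_bracket A Z (vf_bracket A W X) p + vf_bracket A W (vf_bracket A X Z) p
    + vf_bracket A X (vf_bracket A Z W) p = 0"
proof
  fix f
  show "(vf_bracket A Z (vf_bracket A W X) p + vf_bracket A W (vf_bracket A X Z) p
    + vf_bracket A X (vf_bracket A Z W) p) f = 0 f"
  proof (cases "smooth_at A p f")
    case f: True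
    obtain T where T: "open T" "p \<in> T" "T \<subseteq> U" "smooth_fun A T f" using smooth_atE[OF f U] .
    have "vf_bracket A Z (vf_bracket A W X) p f =
        Z p (\<lambda>q. W q (\<lambda>r. X r f)) - Z p (\<lambda>q. X q (\<lambda>r. W r f))
        - (W p (\<lambda>q. X q (\<lambda>r. Z r f)) - X p (\<lambda>q. W q (\<lambda>r. Z r f)))"
      if Z: "vector_field A U Z" and W: "vector_field A U W" and X: "vector_field A U X" for Z W X
    proof -
      have "Z p (\<lambda>q. vf_bracket A W X q f) = Z p (\<lambda>q. W q (\<lambda>r. X r f) - X q (\<lambda>r. W r f))"
        by (rule tangent_germ[OF vf_tangent[OF Z U(2)] T(1,2)
              vf_smooth[OF vf_bracket_vf[OF U(1) W X] T(1,3,4)]])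
          (rule vf_bracket_apply[OF smooth_atI[OF T(1) _ T(4)]])
      also have "\<dots> = Z p (\<lambda>q. W q (\<lambda>r. X r f)) - Z p (\<lambda>q. X q (\<lambda>r. W r f))"
        by (intro tangent_diff_fun[OF vf_tangent[OF Z U(2)]] vf_smooth_at[OF U W]
            vf_smooth_at[OF U X] f)
      finally show ?thesis
        unfolding vf_bracket_apply[OF f] using vf_bracket_apply[OF vf_smooth_at[OF U Z f], of W X] by simp
    qed
    from this[OF Z W X] this[OF W X Z] this[OF X Z W] show ?thesis by simp
  qed (simp add: vf_bracket_def)
qed

section \<open>One-forms\<close>

lemma cot_add: "\<alpha> \<in> cotangent A p \<Longrightarrow> v \<in> tangent A p \<Longrightarrow> w \<in> tangent A p \<Longrightarrow> \<alpha> (v + w) = \<alpha> v + \<alpha> w"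
  and cot_scale: "\<alpha> \<in> cotangent A p \<Longrightarrow> v \<in> tangent A p \<Longrightarrow> \<alpha> (\<lambda>f. c * v f) = c * \<alpha> v"
  and cot_outside: "\<alpha> \<in> cotangent A p \<Longrightarrow> v \<notin> tangent A p \<Longrightarrow> \<alpha> v = 0"
  unfolding cotangent_def mem_Collect_eq by (elim conjE, blast)+

lemma cotI:
  assumes "\<And>v. v \<notin> tangent A p \<Longrightarrow> \<alpha> v = 0"
    and "\<And>v w. v \<in> tangent A p \<Longrightarrow> w \<in> tangent A p \<Longrightarrow> \<alpha> (v + w) = \<alpha> v + \<alpha> w"
    and "\<And>c v. v \<in> tangent A p \<Longrightarrow> \<alpha> (\<lambda>f. c * v f) = c * \<alpha> v"
  shows "\<alpha> \<in> cotangent A p"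
  unfolding cotangent_def using assms by blast

lemma cot_zero_vec: "\<alpha> \<in> cotangent A p \<Longrightarrow> \<alpha> 0 = 0"
  using cot_scale[of \<alpha> p 0 0] tangent_zero by (simp add: zero_fun_def)

lemma cot_uminus_vec: "\<alpha> \<in> cotangent A p \<Longrightarrow> v \<in> tangent A p \<Longrightarrow> \<alpha> (- v) = - \<alpha> v"
  using cot_scale[of \<alpha> p v "-1"] by (simp add: fun_Compl_def)

lemma cot_diff_vec: "\<alpha> \<in> cotangent A p \<Longrightarrow> v \<in> tangent A p \<Longrightarrow> w \<in> tangent A p \<Longrightarrow> \<alpha> (v - w) = \<alpha> v - \<alpha> w"
  using cot_add[of \<alpha> p v "- w"] cot_uminus_vec[of \<alpha> p w] tangent_uminus by simp

lemma cot_lincomb: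
  assumes \<alpha>: "\<alpha> \<in> cotangent A p" and v: "\<And>i. i \<in> I \<Longrightarrow> v i \<in> tangent A p"
  shows "\<alpha> (\<lambda>f. \<Sum>i\<in>I. c i * v i f) = (\<Sum>i\<in>I. c i * \<alpha> (v i))"
  using v
proof (induction I rule: infinite_finite_induct)
  case (insert i I)
  have "\<alpha> (\<lambda>f. \<Sum>i\<in>insert i I. c i * v i f) = \<alpha> ((\<lambda>f. c i * v i f) + (\<lambda>f. \<Sum>i\<in>I. c i * v i f))"
    using insert.hyps by (simp add: plus_fun_def)
  also have "\<dots> = \<alpha> (\<lambda>f. c i * v i f) + \<alpha> (\<lambda>f. \<Sum>i\<in>I. c i * v i f)"
    by (intro cot_add[OF \<alpha>] tangent_scale tangent_sum) (use insert.prems in auto)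
  also have "\<alpha> (\<lambda>f. c i * v i f) = c i * \<alpha> (v i)"
    using cot_scale[OF \<alpha>] insert.prems by simp
  finally show ?case using insert by simp
qed (use cot_zero_vec[OF \<alpha>] in \<open>simp_all add: zero_fun_def\<close>)

lemma cot_lincomb2:
  assumes \<alpha>: "\<alpha> \<in> cotangent A p" and "\<And>i. i \<in> I \<Longrightarrow> v i \<in> tangent A p" "\<And>i. i \<in> I \<Longrightarrow> w i \<in> tangent A p"
  shows "\<alpha> (\<lambda>f. \<Sum>i\<in>I. c i * v i f + d i * w i f) = (\<Sum>i\<in>I. c i * \<alpha> (v i) + d i * \<alpha> (w i))"
proof -
  have "\<alpha> (\<lambda>f. \<Sum>i\<in>I. c i * v i f + d i * w i f) =
      \<alpha> ((\<lambda>f. \<Sum>i\<in>I. c i * v i f) + (\<lambda>f. \<Sum>i\<in>I. d i * w i f))"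
    by (simp add: plus_fun_def sum.distrib)
  also have "\<dots> = \<alpha> (\<lambda>f. \<Sum>i\<in>I. c i * v i f) + \<alpha> (\<lambda>f. \<Sum>i\<in>I. d i * w i f)"
    by (intro cot_add[OF \<alpha>] tangent_sum assms(2,3))
  finally show ?thesis
    by (simp add: cot_lincomb[OF \<alpha>, of I v] cot_lincomb[OF \<alpha>, of I w] assms(2,3) sum.distrib)
qed

lemma cot_expand:
  assumes V: "(V, \<phi>) \<in> A" "p \<in> V" and \<alpha>: "\<alpha> \<in> cotangent A p" and v: "v \<in> tangent A p"
  shows "\<alpha> v = (\<Sum>i\<in>UNIV. v (coord \<phi> i) * \<alpha> (frame V \<phi> i p))"
  by (subst tangent_expand[OF V v], rule cot_lincomb[OF \<alpha>]) (rule frame_tangent[OF V])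

lemma cot_eqI_frame:
  assumes V: "(V, \<phi>) \<in> A" "p \<in> V" and "\<alpha> \<in> cotangent A p" "\<beta> \<in> cotangent A p"
    and eq: "\<And>i. \<alpha> (frame V \<phi> i p) = \<beta> (frame V \<phi> i p)"
  shows "\<alpha> = \<beta>"
proof
  fix v show "\<alpha> v = \<beta> v"
    using cot_expand[OF V assms(3), of v] cot_expand[OF V assms(4), of v] eq
      cot_outside[OF assms(3)] cot_outside[OF assms(4)]
    by (cases "v \<in> tangent A p") auto
qed

text \<open>Two covectors agree if they agree on the values of local vector fields: the frame provides
  enough of them.\<close>

lemma cot_eqI:
  assumes U: "open U" "p \<in> U" and "\<alpha> \<in> cotangent A p" "\<beta> \<in> cotangent A p"
    and eq: "\<And>W Y. open W \<Longrightarrow> p \<in> W \<Longrightarrow> W \<subseteq> U \<Longrightarrow> vector_field A W Y \<Longrightarrow> \<alpha> (Y p) = \<beta> (Y p)"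
  shows "\<alpha> = \<beta>"
proof -
  obtain V \<phi> where V: "(V, \<phi>) \<in> A" "p \<in> V" by (rule chart_exists)
  show ?thesis
    by (rule cot_eqI_frame[OF V assms(3,4)], rule eq[of "U \<inter> V"])
      (use U V chart_open[OF V(1)] vf_subset[OF frame_vector_field[OF V(1)]] in auto)
qed

lemma cot_sum:
  assumes "\<And>i. i \<in> I \<Longrightarrow> \<alpha> i \<in> cotangent A p"
  shows "(\<lambda>v. \<Sum>i\<in>I. c i * \<alpha> i v) \<in> cotangent A p"
proof (rule cotI)
  fix v assume "v \<notin> tangent A p"
  then show "(\<Sum>i\<in>I. c i * \<alpha> i v) = 0" using cot_outside[OF assms] by simp
next
  fix v w assume "v \<in> tangent A p" "w \<in> tangent A p"
  then show "(\<Sum>i\<in>I. c i * \<alpha> i (v + w)) = (\<Sum>i\<in>I. c i * \<alpha> i v) + (\<Sum>i\<in>I. c i * \<alpha> i w)"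
    by (simp add: cot_add[OF assms] distrib_left sum.distrib cong: sum.cong)
next
  fix d v assume "v \<in> tangent A p"
  then show "(\<Sum>i\<in>I. c i * \<alpha> i (\<lambda>f. d * v f)) = d * (\<Sum>i\<in>I. c i * \<alpha> i v)"
    by (simp add: cot_scale[OF assms] sum_distrib_left mult.left_commute cong: sum.cong)
qed

lemma cot_lin2:
  assumes "\<alpha> \<in> cotangent A p" "\<beta> \<in> cotangent A p"
  shows "(\<lambda>v. c * \<alpha> v + d * \<beta> v) \<in> cotangent A p"
  using cot_sum[of "UNIV::bool set" "\<lambda>b. if b then \<alpha> else \<beta>" p "\<lambda>b. if b then c else d"] assms
  by (simp add: UNIV_bool add.commute)

lemma cotangent_add: "\<alpha> \<in> cotangent A p \<Longrightarrow> \<beta> \<in> cotangent A p \<Longrightarrow> \<alpha> + \<beta> \<in> cotangent A p"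
  using cot_lin2[of \<alpha> p \<beta> 1 1] by (simp add: plus_fun_def)

lemma cotangent_scale: "\<alpha> \<in> cotangent A p \<Longrightarrow> (\<lambda>v. c * \<alpha> v) \<in> cotangent A p"
  using cot_lin2[of \<alpha> p \<alpha> c 0] by simp

lemma cotangent_uminus: "\<alpha> \<in> cotangent A p \<Longrightarrow> - \<alpha> \<in> cotangent A p"
  using cotangent_scale[of \<alpha> p "-1"] by (simp add: fun_Compl_def)

lemma cotangent_zero: "0 \<in> cotangent A p"
  using cot_sum[of "{}" _ p] by (simp add: zero_fun_def)

lemma differential_apply [simp]: "v \<in> tangent A p \<Longrightarrow> differential A f p v = v f"
  by (simp add: differential_def)

lemma differential_cot: "differential A f p \<in> cotangent A p"
  by (rule cotI) (auto simp: differential_def tangent_add tangent_scale)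

lemma cotangent_components:
  assumes V: "(V, \<phi>) \<in> A" "p \<in> V"
  shows "\<exists>\<alpha>\<in>cotangent A p. \<forall>i. \<alpha> (frame V \<phi> i p) = a i"
proof (intro bexI allI)
  let ?\<alpha> = "\<lambda>v. \<Sum>i\<in>UNIV. a i * differential A (coord \<phi> i) p v"
  show "?\<alpha> \<in> cotangent A p" by (intro cot_sum differential_cot)
  show "?\<alpha> (frame V \<phi> i p) = a i" for i
    by (simp add: frame_tangent[OF V] frame_coord[OF V] if_distrib[of "(*) _"] cong: if_cong)
qed

lemma cotangent_cnj: "\<alpha> \<in> cotangent A p \<Longrightarrow> cnj_covec \<alpha> \<in> cotangent A p"
proof (rule cotI)
  assume \<alpha>: "\<alpha> \<in> cotangent A p"
  have cc: "cnj_vec (cnj_vec v) = v" for v :: "'a tvec" by (simp add: cnj_vec_def)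
  fix v
  { assume "v \<notin> tangent A p"
    then have "cnj_vec v \<notin> tangent A p" using tangent_cnj[of "cnj_vec v"] cc[of v] by auto
    then show "cnj_covec \<alpha> v = 0" by (simp add: cnj_covec_def cot_outside[OF \<alpha>]) }
  assume v: "v \<in> tangent A p"
  { fix w assume w: "w \<in> tangent A p"
    have "cnj_vec (v + w) = cnj_vec v + cnj_vec w" by (simp add: cnj_vec_def plus_fun_def)
    then show "cnj_covec \<alpha> (v + w) = cnj_covec \<alpha> v + cnj_covec \<alpha> w"
      by (simp add: cnj_covec_def cot_add[OF \<alpha> tangent_cnj[OF v] tangent_cnj[OF w]]) }
  fix c
  have "cnj_vec (\<lambda>f. c * v f) = (\<lambda>f. cnj c * cnj_vec v f)" by (simp add: cnj_vec_def)
  then show "cnj_covec \<alpha> (\<lambda>f. c * v f) = c * cnj_covec \<alpha> v"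
    by (simp add: cnj_covec_def cot_scale[OF \<alpha> tangent_cnj[OF v]])
qed

lemma form_cot: "one_form A U \<alpha> \<Longrightarrow> p \<in> U \<Longrightarrow> \<alpha> p \<in> cotangent A p"
  unfolding one_form_def by simp

lemma form_smooth:
  "one_form A U \<alpha> \<Longrightarrow> open W \<Longrightarrow> W \<subseteq> U \<Longrightarrow> vector_field A W Y \<Longrightarrow> smooth_fun A W (\<lambda>p. \<alpha> p (Y p))"
  unfolding one_form_def by simp

lemma one_formI:
  assumes "\<And>p. p \<in> U \<Longrightarrow> \<alpha> p \<in> cotangent A p"
    and "\<And>W Y. open W \<Longrightarrow> W \<subseteq> U \<Longrightarrow> vector_field A W Y \<Longrightarrow> smooth_fun A W (\<lambda>p. \<alpha> p (Y p))"
  shows "one_form A U \<alpha>"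
  unfolding one_form_def using assms by simp

lemma form_subset: "one_form A U \<alpha> \<Longrightarrow> W \<subseteq> U \<Longrightarrow> one_form A W \<alpha>"
  unfolding one_form_def by (meson order_trans subsetD)

lemma form_cong:
  assumes "\<And>p. p \<in> U \<Longrightarrow> \<alpha> p = \<beta> p" "one_form A U \<alpha>"
  shows "one_form A U \<beta>"
proof (rule one_formI)
  fix W Y assume W: "open W" "W \<subseteq> U" "vector_field A W Y"
  show "smooth_fun A W (\<lambda>p. \<beta> p (Y p))"
    by (rule smooth_fun_cong[OF W(1) _ form_smooth[OF assms(2) W]]) (use assms(1) W(2) in auto)
next
  fix p assume "p \<in> U"
  then show "\<beta> p \<in> cotangent A p" using form_cot[OF assms(2)] assms(1) by metis
qed

lemma form_local:
  assumes "\<And>p. p \<in> U \<Longrightarrow> \<exists>W. open W \<and> p \<in> W \<and> one_form A W \<alpha>"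
  shows "one_form A U \<alpha>"
proof (rule one_formI)
  fix p assume "p \<in> U" then show "\<alpha> p \<in> cotangent A p" using assms form_cot by blast
next
  fix T Y assume T: "open T" "T \<subseteq> U" "vector_field A T Y"
  show "smooth_fun A T (\<lambda>p. \<alpha> p (Y p))"
  proof (rule smooth_fun_local)
    fix p assume p: "p \<in> T"
    then obtain W where W: "open W" "p \<in> W" "one_form A W \<alpha>" using assms T by blast
    have "smooth_fun A (W \<inter> T) (\<lambda>p. \<alpha> p (Y p))"
      using W T by (intro form_smooth[OF W(3)]) (auto intro: vf_subset)
    then show "\<exists>W. open W \<and> p \<in> W \<and> smooth_fun A W (\<lambda>p. \<alpha> p (Y p))"
      using W T p by (intro exI[of _ "W \<inter> T"]) auto
  qed
qed

lemma form_sum: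
  assumes "\<And>i. i \<in> I \<Longrightarrow> smooth_fun A U (g i)" "\<And>i. i \<in> I \<Longrightarrow> one_form A U (\<alpha> i)"
  shows "one_form A U (\<lambda>p v. \<Sum>i\<in>I. g i p * \<alpha> i p v)"
proof (rule one_formI)
  fix p assume "p \<in> U" then show "(\<lambda>v. \<Sum>i\<in>I. g i p * \<alpha> i p v) \<in> cotangent A p"
    by (intro cot_sum form_cot[OF assms(2)])
next
  fix W Y assume W: "open W" "W \<subseteq> U" "vector_field A W Y"
  show "smooth_fun A W (\<lambda>p. \<Sum>i\<in>I. g i p * \<alpha> i p (Y p))"
    by (intro smooth_fun_sum smooth_fun_mult smooth_fun_subset[OF assms(1)] form_smooth[OF assms(2)] W)
qed

lemma form_scale: "smooth_fun A U g \<Longrightarrow> one_form A U \<alpha> \<Longrightarrow> one_form A U (\<lambda>p v. g p * \<alpha> p v)"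
  using form_sum[of "{()}" U "\<lambda>_. g" "\<lambda>_. \<alpha>"] by simp

lemma form_add:
  "open U \<Longrightarrow> one_form A U \<alpha> \<Longrightarrow> one_form A U \<beta> \<Longrightarrow> one_form A U (\<lambda>p. \<alpha> p + \<beta> p)"
  using form_sum[of "UNIV::bool set" U "\<lambda>_ _. 1" "\<lambda>b. if b then \<beta> else \<alpha>"]
  by (simp add: UNIV_bool plus_fun_def)

lemma form_uminus: "open U \<Longrightarrow> one_form A U \<alpha> \<Longrightarrow> one_form A U (\<lambda>p. - \<alpha> p)"
  using form_scale[of U "\<lambda>_. -1" \<alpha>] by (simp add: fun_Compl_def)

lemma form_diff:
  "open U \<Longrightarrow> one_form A U \<alpha> \<Longrightarrow> one_form A U \<beta> \<Longrightarrow> one_form A U (\<lambda>p. \<alpha> p - \<beta> p)"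
  using form_add[OF _ _ form_uminus, of U \<alpha> \<beta>] by simp

lemma form_zero: "open U \<Longrightarrow> one_form A U (\<lambda>p. 0)"
  using form_sum[of "{}" U] by (simp add: zero_fun_def)

lemma differential_form:
  assumes "open U" "smooth_fun A U f" shows "one_form A U (differential A f)"
proof (rule one_formI)
  fix W Y assume W: "open W" "W \<subseteq> U" "vector_field A W Y"
  have "smooth_fun A W (\<lambda>p. Y p f)"
    by (rule vf_smooth[OF W(3,1)]) (use assms W smooth_fun_subset in auto)
  then show "smooth_fun A W (\<lambda>p. differential A f p (Y p))"
    by (rule smooth_fun_cong[OF W(1), rotated]) (simp add: vf_tangent[OF W(3)])
qed (rule differential_cot)

subsection \<open>The Lie derivative of a one-form\<close>

text \<open>The right-hand side depends on \<open>W\<close> only through \<open>W p\<close>. Expanding \<open>W\<close> in the frame, the derivatives of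
  its coefficients enter through \<open>Z (\<eta> W)\<close> and through \<open>\<eta> [Z, W]\<close>, and they cancel. So the covector with the
  required values on the frame has them on all vector fields.\<close>

lemma lie_deriv_exists:
  assumes U: "open U" "p \<in> U" and Z: "vector_field A U Z" and \<eta>: "one_form A U \<eta>"
  shows "\<exists>\<alpha>. \<alpha> \<in> cotangent A p \<and> (\<forall>U' W. open U' \<and> p \<in> U' \<and> vector_field A U' W \<longrightarrow>
        \<alpha> (W p) = Z p (\<lambda>q. \<eta> q (W q)) - \<eta> p (vf_bracket A Z W p))"
proof -
  obtain V \<phi> where V: "(V, \<phi>) \<in> A" "p \<in> V" by (rule chart_exists)
  let ?E = "frame V \<phi>"
  obtain \<alpha> where \<alpha>: "\<alpha> \<in> cotangent A p"
      "\<And>i. \<alpha> (?E i p) = Z p (\<lambda>q. \<eta> q (?E i q)) - \<eta> p (vf_bracket A Z (?E i) p)"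
    using cotangent_components[OF V, where a = "\<lambda>i. Z p (\<lambda>q. \<eta> q (?E i q)) - \<eta> p (vf_bracket A Z (?E i) p)"]
    by auto
  have "\<alpha> (W p) = Z p (\<lambda>q. \<eta> q (W q)) - \<eta> p (vf_bracket A Z W p)"
    if U': "open U'" "p \<in> U'" and W: "vector_field A U' W" for U' W
  proof -
    define D where "D = U \<inter> U' \<inter> V"
    have D: "open D" "p \<in> D" "D \<subseteq> U" "D \<subseteq> U'" "D \<subseteq> V"
      using U U' V chart_open[OF V(1)] by (auto simp: D_def)
    let ?w = "\<lambda>i q. W q (coord \<phi> i)"
    have w: "smooth_fun A D (?w i)" for i
      using vf_smooth[OF W D(1,4) smooth_fun_subset[OF coord_smooth[OF V(1)] D(5)]] .
    have E: "vector_field A D (?E i)" for i using vf_subset[OF frame_vector_field[OF V(1)] D(5)] .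
    have ZD: "vector_field A D Z" using vf_subset[OF Z D(3)] .
    have WD: "vector_field A D W" using vf_subset[OF W D(4)] .
    have \<eta>E: "smooth_fun A D (\<lambda>q. \<eta> q (?E i q))" for i by (rule form_smooth[OF \<eta> D(1,3) E])
    note Zp = vf_tangent[OF ZD D(2)] and s = smooth_atI[OF D(1,2)]
    have "Z p (\<lambda>q. \<eta> q (W q)) = Z p (\<lambda>q. \<Sum>i\<in>UNIV. ?w i q * \<eta> q (?E i q))"
      by (rule tangent_germ[OF Zp D(1,2) form_smooth[OF \<eta> D(1,3) WD]])
        (use D in \<open>auto intro!: cot_expand[OF V(1)] form_cot[OF \<eta>] vf_tangent[OF W]\<close>)
    also have "\<dots> = (\<Sum>i\<in>UNIV. Z p (\<lambda>q. ?w i q * \<eta> q (?E i q)))"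
      by (rule tangent_sum_fun[OF Zp]) (intro smooth_at_mult s w \<eta>E)
    also have "\<dots> = (\<Sum>i\<in>UNIV. ?w i p * Z p (\<lambda>q. \<eta> q (?E i q)) + \<eta> p (?E i p) * Z p (?w i))"
      by (intro sum.cong refl tangent_mult_fun[OF Zp] s w \<eta>E)
    finally have 1: "Z p (\<lambda>q. \<eta> q (W q)) = \<dots>" .
    have "vf_bracket A Z W p = vf_bracket A Z (\<lambda>q f. \<Sum>i\<in>UNIV. ?w i q * ?E i q f) p"
      by (rule vf_bracket_cong[OF D(1,2) ZD WD refl])
        (use D in \<open>auto intro!: tangent_expand[OF V(1)] vf_tangent[OF W]\<close>)
    also have "\<dots> = (\<lambda>f. \<Sum>i\<in>UNIV. ?w i p * vf_bracket A Z (?E i) p f + Z p (?w i) * ?E i p f)"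
      by (rule vf_bracket_sum[OF D(1,2) ZD w E])
    finally have 2: "\<eta> p (vf_bracket A Z W p) =
        (\<Sum>i\<in>UNIV. ?w i p * \<eta> p (vf_bracket A Z (?E i) p) + Z p (?w i) * \<eta> p (?E i p))"
      using cot_lincomb2[OF form_cot[OF \<eta> U(2)] vf_bracket_tangent[OF D(1,2) ZD E] frame_tangent[OF V],
          where I = UNIV and c = "\<lambda>i. ?w i p" and d = "\<lambda>i. Z p (?w i)"] by simp
    have "\<alpha> (W p) = (\<Sum>i\<in>UNIV. ?w i p * \<alpha> (?E i p))"
      by (rule cot_expand[OF V \<alpha>(1) vf_tangent[OF W U'(2)]])
    then show ?thesis unfolding 1 2 \<alpha>(2)
      by (simp add: algebra_simps sum.distrib sum_subtractf)
  qed
  then show ?thesis using \<alpha>(1) by blast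
qed

lemma lie_deriv_props:
  assumes U: "open U" "p \<in> U" and Z: "vector_field A U Z" and \<eta>: "one_form A U \<eta>"
  shows "lie_deriv A Z \<eta> p \<in> cotangent A p \<and> (\<forall>U' W. open U' \<and> p \<in> U' \<and> vector_field A U' W \<longrightarrow>
        lie_deriv A Z \<eta> p (W p) = Z p (\<lambda>q. \<eta> q (W q)) - \<eta> p (vf_bracket A Z W p))"
proof -
  let ?P = "\<lambda>\<alpha>. \<alpha> \<in> cotangent A p \<and> (\<forall>U' W. open U' \<and> p \<in> U' \<and> vector_field A U' W \<longrightarrow>
        \<alpha> (W p) = Z p (\<lambda>q. \<eta> q (W q)) - \<eta> p (vf_bracket A Z W p))"
  obtain \<alpha> where \<alpha>: "?P \<alpha>" using lie_deriv_exists[OF assms] by blast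
  have "\<beta> = \<alpha>" if "?P \<beta>" for \<beta>
    by (rule cot_eqI[OF U]) (use that \<alpha> in auto)
  then have "?P (THE \<alpha>. ?P \<alpha>)" by (intro theI[of ?P, OF \<alpha>])
  then show ?thesis unfolding lie_deriv_def .
qed

lemma lie_deriv_cot:
  "open U \<Longrightarrow> p \<in> U \<Longrightarrow> vector_field A U Z \<Longrightarrow> one_form A U \<eta> \<Longrightarrow> lie_deriv A Z \<eta> p \<in> cotangent A p"
  using lie_deriv_props by simp

text \<open>All later computations use the Lie derivative through this formula only.\<close>

lemma lie_deriv_eval:
  assumes "open U" "p \<in> U" "vector_field A U Z" "one_form A U \<eta>" "vector_field A U W"
  shows "lie_deriv A Z \<eta> p (W p) = Z p (\<lambda>q. \<eta> q (W q)) - \<eta> p (vf_bracket A Z W p)"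
  using lie_deriv_props[OF assms(1-4)] assms by blast

lemma lie_deriv_form:
  assumes U: "open U" and Z: "vector_field A U Z" and \<eta>: "one_form A U \<eta>"
  shows "one_form A U (lie_deriv A Z \<eta>)"
proof (rule one_formI)
  fix W Y assume W: "open W" "W \<subseteq> U" "vector_field A W Y"
  note ZW = vf_subset[OF Z W(2)] and \<eta>W = form_subset[OF \<eta> W(2)]
  have "smooth_fun A W (\<lambda>p. Z p (\<lambda>q. \<eta> q (Y q)) - \<eta> p (vf_bracket A Z Y p))"
    by (intro smooth_fun_diff vf_smooth[OF ZW] form_smooth[OF \<eta>W] vf_bracket_vf ZW W order_refl)
  then show "smooth_fun A W (\<lambda>p. lie_deriv A Z \<eta> p (Y p))"
    by (rule smooth_fun_cong[OF W(1), rotated]) (simp add: lie_deriv_eval[OF W(1) _ ZW \<eta>W W(3)])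
qed (rule lie_deriv_cot[OF U _ Z \<eta>])

section \<open>The almost complex structure\<close>

text \<open>The Cauchy--Riemann equations of the coordinate changes.\<close>

lemma frame_coord_change:
  assumes V: "(V, \<phi>) \<in> A" "p \<in> V" and W: "(W, \<psi>) \<in> A" "p \<in> W"
  shows "frame V \<phi> (Inr k) p (coord \<psi> (Inl l)) = 0"
    and "frame V \<phi> (Inl k) p (coord \<psi> (Inr l)) = 0"
proof -
  let ?\<tau> = "\<psi> \<circ> inv_into V \<phi>"
  let ?D = "frechet_derivative ?\<tau> (at (\<phi> p))"
  have hol: "holomorphic_map_on (\<phi> ` (V \<inter> W)) ?\<tau>" using transition_holomorphic[OF V(1) W(1)] .
  have pin: "\<phi> p \<in> \<phi> ` (V \<inter> W)" using V W by auto
  have D: "(?\<tau> has_derivative ?D) (at (\<phi> p))"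
    using hol pin smooth_on_has_derivative unfolding holomorphic_map_on_def by blast
  have ax: "axis k \<i> = \<i> *s (axis k 1 :: complex^'n)" by (auto simp: vec_eq_iff axis_def)
  have "?D (axis k \<i>) = \<i> *s ?D (axis k 1)"
    unfolding ax using hol pin unfolding holomorphic_map_on_def by blast
  then have Di: "?D (axis k \<i>) $ l = \<i> * ?D (axis k 1) $ l" by simp
  note s = coord_smooth_at[OF W]
  have "((\<lambda>x. ?\<tau> x $ l) has_derivative (\<lambda>b. ?D b $ l)) (at (\<phi> p))"
    by (rule bounded_linear.has_derivative[OF bounded_linear_vec_nth D])
  then have Dl: "((coord \<psi> (Inl l) \<circ> inv_into V \<phi>) has_derivative (\<lambda>b. ?D b $ l)) (at (\<phi> p))"
    by (simp add: o_def coord_def)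
  have "((\<lambda>x. cnj (?\<tau> x $ l)) has_derivative (\<lambda>b. cnj (?D b $ l))) (at (\<phi> p))"
    by (rule bounded_linear.has_derivative[OF bounded_linear_cnj
          bounded_linear.has_derivative[OF bounded_linear_vec_nth D]])
  then have Dr: "((coord \<psi> (Inr l) \<circ> inv_into V \<phi>) has_derivative (\<lambda>b. cnj (?D b $ l))) (at (\<phi> p))"
    by (simp add: o_def coord_def)
  show "frame V \<phi> (Inr k) p (coord \<psi> (Inl l)) = 0"
    unfolding frame_def sum.case directional_eq[OF V s Dl] Di by simp
  show "frame V \<phi> (Inl k) p (coord \<psi> (Inr l)) = 0"
    unfolding frame_def sum.case directional_eq[OF V s Dr] Di by simp
qed

lemma coord_change:
  assumes V: "(V, \<phi>) \<in> A" "p \<in> V" and W: "(W, \<psi>) \<in> A" "p \<in> W" and v: "v \<in> tangent A p"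
  shows "v (coord \<psi> (Inl l)) = (\<Sum>k\<in>UNIV. v (coord \<phi> (Inl k)) * frame V \<phi> (Inl k) p (coord \<psi> (Inl l)))"
    and "v (coord \<psi> (Inr l)) = (\<Sum>k\<in>UNIV. v (coord \<phi> (Inr k)) * frame V \<phi> (Inr k) p (coord \<psi> (Inr l)))"
proof -
  note ex = fun_cong[OF tangent_expand[OF V v], of "coord \<psi> (Inl l)"]
    fun_cong[OF tangent_expand[OF V v], of "coord \<psi> (Inr l)"]
  show "v (coord \<psi> (Inl l)) = (\<Sum>k\<in>UNIV. v (coord \<phi> (Inl k)) * frame V \<phi> (Inl k) p (coord \<psi> (Inl l)))"
    by (rule trans[OF ex(1)]) (simp add: sum_UNIV_Plus frame_coord_change[OF V W])
  show "v (coord \<psi> (Inr l)) = (\<Sum>k\<in>UNIV. v (coord \<phi> (Inr k)) * frame V \<phi> (Inr k) p (coord \<psi> (Inr l)))"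
    by (rule trans[OF ex(2)]) (simp add: sum_UNIV_Plus frame_coord_change[OF V W])
qed

text \<open>The eigenvalues of the almost complex structure on the frame vectors.\<close>

definition J_factor :: "'n + 'n \<Rightarrow> complex" where
  "J_factor i = (case i of Inl k \<Rightarrow> \<i> | Inr k \<Rightarrow> - \<i>)"

lemma J_factor_simps [simp]: "J_factor (Inl k) = \<i>" "J_factor (Inr k) = - \<i>"
  by (simp_all add: J_factor_def)

text \<open>With \<open>a, b\<close> the values of \<open>u\<close> on \<open>z\<^sub>k\<close> and its conjugate, and \<open>c, d\<close> those of \<open>v\<close>, the left-hand side is the
  condition on real and imaginary parts by which \<open>Jmap\<close> is defined.\<close>

lemma Re_Im_rotation_iff:
  "(1/2 * (a + b) = - ((- \<i>/2) * (c - d)) \<and> (- \<i>/2) * (a - b) = 1/2 * (c + d)) \<longleftrightarrow>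
     a = \<i> * c \<and> b = - \<i> * d"
  by (auto simp: complex_eq_iff field_simps)

lemma Jmap_characterization:
  assumes V: "(V, \<phi>) \<in> A" "p \<in> V" and u: "u \<in> tangent A p" and v: "v \<in> tangent A p"
  shows "(u (\<lambda>q. of_real (Re (\<phi> q $ k))) = - v (\<lambda>q. of_real (Im (\<phi> q $ k))) \<and>
      u (\<lambda>q. of_real (Im (\<phi> q $ k))) = v (\<lambda>q. of_real (Re (\<phi> q $ k)))) \<longleftrightarrow>
    u (coord \<phi> (Inl k)) = \<i> * v (coord \<phi> (Inl k)) \<and> u (coord \<phi> (Inr k)) = - \<i> * v (coord \<phi> (Inr k))"
  unfolding tangent_Re_Im_coord[OF V u] tangent_Re_Im_coord[OF V v] by (rule Re_Im_rotation_iff)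

text \<open>The vector with the required values on the coordinates of one chart has them in every chart,
  because by \<open>coord_change\<close> the values on holomorphic coordinates transform among themselves, and
  likewise those on antiholomorphic ones.\<close>

lemma Jmap_props:
  assumes v: "v \<in> tangent A p"
  shows "Jmap A p v \<in> tangent A p"
    and "(V, \<phi>) \<in> A \<Longrightarrow> p \<in> V \<Longrightarrow> Jmap A p v (coord \<phi> i) = J_factor i * v (coord \<phi> i)"
proof -
  let ?P = "\<lambda>u. u \<in> tangent A p \<and> (\<forall>(V, \<phi>)\<in>A. p \<in> V \<longrightarrow> (\<forall>k.
        u (\<lambda>q. of_real (Re (\<phi> q $ k))) = - v (\<lambda>q. of_real (Im (\<phi> q $ k))) \<and>
        u (\<lambda>q. of_real (Im (\<phi> q $ k))) = v (\<lambda>q. of_real (Re (\<phi> q $ k)))))"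
  have P: "u (coord \<phi> i) = J_factor i * v (coord \<phi> i)" if "?P u" "(V, \<phi>) \<in> A" "p \<in> V" for u V \<phi> i
    using that Jmap_characterization[OF that(2,3) _ v, of u] by (cases i) auto
  obtain V \<phi> where V: "(V, \<phi>) \<in> A" "p \<in> V" by (rule chart_exists)
  define u where "u = (\<lambda>f. \<Sum>i\<in>UNIV. (J_factor i * v (coord \<phi> i)) * frame V \<phi> i p f)"
  have u: "u \<in> tangent A p" unfolding u_def by (intro tangent_sum frame_tangent[OF V])
  have u_coord: "u (coord \<phi> i) = J_factor i * v (coord \<phi> i)" for i
    unfolding u_def frame_coord[OF V] by (simp add: if_distrib[of "(*) _"] cong: if_cong)
  have "?P u"
  proof (intro conjI ballI u; clarify)
    fix W \<psi> k assume W: "(W, \<psi>) \<in> A" "p \<in> W"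
    have "u (coord \<psi> (Inl k)) = \<i> * v (coord \<psi> (Inl k))" "u (coord \<psi> (Inr k)) = - \<i> * v (coord \<psi> (Inr k))"
      unfolding coord_change[OF V W u] coord_change[OF V W v] u_coord
      by (simp_all add: sum_distrib_left mult.assoc sum_negf)
    then show "u (\<lambda>q. of_real (Re (\<psi> q $ k))) = - v (\<lambda>q. of_real (Im (\<psi> q $ k))) \<and>
        u (\<lambda>q. of_real (Im (\<psi> q $ k))) = v (\<lambda>q. of_real (Re (\<psi> q $ k)))"
      using Jmap_characterization[OF W u v] by simp
  qed
  moreover have "w = u" if "?P w" for w
    by (rule tangent_eqI[OF V _ u]) (use that P[OF that V] u_coord in auto)
  ultimately have PJ: "?P (Jmap A p v)"
    unfolding Jmap_def by (rule theI)
  then show "Jmap A p v \<in> tangent A p" by simp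
  show "Jmap A p v (coord \<phi> i) = J_factor i * v (coord \<phi> i)" if "(V, \<phi>) \<in> A" "p \<in> V" for V \<phi>
    using P[OF PJ that] .
qed

lemmas Jmap_tangent = Jmap_props(1)
lemmas Jmap_coord = Jmap_props(2)

lemma Jmap_eqI:
  assumes "(V, \<phi>) \<in> A" "p \<in> V" "v \<in> tangent A p" "u \<in> tangent A p"
    and "\<And>i. J_factor i * v (coord \<phi> i) = u (coord \<phi> i)"
  shows "Jmap A p v = u"
  by (rule tangent_eqI[OF assms(1,2) Jmap_tangent[OF assms(3)] assms(4)])
    (simp add: Jmap_coord[OF assms(3,1,2)] assms(5))

lemma Jmap_add: "v \<in> tangent A p \<Longrightarrow> w \<in> tangent A p \<Longrightarrow> Jmap A p (v + w) = Jmap A p v + Jmap A p w"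
proof (rule chart_exists[of p], rule Jmap_eqI)
  fix V \<phi> i assume v: "v \<in> tangent A p" and w: "w \<in> tangent A p" and V: "(V, \<phi>) \<in> A" "p \<in> V"
  show "J_factor i * (v + w) (coord \<phi> i) = (Jmap A p v + Jmap A p w) (coord \<phi> i)"
    by (simp add: Jmap_coord[OF v V] Jmap_coord[OF w V] distrib_left)
qed (simp_all add: tangent_add Jmap_tangent)

lemma Jmap_scale: "v \<in> tangent A p \<Longrightarrow> Jmap A p (\<lambda>f. c * v f) = (\<lambda>f. c * Jmap A p v f)"
proof (rule chart_exists[of p], rule Jmap_eqI)
  fix V \<phi> i assume v: "v \<in> tangent A p" and V: "(V, \<phi>) \<in> A" "p \<in> V"
  show "J_factor i * (c * v (coord \<phi> i)) = c * Jmap A p v (coord \<phi> i)"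
    by (simp add: Jmap_coord[OF v V])
qed (simp_all add: tangent_scale Jmap_tangent)

lemma Jmap_zero: "Jmap A p 0 = 0"
  using Jmap_scale[OF tangent_zero, where c = 0 and p = p] by (simp add: zero_fun_def)

lemma Jmap_Jmap: "v \<in> tangent A p \<Longrightarrow> Jmap A p (Jmap A p v) = - v"
proof (rule chart_exists[of p], rule Jmap_eqI)
  fix V \<phi> i assume v: "v \<in> tangent A p" and V: "(V, \<phi>) \<in> A" "p \<in> V"
  show "J_factor i * Jmap A p v (coord \<phi> i) = (- v) (coord \<phi> i)"
    by (cases i) (simp_all add: Jmap_coord[OF v V])
qed (simp_all add: tangent_uminus Jmap_tangent)

lemma cnj_vec_coord:
  "cnj_vec v (coord \<phi> (Inl k)) = cnj (v (coord \<phi> (Inr k)))"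
  "cnj_vec v (coord \<phi> (Inr k)) = cnj (v (coord \<phi> (Inl k)))"
  by (simp_all add: cnj_vec_def coord_def[abs_def])

lemma cnj_vec_cnj_vec [simp]: "cnj_vec (cnj_vec v) = v"
  by (simp add: cnj_vec_def)

lemma cnj_covec_cnj_covec [simp]: "cnj_covec (cnj_covec \<alpha>) = \<alpha>"
  by (simp add: cnj_covec_def)

lemma Jmap_cnj: "v \<in> tangent A p \<Longrightarrow> Jmap A p (cnj_vec v) = cnj_vec (Jmap A p v)"
proof (rule chart_exists[of p], rule Jmap_eqI)
  fix V \<phi> i assume v: "v \<in> tangent A p" and V: "(V, \<phi>) \<in> A" "p \<in> V"
  show "J_factor i * cnj_vec v (coord \<phi> i) = cnj_vec (Jmap A p v) (coord \<phi> i)"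
    by (cases i) (simp_all add: cnj_vec_coord Jmap_coord[OF v V])
qed (simp_all add: tangent_cnj Jmap_tangent)

lemma Jmap_vf:
  assumes "open U" "vector_field A U Z" shows "vector_field A U (\<lambda>p. Jmap A p (Z p))"
proof (rule vf_components[OF _ assms(1)])
  fix p assume p: "p \<in> U"
  then show "Jmap A p (Z p) \<in> tangent A p" by (intro Jmap_tangent vf_tangent[OF assms(2)])
  obtain V \<phi> where V: "(V, \<phi>) \<in> A" "p \<in> V" by (rule chart_exists)
  have "smooth_fun A (U \<inter> V) (\<lambda>q. Jmap A q (Z q) (coord \<phi> i))" for i
  proof -
    have op: "open (U \<inter> V)" using assms(1) chart_open[OF V(1)] by auto
    show ?thesis
      by (rule smooth_fun_cong[OF op _ smooth_fun_cmult[OF op vf_coord_smooth[OF V(1) assms(2,1)]]])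
        (use Jmap_coord[OF vf_tangent[OF assms(2)] V(1)] in auto)
  qed
  then show "\<exists>(V, \<phi>)\<in>A. p \<in> V \<and> (\<forall>i. smooth_fun A (U \<inter> V) (\<lambda>q. Jmap A q (Z q) (coord \<phi> i)))"
    using V by blast
qed

lemma Jdual_cot: "\<alpha> \<in> cotangent A p \<Longrightarrow> Jdual A p \<alpha> \<in> cotangent A p"
  by (rule cotI) (simp_all add: Jdual_def Jmap_add Jmap_scale Jmap_tangent tangent_add tangent_scale
      cot_add cot_scale)

lemma Jdual_apply: "v \<in> tangent A p \<Longrightarrow> Jdual A p \<alpha> v = \<alpha> (Jmap A p v)"
  by (simp add: Jdual_def)

lemma Jdual_form:
  assumes "open U" "one_form A U \<alpha>" shows "one_form A U (\<lambda>p. Jdual A p (\<alpha> p))"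
proof (rule one_formI)
  fix p assume "p \<in> U"
  then show "Jdual A p (\<alpha> p) \<in> cotangent A p" by (intro Jdual_cot form_cot[OF assms(2)])
next
  fix W Y assume W: "open W" "W \<subseteq> U" "vector_field A W Y"
  show "smooth_fun A W (\<lambda>p. Jdual A p (\<alpha> p) (Y p))"
    by (rule smooth_fun_cong[OF W(1) _ form_smooth[OF assms(2) W(1,2) Jmap_vf[OF W(1,3)]]])
      (simp add: Jdual_apply vf_tangent[OF W(3)])
qed

lemma Jdual_add: "Jdual A p (\<alpha> + \<beta>) = Jdual A p \<alpha> + Jdual A p \<beta>"
  and Jdual_scale: "Jdual A p (\<lambda>v. c * \<alpha> v) = (\<lambda>v. c * Jdual A p \<alpha> v)"
  by (simp_all add: Jdual_def fun_eq_iff)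

lemma Jdual_Jdual: "\<alpha> \<in> cotangent A p \<Longrightarrow> Jdual A p (Jdual A p \<alpha>) = - \<alpha>"
proof
  fix v assume \<alpha>: "\<alpha> \<in> cotangent A p"
  show "Jdual A p (Jdual A p \<alpha>) v = (- \<alpha>) v"
    by (cases "v \<in> tangent A p")
      (simp_all add: Jdual_def Jmap_tangent Jmap_Jmap cot_uminus_vec[OF \<alpha>] cot_outside[OF \<alpha>])
qed

lemma Jdual_uminus: "Jdual A p (- \<alpha>) = - Jdual A p \<alpha>"
  by (simp add: Jdual_def fun_eq_iff)

lemma cnj_vec_tangent_iff: "cnj_vec v \<in> tangent A p \<longleftrightarrow> v \<in> tangent A p"
  using tangent_cnj[of v p] tangent_cnj[of "cnj_vec v" p] by auto

lemma Jdual_cnj: "\<alpha> \<in> cotangent A p \<Longrightarrow> Jdual A p (cnj_covec \<alpha>) = cnj_covec (Jdual A p \<alpha>)"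
  by (auto simp: Jdual_def cnj_covec_def cnj_vec_tangent_iff Jmap_cnj fun_eq_iff)

section \<open>Vectors and forms of pure type\<close>

lemma T10_tangent: "v \<in> T10 A p \<Longrightarrow> v \<in> tangent A p"
  and T01_tangent: "v \<in> T01 A p \<Longrightarrow> v \<in> tangent A p"
  by (simp_all add: T10_def T01_def)

text \<open>From here on, types are read off from the values on coordinates of a single chart.\<close>

lemma T10_iff:
  assumes V: "(V, \<phi>) \<in> A" "p \<in> V"
  shows "v \<in> T10 A p \<longleftrightarrow> v \<in> tangent A p \<and> (\<forall>k. v (coord \<phi> (Inr k)) = 0)"
proof (cases "v \<in> tangent A p")
  case v: True
  have "Jmap A p v = (\<lambda>f. \<i> * v f) \<longleftrightarrow> (\<forall>i. J_factor i * v (coord \<phi> i) = \<i> * v (coord \<phi> i))"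
    using Jmap_eqI[OF V v tangent_scale[OF v, of \<i>]] Jmap_coord[OF v V] by metis
  also have "\<dots> \<longleftrightarrow> (\<forall>k. v (coord \<phi> (Inr k)) = 0)"
    by (auto simp: J_factor_def neg_eq_iff_add_eq_0 split: sum.splits)
  finally show ?thesis using v by (simp add: T10_def)
qed (auto simp: T10_def)

lemma T01_iff:
  assumes V: "(V, \<phi>) \<in> A" "p \<in> V"
  shows "v \<in> T01 A p \<longleftrightarrow> v \<in> tangent A p \<and> (\<forall>k. v (coord \<phi> (Inl k)) = 0)"
proof (cases "v \<in> tangent A p")
  case v: True
  have "Jmap A p v = (\<lambda>f. - \<i> * v f) \<longleftrightarrow> (\<forall>i. J_factor i * v (coord \<phi> i) = - \<i> * v (coord \<phi> i))"
    using Jmap_eqI[OF V v tangent_scale[OF v, of "- \<i>"]] Jmap_coord[OF v V] by metis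
  also have "\<dots> \<longleftrightarrow> (\<forall>k. v (coord \<phi> (Inl k)) = 0)"
    by (auto simp: J_factor_def neg_eq_iff_add_eq_0 split: sum.splits)
  finally show ?thesis using v by (simp add: T01_def)
qed (auto simp: T01_def)

lemma frame_T10: "(V, \<phi>) \<in> A \<Longrightarrow> p \<in> V \<Longrightarrow> frame V \<phi> (Inl k) p \<in> T10 A p"
  and frame_T01: "(V, \<phi>) \<in> A \<Longrightarrow> p \<in> V \<Longrightarrow> frame V \<phi> (Inr k) p \<in> T01 A p"
  using T10_iff[of V \<phi> p] T01_iff[of V \<phi> p] by (simp_all add: frame_tangent frame_coord)

lemma T01_add: "v \<in> T01 A p \<Longrightarrow> w \<in> T01 A p \<Longrightarrow> v + w \<in> T01 A p"
  and T10_add: "v \<in> T10 A p \<Longrightarrow> w \<in> T10 A p \<Longrightarrow> v + w \<in> T10 A p"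
  by (simp_all add: T01_def T10_def tangent_add Jmap_add) (simp_all add: plus_fun_def algebra_simps)

lemma T01_scale: "v \<in> T01 A p \<Longrightarrow> (\<lambda>f. c * v f) \<in> T01 A p"
  and T10_scale: "v \<in> T10 A p \<Longrightarrow> (\<lambda>f. c * v f) \<in> T10 A p"
  by (simp_all add: T01_def T10_def tangent_scale Jmap_scale algebra_simps)

lemma T01_zero: "0 \<in> T01 A p" and T10_zero: "0 \<in> T10 A p"
  by (simp_all add: T01_def T10_def tangent_zero Jmap_zero) (simp_all add: zero_fun_def)

lemma T01_diff: "v \<in> T01 A p \<Longrightarrow> w \<in> T01 A p \<Longrightarrow> v - w \<in> T01 A p"
  and T10_diff: "v \<in> T10 A p \<Longrightarrow> w \<in> T10 A p \<Longrightarrow> v - w \<in> T10 A p"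
  using T01_add[OF _ T01_scale, of v p w "-1"] T10_add[OF _ T10_scale, of v p w "-1"]
  by (simp_all add: plus_fun_def fun_diff_def)

lemma cnj_T10: "v \<in> T10 A p \<Longrightarrow> cnj_vec v \<in> T01 A p"
  by (simp add: T10_def T01_def tangent_cnj Jmap_cnj) (simp add: cnj_vec_def)

lemma T10_dual_iff:
  assumes V: "(V, \<phi>) \<in> A" "p \<in> V"
  shows "\<alpha> \<in> T10_dual A p \<longleftrightarrow> \<alpha> \<in> cotangent A p \<and> (\<forall>k. \<alpha> (frame V \<phi> (Inr k) p) = 0)"
proof safe
  assume \<alpha>: "\<alpha> \<in> cotangent A p" and 0: "\<forall>k. \<alpha> (frame V \<phi> (Inr k) p) = 0"
  have "\<alpha> z = 0" if "z \<in> T01 A p" for z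
    using that 0 cot_expand[OF V \<alpha> T01_tangent[OF that]]
    by (simp add: T01_iff[OF V] sum_UNIV_Plus)
  then show "\<alpha> \<in> T10_dual A p" using \<alpha> by (simp add: T10_dual_def)
qed (use frame_T01[OF V] in \<open>auto simp: T10_dual_def\<close>)

lemma T10_dual_cot: "\<alpha> \<in> T10_dual A p \<Longrightarrow> \<alpha> \<in> cotangent A p"
  and T10_dual_T01: "\<alpha> \<in> T10_dual A p \<Longrightarrow> z \<in> T01 A p \<Longrightarrow> \<alpha> z = 0"
  by (simp_all add: T10_dual_def)

lemma T10_dual_add: "\<alpha> \<in> T10_dual A p \<Longrightarrow> \<beta> \<in> T10_dual A p \<Longrightarrow> \<alpha> + \<beta> \<in> T10_dual A p"
  and T10_dual_scale: "\<alpha> \<in> T10_dual A p \<Longrightarrow> (\<lambda>v. c * \<alpha> v) \<in> T10_dual A p"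
  and T10_dual_zero: "0 \<in> T10_dual A p"
  by (simp_all add: T10_dual_def cotangent_add cotangent_scale cotangent_zero)

lemma dz_T10_dual: "(V, \<phi>) \<in> A \<Longrightarrow> p \<in> V \<Longrightarrow> differential A (coord \<phi> (Inl k)) p \<in> T10_dual A p"
  using T10_dual_iff[of V \<phi> p] by (simp add: differential_cot frame_tangent frame_coord)

lemma T10_T01_trivial: "v \<in> T10 A p \<Longrightarrow> v \<in> T01 A p \<Longrightarrow> v = 0"
proof
  fix f assume "v \<in> T10 A p" "v \<in> T01 A p"
  then have "(\<lambda>f. \<i> * v f) = (\<lambda>f. - \<i> * v f)" by (simp add: T10_def T01_def)
  from fun_cong[OF this, of f] show "v f = 0 f" by simp
qed

lemma pr01_unique:
  assumes "z \<in> T01 A p" "v - z \<in> T10 A p" shows "pr01 A p v = z"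
  unfolding pr01_def
proof (rule the_equality)
  fix y assume y: "y \<in> T01 A p \<and> v - y \<in> T10 A p"
  have "(v - z) - (v - y) \<in> T10 A p" by (rule T10_diff) (use assms y in auto)
  then have "y - z \<in> T10 A p" by simp
  moreover have "y - z \<in> T01 A p" by (rule T01_diff) (use assms y in auto)
  ultimately show "y = z" using T10_T01_trivial by fastforce
qed (use assms in simp)

lemma pr01_props:
  assumes v: "v \<in> tangent A p"
  shows "pr01 A p v \<in> T01 A p" "v - pr01 A p v \<in> T10 A p"
proof -
  obtain V \<phi> where V: "(V, \<phi>) \<in> A" "p \<in> V" by (rule chart_exists)
  define z where "z = (\<lambda>f. \<Sum>k\<in>UNIV. v (coord \<phi> (Inr k)) * frame V \<phi> (Inr k) p f)"
  have zt: "z \<in> tangent A p" unfolding z_def by (intro tangent_sum frame_tangent[OF V])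
  have z: "z \<in> T01 A p" using zt unfolding T01_iff[OF V] by (simp add: z_def frame_coord[OF V])
  have zr: "z (coord \<phi> (Inr k)) = v (coord \<phi> (Inr k))" for k
    unfolding z_def frame_coord[OF V] by (simp add: if_distrib[of "(*) _"] cong: if_cong)
  have "v - z \<in> T10 A p" using tangent_diff[OF v zt] unfolding T10_iff[OF V] by (simp add: zr)
  with z have "pr01 A p v = z" by (rule pr01_unique)
  with z \<open>v - z \<in> T10 A p\<close> show "pr01 A p v \<in> T01 A p" "v - pr01 A p v \<in> T10 A p" by simp_all
qed

lemma pr01_T01: "v \<in> T01 A p \<Longrightarrow> pr01 A p v = v"
  by (rule pr01_unique) (simp_all add: T10_zero)

lemma pr01_T10: "v \<in> T10 A p \<Longrightarrow> pr01 A p v = 0"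
  by (rule pr01_unique) (simp_all add: T01_zero)

lemma pr01_add: "v \<in> tangent A p \<Longrightarrow> w \<in> tangent A p \<Longrightarrow> pr01 A p (v + w) = pr01 A p v + pr01 A p w"
  using T10_add[OF pr01_props(2) pr01_props(2), of v p w]
  by (intro pr01_unique T01_add pr01_props) (auto simp: algebra_simps)

lemma pr01_diff: "v \<in> tangent A p \<Longrightarrow> w \<in> tangent A p \<Longrightarrow> pr01 A p (v - w) = pr01 A p v - pr01 A p w"
  using T10_diff[OF pr01_props(2) pr01_props(2), of v p w]
  by (intro pr01_unique T01_diff pr01_props) (auto simp: algebra_simps)

text \<open>If \<open>Z\<close> and \<open>W\<close> map a coordinate to constants, then each term of the commutator on it is the derivative
  of a constant. The involutivity of both type distributions and the commutation of the frame
  fields follow.\<close>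

lemma bracket_coord_zero:
  assumes U: "open U" "p \<in> U" "vector_field A U Z" "vector_field A U W" and V: "(V, \<phi>) \<in> A" "p \<in> V"
    and "\<And>q. q \<in> U \<inter> V \<Longrightarrow> Z q (coord \<phi> i) = c" "\<And>q. q \<in> U \<inter> V \<Longrightarrow> W q (coord \<phi> i) = d"
  shows "vf_bracket A Z W p (coord \<phi> i) = 0"
proof -
  have op: "open (U \<inter> V)" "p \<in> U \<inter> V" using U V chart_open by auto
  have "Z p (\<lambda>q. W q (coord \<phi> i)) = Z p (\<lambda>q. d)"
    by (rule tangent_germ[OF vf_tangent[OF U(3,2)] op vf_coord_smooth[OF V(1) U(4,1)]]) (rule assms(8))
  moreover have "W p (\<lambda>q. Z q (coord \<phi> i)) = W p (\<lambda>q. c)"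
    by (rule tangent_germ[OF vf_tangent[OF U(4,2)] op vf_coord_smooth[OF V(1) U(3,1)]]) (rule assms(7))
  ultimately show ?thesis
    unfolding vf_bracket_apply[OF coord_smooth_at[OF V]]
    using tangent_const_fun[OF vf_tangent[OF U(3,2)]] tangent_const_fun[OF vf_tangent[OF U(4,2)]] by simp
qed

lemma T01_involutive:
  assumes U: "open U" "p \<in> U" "vector_field A U Z" "vector_field A U W"
    and "\<And>q. q \<in> U \<Longrightarrow> Z q \<in> T01 A q" "\<And>q. q \<in> U \<Longrightarrow> W q \<in> T01 A q"
  shows "vf_bracket A Z W p \<in> T01 A p"
proof -
  obtain V \<phi> where V: "(V, \<phi>) \<in> A" "p \<in> V" by (rule chart_exists)
  have "Z q (coord \<phi> (Inl k)) = 0" "W q (coord \<phi> (Inl k)) = 0" if "q \<in> U \<inter> V" for q k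
    using that assms(5,6)[of q] T01_iff[OF V(1), of q] by simp_all
  then have "vf_bracket A Z W p (coord \<phi> (Inl k)) = 0" for k
    by (rule bracket_coord_zero[OF U V])
  then show ?thesis unfolding T01_iff[OF V] using vf_bracket_tangent[OF U] by simp
qed

lemma T10_involutive:
  assumes U: "open U" "p \<in> U" "vector_field A U Z" "vector_field A U W"
    and "\<And>q. q \<in> U \<Longrightarrow> Z q \<in> T10 A q" "\<And>q. q \<in> U \<Longrightarrow> W q \<in> T10 A q"
  shows "vf_bracket A Z W p \<in> T10 A p"
proof -
  obtain V \<phi> where V: "(V, \<phi>) \<in> A" "p \<in> V" by (rule chart_exists)
  have "Z q (coord \<phi> (Inr k)) = 0" "W q (coord \<phi> (Inr k)) = 0" if "q \<in> U \<inter> V" for q k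
    using that assms(5,6)[of q] T10_iff[OF V(1), of q] by simp_all
  then have "vf_bracket A Z W p (coord \<phi> (Inr k)) = 0" for k
    by (rule bracket_coord_zero[OF U V])
  then show ?thesis unfolding T10_iff[OF V] using vf_bracket_tangent[OF U] by simp
qed

lemma frame_bracket:
  assumes V: "(V, \<phi>) \<in> A" "p \<in> V" shows "vf_bracket A (frame V \<phi> i) (frame V \<phi> j) p = 0"
proof (rule tangent_eqI[OF V _ tangent_zero])
  note vf = frame_vector_field[OF V(1)] and op = chart_open[OF V(1)] V(2)
  show "vf_bracket A (frame V \<phi> i) (frame V \<phi> j) p \<in> tangent A p"
    by (rule vf_bracket_tangent[OF op vf vf])
  show "vf_bracket A (frame V \<phi> i) (frame V \<phi> j) p (coord \<phi> k) = 0 (coord \<phi> k)" for k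
    using bracket_coord_zero[OF op vf vf V] frame_coord[OF V(1)] by simp
qed

section \<open>Bivector fields\<close>

lemma cot_expand_form:
  assumes V: "(V, \<phi>) \<in> A" "p \<in> V" and \<beta>: "\<beta> \<in> cotangent A p"
  shows "\<beta> = (\<lambda>v. \<Sum>i\<in>UNIV. \<beta> (frame V \<phi> i p) * differential A (coord \<phi> i) p v)"
proof
  fix v
  show "\<beta> v = (\<Sum>i\<in>UNIV. \<beta> (frame V \<phi> i p) * differential A (coord \<phi> i) p v)"
  proof (cases "v \<in> tangent A p")
    case True
    show ?thesis by (rule trans[OF cot_expand[OF V \<beta> True]]) (simp add: True mult.commute)
  qed (simp add: cot_outside[OF \<beta>] differential_def)
qed

context
  fixes P :: "'a bivector"
  assumes P: "bivector_field A P"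
begin

lemma biv_commute: "\<alpha> \<in> cotangent A p \<Longrightarrow> \<beta> \<in> cotangent A p \<Longrightarrow> P p \<beta> \<alpha> = - P p \<alpha> \<beta>"
  and biv_scale: "\<alpha> \<in> cotangent A p \<Longrightarrow> \<beta> \<in> cotangent A p \<Longrightarrow> P p \<alpha> (\<lambda>v. c * \<beta> v) = c * P p \<alpha> \<beta>"
  and biv_add: "\<alpha> \<in> cotangent A p \<Longrightarrow> \<beta> \<in> cotangent A p \<Longrightarrow> \<gamma> \<in> cotangent A p \<Longrightarrow>
    P p \<alpha> (\<beta> + \<gamma>) = P p \<alpha> \<beta> + P p \<alpha> \<gamma>"
  and biv_smooth: "open U \<Longrightarrow> one_form A U \<alpha>' \<Longrightarrow> one_form A U \<beta>' \<Longrightarrow> smooth_fun A U (\<lambda>p. P p (\<alpha>' p) (\<beta>' p))"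
  using P unfolding bivector_field_def by blast+

lemma biv_sum:
  assumes \<alpha>: "\<alpha> \<in> cotangent A p" and \<beta>: "\<And>i. i \<in> I \<Longrightarrow> \<beta> i \<in> cotangent A p"
  shows "P p \<alpha> (\<lambda>v. \<Sum>i\<in>I. c i * \<beta> i v) = (\<Sum>i\<in>I. c i * P p \<alpha> (\<beta> i))"
  using \<beta>
proof (induction I rule: infinite_finite_induct)
  case (insert i I)
  have "P p \<alpha> (\<lambda>v. \<Sum>i\<in>insert i I. c i * \<beta> i v) = P p \<alpha> ((\<lambda>v. c i * \<beta> i v) + (\<lambda>v. \<Sum>i\<in>I. c i * \<beta> i v))"
    using insert.hyps by (simp add: plus_fun_def)
  also have "\<dots> = P p \<alpha> (\<lambda>v. c i * \<beta> i v) + P p \<alpha> (\<lambda>v. \<Sum>i\<in>I. c i * \<beta> i v)"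
    by (intro biv_add[OF \<alpha>] cotangent_scale cot_sum) (use insert.prems in auto)
  also have "P p \<alpha> (\<lambda>v. c i * \<beta> i v) = c i * P p \<alpha> (\<beta> i)"
    using biv_scale[OF \<alpha>] insert.prems by simp
  finally show ?case using insert by simp
qed (use biv_scale[OF \<alpha> cotangent_zero, of 0] in \<open>simp_all add: zero_fun_def\<close>)

lemma sharp_props:
  assumes \<alpha>: "\<alpha> \<in> cotangent A p"
  shows "sharp A P p \<alpha> \<in> tangent A p \<and> (\<forall>\<beta>\<in>cotangent A p. \<beta> (sharp A P p \<alpha>) = P p \<alpha> \<beta>)"
proof -
  let ?Q = "\<lambda>v. v \<in> tangent A p \<and> (\<forall>\<beta>\<in>cotangent A p. \<beta> v = P p \<alpha> \<beta>)"
  obtain V \<phi> where V: "(V, \<phi>) \<in> A" "p \<in> V" by (rule chart_exists)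
  define v where "v = (\<lambda>f. \<Sum>i\<in>UNIV. P p \<alpha> (differential A (coord \<phi> i) p) * frame V \<phi> i p f)"
  have v: "v \<in> tangent A p" unfolding v_def by (intro tangent_sum frame_tangent[OF V])
  have "\<beta> v = P p \<alpha> \<beta>" if \<beta>: "\<beta> \<in> cotangent A p" for \<beta>
  proof -
    have "\<beta> v = (\<Sum>i\<in>UNIV. P p \<alpha> (differential A (coord \<phi> i) p) * \<beta> (frame V \<phi> i p))"
      unfolding v_def by (intro cot_lincomb[OF \<beta>] frame_tangent[OF V])
    also have "\<dots> = P p \<alpha> (\<lambda>v. \<Sum>i\<in>UNIV. \<beta> (frame V \<phi> i p) * differential A (coord \<phi> i) p v)"
      by (subst biv_sum[OF \<alpha> differential_cot]) (simp add: mult.commute)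
    also have "\<dots> = P p \<alpha> \<beta>" using cot_expand_form[OF V \<beta>] by simp
    finally show ?thesis .
  qed
  with v have Qv: "?Q v" by blast
  have "w = v" if "?Q w" for w
  proof (rule tangent_eqI[OF V _ v])
    fix i
    have "differential A (coord \<phi> i) p w = differential A (coord \<phi> i) p v"
      using that Qv differential_cot by metis
    then show "w (coord \<phi> i) = v (coord \<phi> i)" using that v by simp
  qed (use that in blast)
  then show ?thesis unfolding sharp_def by (intro theI[of ?Q, OF Qv])
qed

lemma sharp_tangent: "\<alpha> \<in> cotangent A p \<Longrightarrow> sharp A P p \<alpha> \<in> tangent A p"
  and sharp_pairing: "\<alpha> \<in> cotangent A p \<Longrightarrow> \<beta> \<in> cotangent A p \<Longrightarrow> \<beta> (sharp A P p \<alpha>) = P p \<alpha> \<beta>"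
  using sharp_props by blast+

lemma sharp_apply: "\<alpha> \<in> cotangent A p \<Longrightarrow> sharp A P p \<alpha> f = P p \<alpha> (differential A f p)"
  using sharp_pairing[OF _ differential_cot, of \<alpha> p f] by (simp add: sharp_tangent)

lemma sharp_eqI:
  assumes \<alpha>: "\<alpha> \<in> cotangent A p" and v: "v \<in> tangent A p"
    and "\<And>\<beta>. \<beta> \<in> cotangent A p \<Longrightarrow> \<beta> v = P p \<alpha> \<beta>"
  shows "sharp A P p \<alpha> = v"
proof -
  obtain V \<phi> where V: "(V, \<phi>) \<in> A" "p \<in> V" by (rule chart_exists)
  show ?thesis
    by (rule tangent_eqI[OF V sharp_tangent[OF \<alpha>] v])
      (use assms(3)[OF differential_cot] v in \<open>simp add: sharp_apply[OF \<alpha>]\<close>)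
qed

lemma sharp_add:
  assumes "\<alpha> \<in> cotangent A p" "\<beta> \<in> cotangent A p"
  shows "sharp A P p (\<alpha> + \<beta>) = sharp A P p \<alpha> + sharp A P p \<beta>"
proof (rule sharp_eqI[OF cotangent_add[OF assms]])
  fix \<gamma> assume \<gamma>: "\<gamma> \<in> cotangent A p"
  show "\<gamma> (sharp A P p \<alpha> + sharp A P p \<beta>) = P p (\<alpha> + \<beta>) \<gamma>"
    using biv_add[OF \<gamma> assms] cot_add[OF \<gamma> sharp_tangent[OF assms(1)] sharp_tangent[OF assms(2)]]
      sharp_pairing[OF assms(1) \<gamma>] sharp_pairing[OF assms(2) \<gamma>]
      biv_commute[OF \<gamma> cotangent_add[OF assms]] biv_commute[OF \<gamma> assms(1)] biv_commute[OF \<gamma> assms(2)]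
    by simp
qed (intro tangent_add sharp_tangent assms)

lemma sharp_scale:
  assumes "\<alpha> \<in> cotangent A p"
  shows "sharp A P p (\<lambda>v. c * \<alpha> v) = (\<lambda>f. c * sharp A P p \<alpha> f)"
proof (rule sharp_eqI[OF cotangent_scale[OF assms]])
  fix \<gamma> assume \<gamma>: "\<gamma> \<in> cotangent A p"
  show "\<gamma> (\<lambda>f. c * sharp A P p \<alpha> f) = P p (\<lambda>v. c * \<alpha> v) \<gamma>"
    using biv_scale[OF \<gamma> assms, of c] cot_scale[OF \<gamma> sharp_tangent[OF assms], of c]
      sharp_pairing[OF assms \<gamma>] biv_commute[OF \<gamma> cotangent_scale[OF assms, of c]] biv_commute[OF \<gamma> assms]
    by simp
qed (intro tangent_scale sharp_tangent assms)

lemma sharp_vf: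
  assumes "open U" "one_form A U \<alpha>" shows "vector_field A U (\<lambda>p. sharp A P p (\<alpha> p))"
proof (rule vf_components[OF _ assms(1)])
  fix p assume p: "p \<in> U"
  then show "sharp A P p (\<alpha> p) \<in> tangent A p" by (intro sharp_tangent form_cot[OF assms(2)])
  obtain V \<phi> where V: "(V, \<phi>) \<in> A" "p \<in> V" by (rule chart_exists)
  have op: "open (U \<inter> V)" using assms(1) chart_open[OF V(1)] by auto
  have "smooth_fun A (U \<inter> V) (\<lambda>q. sharp A P q (\<alpha> q) (coord \<phi> i))" for i
  proof (rule smooth_fun_cong[OF op])
    show "smooth_fun A (U \<inter> V) (\<lambda>q. P q (\<alpha> q) (differential A (coord \<phi> i) q))"
      by (intro biv_smooth op form_subset[OF assms(2)] differential_form
          smooth_fun_subset[OF coord_smooth[OF V(1)]]) auto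
  qed (use form_cot[OF assms(2)] in \<open>simp add: sharp_apply\<close>)
  then show "\<exists>(V, \<phi>)\<in>A. p \<in> V \<and> (\<forall>i. smooth_fun A (U \<inter> V) (\<lambda>q. sharp A P q (\<alpha> q) (coord \<phi> i)))"
    using V by blast
qed

end

end

section \<open>Holomorphic Poisson structures\<close>

locale holomorphic_poisson_manifold = complex_manifold A
  for A :: "('a::topological_space, 'n::finite) atlas" +
  fixes \<pi> :: "'a bivector"
  assumes poisson: "holomorphic_poisson A \<pi>"
begin

lemma pi_bivector: "bivector_field A \<pi>"
  using poisson unfolding holomorphic_poisson_def bivector_field_20_def by blast

lemma pi_type:
  assumes "\<alpha> \<in> cotangent A p" "\<beta> \<in> cotangent A p" "\<And>v. v \<in> T10 A p \<Longrightarrow> \<alpha> v = 0"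
  shows "\<pi> p \<alpha> \<beta> = 0"
proof -
  have "bivector_field_20 A \<pi>" using poisson unfolding holomorphic_poisson_def by (elim conjE)
  then have "\<forall>p. \<forall>\<alpha>\<in>cotangent A p. \<forall>\<beta>\<in>cotangent A p. (\<forall>v\<in>T10 A p. \<alpha> v = 0) \<longrightarrow> \<pi> p \<alpha> \<beta> = 0"
    unfolding bivector_field_20_def by (elim conjE)
  from this[THEN spec, THEN bspec, THEN bspec, THEN mp, OF assms(1,2)] assms(3)
  show ?thesis by simp
qed

lemmas pi_commute = biv_commute[OF pi_bivector]
  and pi_smooth = biv_smooth[OF pi_bivector]
  and pi_sharp_tangent = sharp_tangent[OF pi_bivector]
  and pi_sharp_pairing = sharp_pairing[OF pi_bivector]
  and pi_sharp_apply = sharp_apply[OF pi_bivector]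
  and pi_sharp_vf = sharp_vf[OF pi_bivector]

text \<open>A bivector of type (2,0) contracts to zero with forms that annihilate (1,0)-vectors, among them the
  differentials of the antiholomorphic coordinates.\<close>

lemma pi_sharp_T10:
  assumes \<alpha>: "\<alpha> \<in> cotangent A p" shows "sharp A \<pi> p \<alpha> \<in> T10 A p"
proof -
  obtain V \<phi> where V: "(V, \<phi>) \<in> A" "p \<in> V" by (rule chart_exists)
  have "sharp A \<pi> p \<alpha> (coord \<phi> (Inr k)) = 0" for k
  proof -
    have "differential A (coord \<phi> (Inr k)) p v = 0" if "v \<in> T10 A p" for v
      using that T10_iff[OF V] by simp
    then have "\<pi> p (differential A (coord \<phi> (Inr k)) p) \<alpha> = 0"
      by (intro pi_type differential_cot \<alpha>)
    then show ?thesis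
      using pi_commute[OF \<alpha> differential_cot] by (simp add: pi_sharp_apply[OF \<alpha>])
  qed
  then show ?thesis unfolding T10_iff[OF V] using pi_sharp_tangent[OF \<alpha>] by simp
qed

lemma lie_deriv_frame_coord:
  assumes V: "(V, \<phi>) \<in> A" "p \<in> V"
  shows "lie_deriv A (frame V \<phi> i) (differential A (coord \<phi> j)) p = 0"
proof (rule cot_eqI_frame[OF V _ cotangent_zero])
  note op = chart_open[OF V(1)] and vf = frame_vector_field[OF V(1)]
  have dz: "one_form A V (differential A (coord \<phi> j))"
    by (rule differential_form[OF op coord_smooth[OF V(1)]])
  show "lie_deriv A (frame V \<phi> i) (differential A (coord \<phi> j)) p \<in> cotangent A p"
    by (rule lie_deriv_cot[OF op V(2) vf dz])
  fix k
  have "frame V \<phi> i p (\<lambda>q. differential A (coord \<phi> j) q (frame V \<phi> k q)) =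
      frame V \<phi> i p (\<lambda>q. if k = j then 1 else 0)"
    by (rule tangent_germ[OF frame_tangent[OF V] op V(2) form_smooth[OF dz op order_refl vf]])
      (simp add: frame_tangent[OF V(1)] frame_coord[OF V(1)])
  then show "lie_deriv A (frame V \<phi> i) (differential A (coord \<phi> j)) p (frame V \<phi> k p) = 0 (frame V \<phi> k p)"
    unfolding lie_deriv_eval[OF op V(2) vf dz vf] frame_bracket[OF V]
    by (simp add: tangent_const_fun[OF frame_tangent[OF V]] cot_zero_vec[OF differential_cot])
qed

lemma pi_dbar:
  assumes "open U" "vector_field A U Z" "one_form A U \<xi>" "one_form A U \<eta>"
    and "\<And>q. q \<in> U \<Longrightarrow> Z q \<in> T01 A q \<and> \<xi> q \<in> T10_dual A q \<and> \<eta> q \<in> T10_dual A q" and "p \<in> U"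
  shows "dbar_bivector A \<pi> Z \<xi> \<eta> p = 0"
proof -
  have "\<forall>U Z \<xi> \<eta>. open U \<and> vector_field A U Z \<and> one_form A U \<xi> \<and> one_form A U \<eta> \<and>
        (\<forall>q\<in>U. Z q \<in> T01 A q \<and> \<xi> q \<in> T10_dual A q \<and> \<eta> q \<in> T10_dual A q) \<longrightarrow>
        (\<forall>p\<in>U. dbar_bivector A \<pi> Z \<xi> \<eta> p = 0)"
    using poisson unfolding holomorphic_poisson_def by (elim conjE)
  from this[THEN spec, THEN spec, THEN spec, THEN spec, THEN mp, THEN bspec, OF _ assms(6)]
  show ?thesis using assms(1-5) by simp
qed

text \<open>In \<open>(\<partial>bar\<^sub>Z \<pi>)(dz\<^sub>k, dz\<^sub>l) = 0\<close> with \<open>Z\<close> a frame field, both Lie derivatives vanish by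
  \<open>lie_deriv_frame_coord\<close>, which leaves the derivative of the coefficient.\<close>

lemma pi_coefficients_holomorphic:
  assumes V: "(V, \<phi>) \<in> A" "p \<in> V"
  shows "frame V \<phi> (Inr j) p
    (\<lambda>q. \<pi> q (differential A (coord \<phi> (Inl k)) q) (differential A (coord \<phi> (Inl l)) q)) = 0"
proof -
  note op = chart_open[OF V(1)] and vf = frame_vector_field[OF V(1)]
  have dz: "one_form A V (differential A (coord \<phi> i))" for i
    by (rule differential_form[OF op coord_smooth[OF V(1)]])
  have "dbar_bivector A \<pi> (frame V \<phi> (Inr j)) (differential A (coord \<phi> (Inl k)))
      (differential A (coord \<phi> (Inl l))) p = 0"
    by (rule pi_dbar[OF op vf dz dz _ V(2)]) (simp add: frame_T01[OF V(1)] dz_T10_dual[OF V(1)])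
  moreover have "\<pi> p \<alpha> 0 = 0" "\<pi> p 0 \<alpha> = 0" if "\<alpha> \<in> cotangent A p" for \<alpha>
    using biv_scale[OF pi_bivector that cotangent_zero, of 0] pi_commute[OF that cotangent_zero]
    by (simp_all add: zero_fun_def)
  ultimately show ?thesis
    by (simp add: dbar_bivector_def nabla_vec_form_def lie_deriv_frame_coord[OF V] differential_cot)
qed

text \<open>With \<open>{f, g} = \<pi>(df, dg)\<close>, evaluation on \<open>h\<close> turns the claim into
  \<open>{f, {g, h}} - {g, {f, h}} = {{f, g}, h}\<close>. This is the Jacobi identity, and half of the
  Schouten bracket of \<open>\<pi>\<close> with itself is its cyclic sum.\<close>

lemma hamiltonian_bracket:
  assumes U: "open U" "p \<in> U" and f: "smooth_fun A U f" and g: "smooth_fun A U g"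
  shows "vf_bracket A (\<lambda>q. sharp A \<pi> q (differential A f q)) (\<lambda>q. sharp A \<pi> q (differential A g q)) p =
    sharp A \<pi> p (differential A (\<lambda>q. \<pi> q (differential A f q) (differential A g q)) p)"
    (is "vf_bracket A ?Xf ?Xg p = ?R")
proof
  fix h
  note vf = pi_sharp_vf[OF U(1) differential_form[OF U(1)]]
  note tan = vf_tangent[OF vf U(2)]
  show "vf_bracket A ?Xf ?Xg p h = ?R h"
  proof (cases "smooth_at A p h")
    case False
    then show ?thesis
      using tangent_nonsmooth[OF pi_sharp_tangent[OF differential_cot]] by (simp add: vf_bracket_def)
  next
    case h: True
    let ?X = "\<lambda>f q. sharp A \<pi> q (differential A f q)"
    let ?br = "\<lambda>f g q. \<pi> q (differential A f q) (differential A g q)"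
    have X: "?X f q g = ?br f g q" for f g q by (rule pi_sharp_apply[OF differential_cot])
    have anti: "?br f g q = - ?br g f q" for f g q by (rule pi_commute[OF differential_cot differential_cot])
    have s: "smooth_at A p f" "smooth_at A p g" using f g U smooth_atI by blast+
    have "\<forall>p f g h. smooth_at A p f \<and> smooth_at A p g \<and> smooth_at A p h \<longrightarrow> schouten A \<pi> \<pi> p f g h = 0"
      using poisson unfolding holomorphic_poisson_def by (elim conjE)
    then have "schouten A \<pi> \<pi> p f g h = 0" using s h by simp
    then have "2 * (?br (?br f g) h p + ?br (?br g h) f p + ?br (?br h f) g p) = 0"
      unfolding schouten_def Let_def by (simp add: algebra_simps)
    then have jac: "?br (?br f g) h p + ?br (?br g h) f p + ?br (?br h f) g p = 0"
      by (simp only: mult_eq_0_iff) simp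
    obtain T where T: "open T" "p \<in> T" "T \<subseteq> U" "smooth_fun A T h" using smooth_atE[OF h U] .
    have "smooth_fun A T (?br f h)"
      by (intro pi_smooth differential_form T smooth_fun_subset[OF f])
    then have sm: "smooth_at A p (?br f h)" by (rule smooth_atI[OF T(1,2)])
    have "?X g p (?br h f) = ?X g p (\<lambda>q. - ?br f h q)" by (subst anti) simp
    also have "\<dots> = - ?X g p (?br f h)" by (rule tangent_minus_fun[OF tan[OF g] sm])
    finally have 1: "?br g (?br h f) p = - ?br g (?br f h) p" by (simp add: X)
    have "vf_bracket A ?Xf ?Xg p h = ?br f (?br g h) p - ?br g (?br f h) p"
      unfolding vf_bracket_apply[OF h] X ..
    also have "\<dots> = ?br (?br f g) h p"
      using jac 1 anti[where f = "?br g h" and g = f and q = p] anti[where f = "?br h f" and g = g and q = p] by (simp add: algebra_simps)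
    finally show ?thesis by (simp add: X)
  qed
qed

end

section \<open>The Courant bracket on isotropic sections\<close>

abbreviation vpart :: "('a \<Rightarrow> 'a gvec) \<Rightarrow> 'a \<Rightarrow> 'a tvec" where
  "vpart s \<equiv> \<lambda>q. fst (s q)"

abbreviation fpart :: "('a \<Rightarrow> 'a gvec) \<Rightarrow> 'a \<Rightarrow> 'a covec" where
  "fpart s \<equiv> \<lambda>q. snd (s q)"

definition isotropic_on :: "'a set \<Rightarrow> ('a \<Rightarrow> 'a gvec) \<Rightarrow> ('a \<Rightarrow> 'a gvec) \<Rightarrow> bool" where
  "isotropic_on U s t \<longleftrightarrow> (\<forall>q\<in>U. snd (s q) (fst (t q)) + snd (t q) (fst (s q)) = 0)"

text \<open>A combination of sections with variable coefficients. It is written in components so that it does not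
  presuppose a scalar multiplication on the fibres.\<close>

definition gcomb :: "'i set \<Rightarrow> ('i \<Rightarrow> 'a \<Rightarrow> complex) \<Rightarrow> ('i \<Rightarrow> 'a \<Rightarrow> 'a gvec) \<Rightarrow> 'a \<Rightarrow> 'a gvec" where
  "gcomb I c e q =
     ((\<lambda>f. \<Sum>i\<in>I. c i q * fst (e i q) f), (\<lambda>v. \<Sum>i\<in>I. c i q * snd (e i q) v))"

lemma fst_gcomb: "fst (gcomb I c e q) = (\<lambda>f. \<Sum>i\<in>I. c i q * fst (e i q) f)"
  and snd_gcomb: "snd (gcomb I c e q) = (\<lambda>v. \<Sum>i\<in>I. c i q * snd (e i q) v)"
  by (simp_all add: gcomb_def)

lemma isotropic_on_subset: "isotropic_on U s t \<Longrightarrow> W \<subseteq> U \<Longrightarrow> isotropic_on W s t"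
  by (auto simp: isotropic_on_def)

lemma courant_vpart: "fst (courant_bracket A s t p) = vf_bracket A (vpart s) (vpart t) p"
  by (simp add: courant_bracket_def Let_def)

context complex_manifold
begin

lemma gsection_vpart: "gsection A U s \<Longrightarrow> vector_field A U (vpart s)"
  and gsection_fpart: "gsection A U s \<Longrightarrow> one_form A U (fpart s)"
  by (simp_all add: gsection_def)

lemma gsection_subset: "gsection A U s \<Longrightarrow> W \<subseteq> U \<Longrightarrow> gsection A W s"
  using vf_subset[of U "vpart s" W] form_subset[of U "fpart s" W] by (simp add: gsection_def)

lemma gsection_gcomb:
  assumes "\<And>i. i \<in> I \<Longrightarrow> smooth_fun A U (c i)" "\<And>i. i \<in> I \<Longrightarrow> gsection A U (e i)"
  shows "gsection A U (gcomb I c e)"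
  unfolding gsection_def fst_gcomb snd_gcomb
  by (intro conjI vf_sum form_sum assms(1) gsection_vpart gsection_fpart assms(2))

lemma gsection_courant:
  assumes U: "open U" and s: "gsection A U s" and t: "gsection A U t"
  shows "gsection A U (courant_bracket A s t)"
  unfolding gsection_def courant_vpart
proof
  note V = gsection_vpart[OF s] gsection_vpart[OF t] and F = gsection_fpart[OF s] gsection_fpart[OF t]
  show "vector_field A U (vf_bracket A (vpart s) (vpart t))" by (rule vf_bracket_vf[OF U V])
  have "smooth_fun A U (\<lambda>q. snd (s q) (fst (t q)) - snd (t q) (fst (s q)))"
    by (intro smooth_fun_diff form_smooth[OF F(1)] form_smooth[OF F(2)] U V order_refl)
  then show "one_form A U (fpart (courant_bracket A s t))"
    unfolding courant_bracket_def Let_def snd_conv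
    by (intro form_add form_diff lie_deriv_form form_scale differential_form U V F smooth_fun_const)
qed

text \<open>For orthogonal sections with forms \<open>\<xi>\<close>, \<open>\<eta>\<close> and vector parts \<open>V\<close>, \<open>W\<close>, \<open>\<xi> W - \<eta> V = 2 \<xi> W\<close>, so the exact
  term of the Courant bracket becomes \<open>d (\<xi> W)\<close>. All identities for the bracket are proved by
  evaluating its form part through this formula.\<close>

lemma courant_fpart_apply:
  assumes U: "open U" "p \<in> U" and s: "gsection A U s" and t: "gsection A U t"
    and iso: "isotropic_on U s t" and Y: "vector_field A U Y"
  shows "snd (courant_bracket A s t p) (Y p) =
    vpart s p (\<lambda>q. fpart t q (Y q)) - fpart t p (vf_bracket A (vpart s) Y p)
    - vpart t p (\<lambda>q. fpart s q (Y q)) + fpart s p (vf_bracket A (vpart t) Y p)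
    + Y p (\<lambda>q. fpart s q (vpart t q))"
proof -
  note V = gsection_vpart[OF s] gsection_vpart[OF t] and F = gsection_fpart[OF s] gsection_fpart[OF t]
  note Yp = vf_tangent[OF Y U(2)]
  have sm: "smooth_fun A U (\<lambda>q. snd (s q) (fst (t q)))"
    by (rule form_smooth[OF F(1) U(1) order_refl V(2)])
  have "Y p (\<lambda>q. snd (s q) (fst (t q)) - snd (t q) (fst (s q))) = Y p (\<lambda>q. 2 * snd (s q) (fst (t q)))"
  proof (rule tangent_germ[OF Yp U])
    show "smooth_fun A U (\<lambda>q. snd (s q) (fst (t q)) - snd (t q) (fst (s q)))"
      by (intro smooth_fun_diff sm form_smooth[OF F(2)] U V order_refl)
  qed (use iso in \<open>simp add: isotropic_on_def add_eq_0_iff2\<close>)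
  also have "\<dots> = 2 * Y p (\<lambda>q. snd (s q) (fst (t q)))"
    by (rule tangent_cmult_fun[OF Yp smooth_atI[OF U sm]])
  finally show ?thesis
    by (simp add: courant_bracket_def Let_def lie_deriv_eval[OF U _ _ Y] V F Yp)
qed

lemma courant_commute:
  assumes U: "open U" "p \<in> U" and s: "gsection A U s" and t: "gsection A U t"
  shows "courant_bracket A t s p = - courant_bracket A s t p"
proof -
  note V = gsection_vpart[OF s] gsection_vpart[OF t] and F = gsection_fpart[OF s] gsection_fpart[OF t]
  let ?u = "\<lambda>q. snd (s q) (fst (t q)) - snd (t q) (fst (s q))"
  have "smooth_fun A U ?u"
    by (intro smooth_fun_diff form_smooth[OF F(1)] form_smooth[OF F(2)] U V order_refl)
  then have "smooth_at A p ?u" by (rule smooth_atI[OF U])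
  then have "differential A (\<lambda>q. snd (t q) (fst (s q)) - snd (s q) (fst (t q))) p v = - differential A ?u p v" for v
    using tangent_minus_fun[of v p ?u] by (simp add: differential_def)
  then show ?thesis
    unfolding courant_bracket_def Let_def
    by (auto simp: prod_eq_iff fun_eq_iff vf_bracket_commute[of _ "vpart s"])
qed

lemma isotropic_on_gcomb:
  assumes s: "gsection A U s" and e: "\<And>i. i \<in> I \<Longrightarrow> gsection A U (e i)"
    and iso: "\<And>i. i \<in> I \<Longrightarrow> isotropic_on U s (e i)"
  shows "isotropic_on U s (gcomb I c e)"
  unfolding isotropic_on_def
proof
  fix q assume q: "q \<in> U"
  have "snd (s q) (fst (gcomb I c e q)) + snd (gcomb I c e q) (fst (s q)) =
      (\<Sum>i\<in>I. c i q * (snd (s q) (fst (e i q)) + snd (e i q) (fst (s q))))"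
    unfolding fst_gcomb snd_gcomb
    by (subst cot_lincomb[OF form_cot[OF gsection_fpart[OF s] q]])
      (auto intro: vf_tangent[OF gsection_vpart[OF e] q] simp: distrib_left sum.distrib)
  also have "\<dots> = 0" using iso q by (intro sum.neutral) (simp add: isotropic_on_def)
  finally show "snd (s q) (fst (gcomb I c e q)) + snd (gcomb I c e q) (fst (s q)) = 0" .
qed

text \<open>The Courant bracket violates the Leibniz rule by a multiple of the pairing of \<open>s\<close> with the
  other section, times the differential of the coefficient. For orthogonal sections this defect is
  absent: with the exact term in the form \<open>d (\<xi> W)\<close>, the terms with \<open>Y (c\<^sub>i)\<close> cancel.\<close>

lemma courant_gcomb:
  assumes U: "open U" "p \<in> U" and s: "gsection A U s"
    and c: "\<And>i. i \<in> I \<Longrightarrow> smooth_fun A U (c i)" and e: "\<And>i. i \<in> I \<Longrightarrow> gsection A U (e i)"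
    and iso: "\<And>i. i \<in> I \<Longrightarrow> isotropic_on U s (e i)"
  shows "courant_bracket A s (gcomb I c e) p =
    ((\<lambda>f. \<Sum>i\<in>I. c i p * fst (courant_bracket A s (e i) p) f + fst (s p) (c i) * fst (e i p) f),
     (\<lambda>v. \<Sum>i\<in>I. c i p * snd (courant_bracket A s (e i) p) v + fst (s p) (c i) * snd (e i p) v))"
    (is "?C = (?v, ?\<alpha>)")
proof (rule prod_eqI; simp only: fst_conv snd_conv)
  show "fst ?C = ?v"
    unfolding courant_vpart fst_gcomb
    by (rule vf_bracket_sum[OF U gsection_vpart[OF s] c gsection_vpart[OF e]])
  show "snd ?C = ?\<alpha>"
  proof (rule cot_eqI[OF U])
    show "snd ?C \<in> cotangent A p"
      by (rule form_cot[OF gsection_fpart[OF gsection_courant[OF U(1) s gsection_gcomb[OF c e]]] U(2)])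
    have "?\<alpha> = (\<lambda>v. \<Sum>i\<in>I. c i p * snd (courant_bracket A s (e i) p) v) +
        (\<lambda>v. \<Sum>i\<in>I. fst (s p) (c i) * snd (e i p) v)"
      by (simp add: plus_fun_def sum.distrib)
    also have "\<dots> \<in> cotangent A p"
      by (intro cotangent_add cot_sum form_cot[OF gsection_fpart[OF e] U(2)]
          form_cot[OF gsection_fpart[OF gsection_courant[OF U(1) s e]] U(2)])
    finally show "?\<alpha> \<in> cotangent A p" .
  next
    fix W Y assume W: "open W" "p \<in> W" "W \<subseteq> U" and Y: "vector_field A W Y"
    note sW = gsection_subset[OF s W(3)] and eW = gsection_subset[OF e W(3)]
      and cW = smooth_fun_subset[OF c W(3)] and isoW = isotropic_on_subset[OF iso W(3)]
    note Vs = gsection_vpart[OF sW] and Fs = gsection_fpart[OF sW]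
      and Ve = gsection_vpart[OF eW] and Fe = gsection_fpart[OF eW]
    note Yp = vf_tangent[OF Y W(2)] and Vp = vf_tangent[OF Vs W(2)] and \<xi>p = form_cot[OF Fs W(2)]
    note sm = smooth_atI[OF W(1,2)]
    let ?V = "vpart s" and ?\<xi> = "fpart s" and ?W = "\<lambda>i. vpart (e i)" and ?\<eta> = "\<lambda>i. fpart (e i)"
    \<comment> \<open>expand those terms of the evaluation formula in which a derivation meets the coefficients\<close>
    have e1: "?V p (\<lambda>q. fpart (gcomb I c e) q (Y q)) =
        (\<Sum>i\<in>I. c i p * ?V p (\<lambda>q. ?\<eta> i q (Y q)) + ?\<eta> i p (Y p) * ?V p (c i))"
    proof -
      have "?V p (\<lambda>q. \<Sum>i\<in>I. c i q * ?\<eta> i q (Y q)) = (\<Sum>i\<in>I. ?V p (\<lambda>q. c i q * ?\<eta> i q (Y q)))"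
        by (rule tangent_sum_fun[OF Vp]) (intro sm smooth_fun_mult cW form_smooth[OF Fe] W Y order_refl)
      also have "\<dots> = (\<Sum>i\<in>I. c i p * ?V p (\<lambda>q. ?\<eta> i q (Y q)) + ?\<eta> i p (Y p) * ?V p (c i))"
        by (intro sum.cong refl tangent_mult_fun[OF Vp] sm cW form_smooth[OF Fe] W Y order_refl)
      finally show ?thesis by (simp only: snd_gcomb)
    qed
    have e4: "?\<xi> p (vf_bracket A (vpart (gcomb I c e)) Y p) =
        (\<Sum>i\<in>I. c i p * ?\<xi> p (vf_bracket A (?W i) Y p) - Y p (c i) * ?\<xi> p (?W i p))"
    proof -
      have "vf_bracket A (vpart (gcomb I c e)) Y p = - vf_bracket A Y (vpart (gcomb I c e)) p"
        by (rule vf_bracket_commute)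
      also have "vf_bracket A Y (vpart (gcomb I c e)) p =
          (\<lambda>f. \<Sum>i\<in>I. c i p * vf_bracket A Y (?W i) p f + Y p (c i) * ?W i p f)"
        unfolding fst_gcomb by (rule vf_bracket_sum[OF W(1,2) Y cW Ve])
      also have "- \<dots> = (\<lambda>f. \<Sum>i\<in>I. c i p * vf_bracket A (?W i) Y p f + (- Y p (c i)) * ?W i p f)"
        by (simp add: fun_eq_iff vf_bracket_commute[of _ Y] sum_negf[symmetric])
      finally show ?thesis
        using cot_lincomb2[OF \<xi>p vf_bracket_tangent[OF W(1,2) Ve Y] vf_tangent[OF Ve W(2)],
            where I = I and c = "\<lambda>i. c i p" and d = "\<lambda>i. - Y p (c i)"]
        by simp
    qed
    have e5: "Y p (\<lambda>q. ?\<xi> q (vpart (gcomb I c e) q)) =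
        (\<Sum>i\<in>I. c i p * Y p (\<lambda>q. ?\<xi> q (?W i q)) + ?\<xi> p (?W i p) * Y p (c i))"
    proof -
      have "Y p (\<lambda>q. ?\<xi> q (vpart (gcomb I c e) q)) = Y p (\<lambda>q. \<Sum>i\<in>I. c i q * ?\<xi> q (?W i q))"
      proof (rule tangent_germ[OF Yp W(1,2)])
        show "smooth_fun A W (\<lambda>q. ?\<xi> q (vpart (gcomb I c e) q))"
          by (rule form_smooth[OF Fs W(1) order_refl gsection_vpart[OF gsection_gcomb[OF cW eW]]])
        fix q assume q: "q \<in> W"
        show "?\<xi> q (vpart (gcomb I c e) q) = (\<Sum>i\<in>I. c i q * ?\<xi> q (?W i q))"
          unfolding fst_gcomb by (intro cot_lincomb[OF form_cot[OF Fs q]] vf_tangent[OF Ve q])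
      qed
      also have "\<dots> = (\<Sum>i\<in>I. Y p (\<lambda>q. c i q * ?\<xi> q (?W i q)))"
        by (rule tangent_sum_fun[OF Yp]) (intro sm smooth_fun_mult cW form_smooth[OF Fs] W Ve order_refl)
      also have "\<dots> = (\<Sum>i\<in>I. c i p * Y p (\<lambda>q. ?\<xi> q (?W i q)) + ?\<xi> p (?W i p) * Y p (c i))"
        by (intro sum.cong refl tangent_mult_fun[OF Yp] sm cW form_smooth[OF Fs] W Ve order_refl)
      finally show ?thesis .
    qed
    have gW: "gsection A W (gcomb I c e)" by (rule gsection_gcomb[OF cW eW])
    have isoC: "isotropic_on W s (gcomb I c e)" by (rule isotropic_on_gcomb[OF sW eW isoW])
    have "snd ?C (Y p) =
        (\<Sum>i\<in>I. c i p * ?V p (\<lambda>q. ?\<eta> i q (Y q)) + ?\<eta> i p (Y p) * ?V p (c i))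
        - (\<Sum>i\<in>I. c i p * ?\<eta> i p (vf_bracket A ?V Y p))
        - (\<Sum>i\<in>I. c i p * ?W i p (\<lambda>q. ?\<xi> q (Y q)))
        + (\<Sum>i\<in>I. c i p * ?\<xi> p (vf_bracket A (?W i) Y p) - Y p (c i) * ?\<xi> p (?W i p))
        + (\<Sum>i\<in>I. c i p * Y p (\<lambda>q. ?\<xi> q (?W i q)) + ?\<xi> p (?W i p) * Y p (c i))"
      unfolding courant_fpart_apply[OF W(1,2) sW gW isoC Y] e1 e4 e5
      unfolding fst_gcomb snd_gcomb ..
    also have "\<dots> = (\<Sum>i\<in>I. c i p * (?V p (\<lambda>q. ?\<eta> i q (Y q)) - ?\<eta> i p (vf_bracket A ?V Y p)
        - ?W i p (\<lambda>q. ?\<xi> q (Y q)) + ?\<xi> p (vf_bracket A (?W i) Y p) + Y p (\<lambda>q. ?\<xi> q (?W i q)))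
        + ?V p (c i) * ?\<eta> i p (Y p))"
      unfolding sum.distrib[symmetric] sum_subtractf[symmetric]
      by (intro sum.cong refl) (simp add: algebra_simps)
    also have "\<dots> = ?\<alpha> (Y p)"
      by (intro sum.cong refl) (simp add: courant_fpart_apply[OF W(1,2) sW eW isoW Y])
    finally show "snd ?C (Y p) = ?\<alpha> (Y p)" .
  qed
qed

text \<open>Used to replace sections by their frame expansions, which are valid on a chart domain only.\<close>

lemma courant_cong:
  assumes U: "open U" "p \<in> U" and s: "gsection A U s" "gsection A U s'" and t: "gsection A U t" "gsection A U t'"
    and eq: "\<And>q. q \<in> U \<Longrightarrow> s q = s' q" "\<And>q. q \<in> U \<Longrightarrow> t q = t' q" and iso: "isotropic_on U s t"
  shows "courant_bracket A s t p = courant_bracket A s' t' p"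
proof (rule prod_eqI)
  show "fst (courant_bracket A s t p) = fst (courant_bracket A s' t' p)"
    unfolding courant_vpart
    by (rule vf_bracket_cong[OF U gsection_vpart[OF s(1)] gsection_vpart[OF t(1)]]) (simp_all add: eq)
  have iso': "isotropic_on U s' t'" using iso eq by (simp add: isotropic_on_def)
  show "snd (courant_bracket A s t p) = snd (courant_bracket A s' t' p)"
  proof (rule cot_eqI[OF U form_cot[OF gsection_fpart[OF gsection_courant[OF U(1) s(1) t(1)]] U(2)]
        form_cot[OF gsection_fpart[OF gsection_courant[OF U(1) s(2) t(2)]] U(2)]])
    fix W Y assume W: "open W" "p \<in> W" "W \<subseteq> U" and Y: "vector_field A W Y"
    note sW = gsection_subset[OF s(1) W(3)] gsection_subset[OF s(2) W(3)]
      and tW = gsection_subset[OF t(1) W(3)] gsection_subset[OF t(2) W(3)]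
    note F = gsection_fpart[OF sW(1)] gsection_fpart[OF tW(1)]
      and V = gsection_vpart[OF sW(1)] gsection_vpart[OF tW(1)]
    have eqp: "s p = s' p" "t p = t' p" using eq U by auto
    have germ: "v (\<lambda>q. snd (x q) (Z q)) = v (\<lambda>q. snd (x' q) (Z' q))"
      if "v \<in> tangent A p" "one_form A W (fpart x)" "vector_field A W Z"
        "\<And>q. q \<in> W \<Longrightarrow> x q = x' q" "\<And>q. q \<in> W \<Longrightarrow> Z q = Z' q" for v x x' Z Z'
      by (rule tangent_germ[OF that(1) W(1,2) form_smooth[OF that(2) W(1) order_refl that(3)]])
        (simp add: that(4,5))
    have eqW: "s q = s' q" "t q = t' q" if "q \<in> W" for q using eq that W by auto
    have 1: "vpart s p (\<lambda>q. snd (t q) (Y q)) = vpart s' p (\<lambda>q. snd (t' q) (Y q))"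
      using germ[OF vf_tangent[OF V(1) W(2)] F(2) Y eqW(2) refl] eqp by simp
    have 2: "vpart t p (\<lambda>q. snd (s q) (Y q)) = vpart t' p (\<lambda>q. snd (s' q) (Y q))"
      using germ[OF vf_tangent[OF V(2) W(2)] F(1) Y eqW(1) refl] eqp by simp
    have 3: "Y p (\<lambda>q. snd (s q) (fst (t q))) = Y p (\<lambda>q. snd (s' q) (fst (t' q)))"
      by (rule germ[OF vf_tangent[OF Y W(2)] F(1) V(2) eqW(1)]) (simp_all add: eqW)
    have 4: "vf_bracket A (vpart s) Y p = vf_bracket A (vpart s') Y p"
      by (rule vf_bracket_cong[OF W(1,2) V(1) Y]) (simp_all add: eqW)
    have 5: "vf_bracket A (vpart t) Y p = vf_bracket A (vpart t') Y p"
      by (rule vf_bracket_cong[OF W(1,2) V(2) Y]) (simp_all add: eqW)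
    show "snd (courant_bracket A s t p) (Y p) = snd (courant_bracket A s' t' p) (Y p)"
      unfolding courant_fpart_apply[OF W(1,2) sW(1) tW(1) isotropic_on_subset[OF iso W(3)] Y]
        courant_fpart_apply[OF W(1,2) sW(2) tW(2) isotropic_on_subset[OF iso' W(3)] Y]
      unfolding 1 2 3 4 5 unfolding eqp ..
  qed
qed

text \<open>The evaluation formula applied twice, with all derivations of sums and all brackets acting on
  functions multiplied out. The terms that differentiate \<open>\<eta> X\<close> by \<open>V\<close> and then \<open>Y\<close> in either
  order have been combined.\<close>

lemma courant_nested_apply:
  assumes U: "open U" "p \<in> U" and s: "gsection A U s" and t: "gsection A U t" and u: "gsection A U u"
    and Y: "vector_field A U Y"
    and iso: "isotropic_on U t u" "isotropic_on U s (courant_bracket A t u)"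
  shows "snd (courant_bracket A s (courant_bracket A t u) p) (Y p) =
    vpart s p (\<lambda>q. vpart t q (\<lambda>r. fpart u r (Y r))) - vpart s p (\<lambda>q. fpart u q (vf_bracket A (vpart t) Y q))
    - vpart s p (\<lambda>q. vpart u q (\<lambda>r. fpart t r (Y r))) + vpart s p (\<lambda>q. fpart t q (vf_bracket A (vpart u) Y q))
    - vpart t p (\<lambda>q. fpart u q (vf_bracket A (vpart s) Y q))
    + fpart u p (vf_bracket A (vpart t) (vf_bracket A (vpart s) Y) p)
    + vpart u p (\<lambda>q. fpart t q (vf_bracket A (vpart s) Y q))
    - fpart t p (vf_bracket A (vpart u) (vf_bracket A (vpart s) Y) p)
    + Y p (\<lambda>q. vpart s q (\<lambda>r. fpart t r (vpart u r)))
    - vpart t p (\<lambda>q. vpart u q (\<lambda>r. fpart s r (Y r))) + vpart u p (\<lambda>q. vpart t q (\<lambda>r. fpart s r (Y r)))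
    - fpart s p (vf_bracket A Y (vf_bracket A (vpart t) (vpart u)) p)
    + Y p (\<lambda>q. fpart s q (vf_bracket A (vpart t) (vpart u) q))"
proof -
  let ?V = "vpart s" and ?W = "vpart t" and ?X = "vpart u"
  let ?\<xi> = "fpart s" and ?\<eta> = "fpart t" and ?\<theta> = "fpart u"
  note V = gsection_vpart[OF s] gsection_vpart[OF t] gsection_vpart[OF u]
    and F = gsection_fpart[OF s] gsection_fpart[OF t] gsection_fpart[OF u]
  note Vp = vf_tangent[OF V(1) U(2)]
  note br = vf_bracket_vf[OF U(1)]
  note sm = form_smooth[OF _ U(1) order_refl] vf_smooth[OF _ U(1) order_refl]
  note VY = br[OF V(1) Y]
  have "?V p (\<lambda>q. snd (courant_bracket A t u q) (Y q)) =
      ?V p (\<lambda>q. ?W q (\<lambda>r. ?\<theta> r (Y r)) - ?\<theta> q (vf_bracket A ?W Y q)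
        - ?X q (\<lambda>r. ?\<eta> r (Y r)) + ?\<eta> q (vf_bracket A ?X Y q) + Y q (\<lambda>r. ?\<eta> r (?X r)))"
    by (rule tangent_germ[OF Vp U sm(1)[OF gsection_fpart[OF gsection_courant[OF U(1) t u]] Y]])
      (rule courant_fpart_apply[OF U(1) _ t u iso(1) Y])
  also have "\<dots> = ?V p (\<lambda>q. ?W q (\<lambda>r. ?\<theta> r (Y r))) - ?V p (\<lambda>q. ?\<theta> q (vf_bracket A ?W Y q))
      - ?V p (\<lambda>q. ?X q (\<lambda>r. ?\<eta> r (Y r))) + ?V p (\<lambda>q. ?\<eta> q (vf_bracket A ?X Y q))
      + ?V p (\<lambda>q. Y q (\<lambda>r. ?\<eta> r (?X r)))"
  proof -
    have s1: "smooth_fun A U (\<lambda>q. ?W q (\<lambda>r. ?\<theta> r (Y r)))" by (rule sm(2)[OF V(2) sm(1)[OF F(3) Y]])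
    have s2: "smooth_fun A U (\<lambda>q. ?\<theta> q (vf_bracket A ?W Y q))" by (rule sm(1)[OF F(3) br[OF V(2) Y]])
    have s3: "smooth_fun A U (\<lambda>q. ?X q (\<lambda>r. ?\<eta> r (Y r)))" by (rule sm(2)[OF V(3) sm(1)[OF F(2) Y]])
    have s4: "smooth_fun A U (\<lambda>q. ?\<eta> q (vf_bracket A ?X Y q))" by (rule sm(1)[OF F(2) br[OF V(3) Y]])
    have s5: "smooth_fun A U (\<lambda>q. Y q (\<lambda>r. ?\<eta> r (?X r)))" by (rule sm(2)[OF Y sm(1)[OF F(2) V(3)]])
    note at = smooth_atI[OF U]
    note d12 = smooth_fun_diff[OF U(1) s1 s2]
    note d123 = smooth_fun_diff[OF U(1) d12 s3]
    note d1234 = smooth_fun_add[OF U(1) d123 s4]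
    show ?thesis
      unfolding tangent_add_fun[OF Vp at[OF d1234] at[OF s5]] tangent_add_fun[OF Vp at[OF d123] at[OF s4]]
        tangent_diff_fun[OF Vp at[OF d12] at[OF s3]] tangent_diff_fun[OF Vp at[OF s1] at[OF s2]] ..
  qed
  finally have 1: "?V p (\<lambda>q. snd (courant_bracket A t u q) (Y q)) =
      ?V p (\<lambda>q. ?W q (\<lambda>r. ?\<theta> r (Y r))) - ?V p (\<lambda>q. ?\<theta> q (vf_bracket A ?W Y q))
      - ?V p (\<lambda>q. ?X q (\<lambda>r. ?\<eta> r (Y r))) + ?V p (\<lambda>q. ?\<eta> q (vf_bracket A ?X Y q))
      + ?V p (\<lambda>q. Y q (\<lambda>r. ?\<eta> r (?X r)))" .
  have \<eta>X: "smooth_at A p (\<lambda>r. ?\<eta> r (?X r))" by (rule smooth_atI[OF U sm(1)[OF F(2) V(3)]])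
  have \<xi>Y: "smooth_at A p (\<lambda>r. ?\<xi> r (Y r))" by (rule smooth_atI[OF U sm(1)[OF F(1) Y]])
  note 2 = courant_fpart_apply[OF U t u iso(1) VY]
  have 3: "?\<xi> p (vf_bracket A (vf_bracket A ?W ?X) Y p) = - ?\<xi> p (vf_bracket A Y (vf_bracket A ?W ?X) p)"
    unfolding vf_bracket_commute[of "vf_bracket A ?W ?X" Y]
    by (rule cot_uminus_vec[OF form_cot[OF F(1) U(2)] vf_bracket_tangent[OF U Y br[OF V(2,3)]]])
  have "snd (courant_bracket A s (courant_bracket A t u) p) (Y p) =
      ?V p (\<lambda>q. snd (courant_bracket A t u q) (Y q)) - snd (courant_bracket A t u p) (vf_bracket A ?V Y p)
      - vf_bracket A ?W ?X p (\<lambda>q. ?\<xi> q (Y q)) + ?\<xi> p (vf_bracket A (vf_bracket A ?W ?X) Y p)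
      + Y p (\<lambda>q. ?\<xi> q (vf_bracket A ?W ?X q))"
    using courant_fpart_apply[OF U s gsection_courant[OF U(1) t u] iso(2) Y] by (simp only: courant_vpart)
  then show ?thesis
    unfolding 1 2 3 vf_bracket_apply[OF \<eta>X] vf_bracket_apply[OF \<xi>Y] by (simp add: algebra_simps)
qed

lemma zero_from_zeros:
  "a = 0 \<Longrightarrow> b = 0 \<Longrightarrow> c = 0 \<Longrightarrow> d = 0 \<Longrightarrow> x = a + b + c + d \<Longrightarrow> x = 0" for x :: complex
  by simp

text \<open>In the cyclic sum of the form parts, most terms cancel in pairs. The double brackets of vector fields
  cancel by their Jacobi identity, paired with each of the three forms. What remains is the derivative along
  \<open>Y\<close> of a function \<open>R\<close>, and \<open>R\<close> is the pairing of \<open>s\<close> with \<open>[t, u]\<close>, which vanishes.\<close>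

lemma courant_jacobi:
  assumes U: "open U" "p \<in> U" and s: "gsection A U s" and t: "gsection A U t" and u: "gsection A U u"
    and iso: "isotropic_on U s t" "isotropic_on U t u" "isotropic_on U u s"
    and iso': "isotropic_on U s (courant_bracket A t u)" "isotropic_on U t (courant_bracket A u s)"
      "isotropic_on U u (courant_bracket A s t)"
  shows "courant_bracket A s (courant_bracket A t u) p + courant_bracket A t (courant_bracket A u s) p
    + courant_bracket A u (courant_bracket A s t) p = 0"
proof (rule prod_eqI)
  note cour = gsection_courant[OF U(1)]
  have "fst (courant_bracket A s (courant_bracket A t u) p) + fst (courant_bracket A t (courant_bracket A u s) p)
    + fst (courant_bracket A u (courant_bracket A s t) p) = 0"
    unfolding courant_vpart
    by (rule vf_bracket_jacobi[OF U gsection_vpart[OF s] gsection_vpart[OF t] gsection_vpart[OF u]])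
  then show "fst (courant_bracket A s (courant_bracket A t u) p + courant_bracket A t (courant_bracket A u s) p
    + courant_bracket A u (courant_bracket A s t) p) = fst (0 :: 'a gvec)" by simp
  have cot: "snd (courant_bracket A x (courant_bracket A y z) p) \<in> cotangent A p"
    if "gsection A U x" "gsection A U y" "gsection A U z" for x y z
    by (rule form_cot[OF gsection_fpart[OF cour[OF that(1) cour[OF that(2,3)]]] U(2)])
  show "snd (courant_bracket A s (courant_bracket A t u) p + courant_bracket A t (courant_bracket A u s) p
    + courant_bracket A u (courant_bracket A s t) p) = snd (0 :: 'a gvec)"
    unfolding snd_add snd_zero
  proof (rule cot_eqI[OF U _ cotangent_zero])
    show "snd (courant_bracket A s (courant_bracket A t u) p) + snd (courant_bracket A t (courant_bracket A u s) p)
      + snd (courant_bracket A u (courant_bracket A s t) p) \<in> cotangent A p"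
      by (intro cotangent_add cot s t u)
  next
    fix T Y assume T: "open T" "p \<in> T" "T \<subseteq> U" and Y: "vector_field A T Y"
    let ?V = "vpart s" and ?W = "vpart t" and ?X = "vpart u"
    let ?\<xi> = "fpart s" and ?\<eta> = "fpart t" and ?\<theta> = "fpart u"
    note sT = gsection_subset[OF s T(3)] and tT = gsection_subset[OF t T(3)] and uT = gsection_subset[OF u T(3)]
    note isoT = iso[THEN isotropic_on_subset[OF _ T(3)]] and isoT' = iso'[THEN isotropic_on_subset[OF _ T(3)]]
    note V = gsection_vpart[OF sT] gsection_vpart[OF tT] gsection_vpart[OF uT]
      and F = gsection_fpart[OF sT] gsection_fpart[OF tT] gsection_fpart[OF uT]
    note Yp = vf_tangent[OF Y T(2)] and br = vf_bracket_vf[OF T(1)]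
    note sm = form_smooth[OF _ T(1) order_refl] vf_smooth[OF _ T(1) order_refl]
    \<comment> \<open>the vector field Jacobi identity, paired with each of the three forms\<close>
    have jac: "\<alpha> (vf_bracket A Z (vf_bracket A Z' Y) p) - \<alpha> (vf_bracket A Z' (vf_bracket A Z Y) p)
        - \<alpha> (vf_bracket A Y (vf_bracket A Z' Z) p) = 0"
      if \<alpha>: "\<alpha> \<in> cotangent A p" and Z: "vector_field A T Z" "vector_field A T Z'" for \<alpha> Z Z'
    proof -
      have 1: "vf_bracket A Z' (vf_bracket A Y Z) p = - vf_bracket A Z' (vf_bracket A Z Y) p"
      proof -
        have "vf_bracket A Z' (\<lambda>q f. - 1 * vf_bracket A Z Y q f) p =
            (\<lambda>f. - 1 * vf_bracket A Z' (vf_bracket A Z Y) p f + Z' p (\<lambda>q. - 1) * vf_bracket A Z Y p f)"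
          by (rule vf_bracket_scale[OF T(1,2) Z(2) smooth_fun_const[OF T(1)] br[OF Z(1) Y]])
        moreover have "(\<lambda>q f. - 1 * vf_bracket A Z Y q f) = vf_bracket A Y Z"
          by (simp add: fun_eq_iff vf_bracket_commute[of Y Z])
        ultimately show ?thesis
          using tangent_const_fun[OF vf_tangent[OF Z(2) T(2)]] by (simp add: fun_eq_iff)
      qed
      have 2: "vf_bracket A Y (vf_bracket A Z Z') p = - vf_bracket A Y (vf_bracket A Z' Z) p"
      proof -
        have "vf_bracket A Y (\<lambda>q f. - 1 * vf_bracket A Z' Z q f) p =
            (\<lambda>f. - 1 * vf_bracket A Y (vf_bracket A Z' Z) p f + Y p (\<lambda>q. - 1) * vf_bracket A Z' Z p f)"
          by (rule vf_bracket_scale[OF T(1,2) Y smooth_fun_const[OF T(1)] br[OF Z(2,1)]])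
        moreover have "(\<lambda>q f. - 1 * vf_bracket A Z' Z q f) = vf_bracket A Z Z'"
          by (simp add: fun_eq_iff vf_bracket_commute[of Z Z'])
        ultimately show ?thesis
          using tangent_const_fun[OF Yp] by (simp add: fun_eq_iff)
      qed
      note tan = vf_bracket_tangent[OF T(1,2)]
      have "vf_bracket A Z (vf_bracket A Z' Y) p - vf_bracket A Z' (vf_bracket A Z Y) p
          - vf_bracket A Y (vf_bracket A Z' Z) p = 0"
        using vf_bracket_jacobi[OF T(1,2) Z Y] unfolding 1 2 by simp
      from arg_cong[OF this, of \<alpha>] show ?thesis
        by (simp add: cot_diff_vec[OF \<alpha>] cot_zero_vec[OF \<alpha>] tangent_diff
            tan[OF Z(1) br[OF Z(2) Y]] tan[OF Z(2) br[OF Z(1) Y]] tan[OF Y br[OF Z(2,1)]])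
    qed
    note \<xi>p = form_cot[OF F(1) T(2)] and \<eta>p = form_cot[OF F(2) T(2)] and \<theta>p = form_cot[OF F(3) T(2)]
    let ?R = "\<lambda>q. ?V q (\<lambda>r. ?\<eta> r (?X r)) + ?W q (\<lambda>r. ?\<theta> r (?V r)) + ?X q (\<lambda>r. ?\<xi> r (?W r))
        + ?\<xi> q (vf_bracket A ?W ?X q) + ?\<eta> q (vf_bracket A ?X ?V q) + ?\<theta> q (vf_bracket A ?V ?W q)"
    \<comment> \<open>isotropy of \<open>s\<close> and \<open>[t, u]\<close>, written out\<close>
    have R0: "?R q = 0" if q: "q \<in> T" for q
    proof -
      have "?\<xi> q (vf_bracket A ?W ?X q) + snd (courant_bracket A t u q) (?V q) = 0"
        using isoT'(1) q by (simp add: isotropic_on_def courant_vpart)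
      moreover have "snd (courant_bracket A t u q) (?V q) =
          ?W q (\<lambda>r. ?\<theta> r (?V r)) - ?\<theta> q (vf_bracket A ?W ?V q)
          - ?X q (\<lambda>r. ?\<eta> r (?V r)) + ?\<eta> q (vf_bracket A ?X ?V q) + ?V q (\<lambda>r. ?\<eta> r (?X r))"
        by (rule courant_fpart_apply[OF T(1) q tT uT isoT(2) V(1)])
      moreover have "?\<theta> q (vf_bracket A ?W ?V q) = - ?\<theta> q (vf_bracket A ?V ?W q)"
        unfolding vf_bracket_commute[of ?W ?V]
        by (rule cot_uminus_vec[OF form_cot[OF F(3) q] vf_bracket_tangent[OF T(1) q V(1,2)]])
      moreover have "?X q (\<lambda>r. ?\<eta> r (?V r)) = - ?X q (\<lambda>r. ?\<xi> r (?W r))"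
      proof -
        have sm1: "smooth_fun A T (\<lambda>r. ?\<xi> r (?W r))" by (rule sm(1)[OF F(1) V(2)])
        have "?X q (\<lambda>r. ?\<eta> r (?V r)) = ?X q (\<lambda>r. - ?\<xi> r (?W r))"
          by (rule tangent_germ[OF vf_tangent[OF V(3) q] T(1) q sm(1)[OF F(2) V(1)]])
            (use isoT(1) in \<open>simp add: isotropic_on_def add_eq_0_iff\<close>)
        also have "\<dots> = - ?X q (\<lambda>r. ?\<xi> r (?W r))"
          by (rule tangent_minus_fun[OF vf_tangent[OF V(3) q] smooth_atI[OF T(1) q sm1]])
        finally show ?thesis .
      qed
      ultimately show ?thesis by (simp add: algebra_simps)
    qed
    have s1: "smooth_fun A T (\<lambda>q. ?V q (\<lambda>r. ?\<eta> r (?X r)))" by (rule sm(2)[OF V(1) sm(1)[OF F(2) V(3)]])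
    have s2: "smooth_fun A T (\<lambda>q. ?W q (\<lambda>r. ?\<theta> r (?V r)))" by (rule sm(2)[OF V(2) sm(1)[OF F(3) V(1)]])
    have s3: "smooth_fun A T (\<lambda>q. ?X q (\<lambda>r. ?\<xi> r (?W r)))" by (rule sm(2)[OF V(3) sm(1)[OF F(1) V(2)]])
    have s4: "smooth_fun A T (\<lambda>q. ?\<xi> q (vf_bracket A ?W ?X q))" by (rule sm(1)[OF F(1) br[OF V(2) V(3)]])
    have s5: "smooth_fun A T (\<lambda>q. ?\<eta> q (vf_bracket A ?X ?V q))" by (rule sm(1)[OF F(2) br[OF V(3) V(1)]])
    have s6: "smooth_fun A T (\<lambda>q. ?\<theta> q (vf_bracket A ?V ?W q))" by (rule sm(1)[OF F(3) br[OF V(1) V(2)]])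
    note a12 = smooth_fun_add[OF T(1) s1 s2]
    note a123 = smooth_fun_add[OF T(1) a12 s3]
    note a1234 = smooth_fun_add[OF T(1) a123 s4]
    note a12345 = smooth_fun_add[OF T(1) a1234 s5]
    note a123456 = smooth_fun_add[OF T(1) a12345 s6]
    note at = smooth_atI[OF T(1,2)]
    have "Y p ?R = Y p (\<lambda>q. 0)" by (rule tangent_germ[OF Yp T(1,2) a123456 R0])
    then have R: "Y p (\<lambda>q. ?V q (\<lambda>r. ?\<eta> r (?X r))) + Y p (\<lambda>q. ?W q (\<lambda>r. ?\<theta> r (?V r)))
        + Y p (\<lambda>q. ?X q (\<lambda>r. ?\<xi> r (?W r))) + Y p (\<lambda>q. ?\<xi> q (vf_bracket A ?W ?X q))
        + Y p (\<lambda>q. ?\<eta> q (vf_bracket A ?X ?V q)) + Y p (\<lambda>q. ?\<theta> q (vf_bracket A ?V ?W q)) = 0"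
      unfolding tangent_add_fun[OF Yp at[OF a12345] at[OF s6]] tangent_add_fun[OF Yp at[OF a1234] at[OF s5]]
        tangent_add_fun[OF Yp at[OF a123] at[OF s4]] tangent_add_fun[OF Yp at[OF a12] at[OF s3]]
        tangent_add_fun[OF Yp at[OF s1] at[OF s2]] tangent_const_fun[OF Yp] .
    show "(snd (courant_bracket A s (courant_bracket A t u) p) + snd (courant_bracket A t (courant_bracket A u s) p)
      + snd (courant_bracket A u (courant_bracket A s t) p)) (Y p) = 0 (Y p)"
      unfolding plus_fun_apply zero_fun_apply
        courant_nested_apply[OF T(1,2) sT tT uT Y isoT(2) isoT'(1)]
        courant_nested_apply[OF T(1,2) tT uT sT Y isoT(3) isoT'(2)]
        courant_nested_apply[OF T(1,2) uT sT tT Y isoT(1) isoT'(3)]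
      by (rule zero_from_zeros[OF R jac[OF \<theta>p V(2,1)] jac[OF \<xi>p V(3,2)] jac[OF \<eta>p V(1,3)]])
        (simp add: algebra_simps)
  qed
qed

end

lemma gscale_simps [simp]: "fst (gscale c x) = (\<lambda>f. c * fst x f)" "snd (gscale c x) = (\<lambda>v. c * snd x v)"
  by (simp_all add: gscale_def)

lemma sum_gscale:
  "(\<Sum>i\<in>I. gscale (c i) (e i)) = ((\<lambda>f. \<Sum>i\<in>I. c i * fst (e i) f), (\<lambda>v. \<Sum>i\<in>I. c i * snd (e i) v))"
  by (induction I rule: infinite_finite_induct)
    (simp_all add: prod_eq_iff fun_eq_iff zero_prod_def zero_fun_def)

context complex_manifold
begin

section \<open>Lie algebroids from involutive isotropic subbundles\<close>

lemma gsection_cong: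
  assumes "\<And>p. p \<in> U \<Longrightarrow> s p = t p" "gsection A U s" shows "gsection A U t"
  unfolding gsection_def
proof
  show "vector_field A U (vpart t)"
    by (rule vf_cong[OF _ gsection_vpart[OF assms(2)]]) (simp add: assms(1))
  show "one_form A U (fpart t)"
    by (rule form_cong[OF _ gsection_fpart[OF assms(2)]]) (simp add: assms(1))
qed

lemma gsection_local:
  assumes "\<And>p. p \<in> U \<Longrightarrow> \<exists>W. open W \<and> p \<in> W \<and> gsection A W s"
  shows "gsection A U s"
  unfolding gsection_def
proof
  show "vector_field A U (vpart s)"
    by (rule vf_local) (use assms gsection_vpart in blast)
  show "one_form A U (fpart s)"
    by (rule form_local) (use assms gsection_fpart in blast)
qed

lemma gcomb_single: "gcomb {()} (\<lambda>_. f) (\<lambda>_. t) = (\<lambda>q. gscale (f q) (t q))"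
  by (simp add: gcomb_def gscale_def fun_eq_iff)

lemma gcomb_add: "gcomb UNIV (\<lambda>_ _. 1) (\<lambda>b. if b then u else t) = (\<lambda>q. t q + u q)"
  by (simp add: gcomb_def UNIV_bool fun_eq_iff prod_eq_iff)

lemma gsection_scale: "smooth_fun A U f \<Longrightarrow> gsection A U t \<Longrightarrow> gsection A U (\<lambda>q. gscale (f q) (t q))"
  using gsection_gcomb[of "{()}" U "\<lambda>_. f" "\<lambda>_. t"] by (simp add: gcomb_single)

lemma gsection_add: "open U \<Longrightarrow> gsection A U t \<Longrightarrow> gsection A U u \<Longrightarrow> gsection A U (\<lambda>q. t q + u q)"
  using gsection_gcomb[of "UNIV" U "\<lambda>_ _. 1" "\<lambda>b. if b then u else t"] by (simp add: gcomb_add)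

lemma courant_leibniz:
  assumes U: "open U" "p \<in> U" and s: "gsection A U s" and t: "gsection A U t" and f: "smooth_fun A U f"
    and iso: "isotropic_on U s t"
  shows "courant_bracket A s (\<lambda>q. gscale (f q) (t q)) p =
    gscale (f p) (courant_bracket A s t p) + gscale (fst (s p) f) (t p)"
  using courant_gcomb[OF U s, of "{()}" "\<lambda>_. f" "\<lambda>_. t"] f t iso
  by (simp add: gcomb_single prod_eq_iff fun_eq_iff)

lemma courant_add:
  assumes U: "open U" "p \<in> U" and s: "gsection A U s" and t: "gsection A U t" and u: "gsection A U u"
    and iso: "isotropic_on U s t" "isotropic_on U s u"
  shows "courant_bracket A s (\<lambda>q. t q + u q) p = courant_bracket A s t p + courant_bracket A s u p"
proof -
  have "courant_bracket A s (gcomb UNIV (\<lambda>_ _. 1) (\<lambda>b. if b then u else t)) p =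
    ((\<lambda>f. \<Sum>b\<in>UNIV. 1 * fst (courant_bracket A s (if b then u else t) p) f
        + fst (s p) (\<lambda>_. 1) * fst ((if b then u else t) p) f),
     (\<lambda>v. \<Sum>b\<in>UNIV. 1 * snd (courant_bracket A s (if b then u else t) p) v
        + fst (s p) (\<lambda>_. 1) * snd ((if b then u else t) p) v))"
    by (rule courant_gcomb[OF U s smooth_fun_const[OF U(1)]]) (use t u iso in \<open>simp_all split: if_splits\<close>)
  then show ?thesis
    unfolding gcomb_add unfolding UNIV_bool
    by (simp add: prod_eq_iff fun_eq_iff tangent_const_fun[OF vf_tangent[OF gsection_vpart[OF s] U(2)]])
qed

lemma courant_algebroid_simps [simp]:
  "fibre (courant_algebroid_of A L) = L" "scal (courant_algebroid_of A L) = gscale"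
  "smooth_sec (courant_algebroid_of A L) U s = (gsection A U s \<and> (\<forall>p\<in>U. s p \<in> L p))"
  "anchor (courant_algebroid_of A L) p x = fst x" "brack (courant_algebroid_of A L) = courant_bracket A"
  by (simp_all add: courant_algebroid_of_def)

lemma courant_lie_algebroid:
  assumes cvb: "complex_vector_bundle A (courant_algebroid_of A L)"
    and sub: "\<And>p x. x \<in> L p \<Longrightarrow> x \<in> gfibre A p"
    and isotropic: "\<And>p x y. x \<in> L p \<Longrightarrow> y \<in> L p \<Longrightarrow> snd x (fst y) + snd y (fst x) = 0"
    and involutive: "\<And>s t p. gsection A UNIV s \<Longrightarrow> gsection A UNIV t \<Longrightarrow> (\<And>q. s q \<in> L q) \<Longrightarrow>
      (\<And>q. t q \<in> L q) \<Longrightarrow> courant_bracket A s t p \<in> L p"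
  shows "complex_lie_algebroid A (courant_algebroid_of A L)"
  unfolding complex_lie_algebroid_def courant_algebroid_simps
proof (intro conjI ballI allI impI cvb; (elim conjE)?)
  fix p x y c assume x: "x \<in> L p"
  show "fst x \<in> tangent A p" using sub[OF x] by (auto simp: gfibre_def)
  show "fst (gscale c x) = (\<lambda>f. c * fst x f)" by simp
  show "fst (x + y) = fst x + fst y" by simp
next
  fix U s assume "gsection A U s"
  then show "vector_field A U (vpart s)" by (rule gsection_vpart)
next
  fix s t assume "s \<in> {s. gsection A UNIV s \<and> (\<forall>p\<in>UNIV. s p \<in> L p)}"
    "t \<in> {s. gsection A UNIV s \<and> (\<forall>p\<in>UNIV. s p \<in> L p)}"
  then have s: "gsection A UNIV s" "\<And>q. s q \<in> L q" and t: "gsection A UNIV t" "\<And>q. t q \<in> L q" by auto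
  have iso: "isotropic_on UNIV x y" if "\<And>q. x q \<in> L q" "\<And>q. y q \<in> L q" for x y
    by (simp add: isotropic_on_def isotropic[OF that])
  show "courant_bracket A s t \<in> {s. gsection A UNIV s \<and> (\<forall>p\<in>UNIV. s p \<in> L p)}"
    using gsection_courant[OF open_UNIV s(1) t(1)] involutive[OF s(1) t(1) s(2) t(2)] by simp
  show "courant_bracket A t s = - courant_bracket A s t"
    using courant_commute[OF open_UNIV UNIV_I s(1) t(1)] by (simp add: fun_eq_iff)
  have leib: "courant_bracket A s (\<lambda>p. gscale (f p) (t p)) =
      (\<lambda>p. gscale (f p) (courant_bracket A s t p) + gscale (fst (s p) f) (t p))" if "smooth_fun A UNIV f" for f
    by (rule ext) (rule courant_leibniz[OF open_UNIV UNIV_I s(1) t(1) that iso[OF s(2) t(2)]])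
  then show "courant_bracket A s (\<lambda>p. gscale (f p) (t p)) =
      (\<lambda>p. gscale (f p) (courant_bracket A s t p) + gscale (fst (s p) f) (t p))" if "smooth_fun A UNIV f" for f
    using that .
  show "courant_bracket A s (\<lambda>p. gscale c (t p)) = (\<lambda>p. gscale c (courant_bracket A s t p))" for c
  proof -
    have "gscale (fst (s p) (\<lambda>q. c)) (t p) = 0" for p
      using tangent_const_fun[OF vf_tangent[OF gsection_vpart[OF s(1)] UNIV_I]]
      by (simp add: prod_eq_iff fun_eq_iff)
    then show ?thesis using leib[OF smooth_fun_const[OF open_UNIV, of c]] by simp
  qed
  show "fst (courant_bracket A s t p) = vf_bracket A (vpart s) (vpart t) p" for p by (rule courant_vpart)
  fix u assume "u \<in> {s. gsection A UNIV s \<and> (\<forall>p\<in>UNIV. s p \<in> L p)}"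
  then have u: "gsection A UNIV u" "\<And>q. u q \<in> L q" by auto
  show "courant_bracket A s (t + u) = courant_bracket A s t + courant_bracket A s u"
    using courant_add[OF open_UNIV UNIV_I s(1) t(1) u(1) iso[OF s(2) t(2)] iso[OF s(2) u(2)]]
    by (simp add: fun_eq_iff plus_fun_def[of t u])
  note inv = involutive[OF s(1) t(1) s(2) t(2)] involutive[OF t(1) u(1) t(2) u(2)]
    involutive[OF u(1) s(1) u(2) s(2)]
  show "courant_bracket A s (courant_bracket A t u) + courant_bracket A t (courant_bracket A u s) +
      courant_bracket A u (courant_bracket A s t) = 0"
    using courant_jacobi[OF open_UNIV UNIV_I s(1) t(1) u(1) iso[OF s(2) t(2)] iso[OF t(2) u(2)]
        iso[OF u(2) s(2)] iso[OF s(2) inv(2)] iso[OF t(2) inv(3)] iso[OF u(2) inv(1)]]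
    by (simp add: fun_eq_iff)
qed

lemma cvb_fibre:
  assumes "complex_vector_bundle A E" "x \<in> fibre E p"
  shows "scal E c x \<in> fibre E p" "scal E 1 x = x" "scal E (c + d) x = scal E c x + scal E d x"
    "y \<in> fibre E p \<Longrightarrow> x + y \<in> fibre E p"
proof -
  note ax = assms(1)[unfolded complex_vector_bundle_def, THEN conjunct1, THEN spec, THEN conjunct2,
      THEN bspec, OF assms(2), THEN spec, THEN spec]
  show "scal E c x \<in> fibre E p" "scal E 1 x = x"
    by (rule ax[THEN conjunct1], rule ax[THEN conjunct2, THEN conjunct1])
  show "scal E (c + d) x = scal E c x + scal E d x"
    by (rule ax[THEN conjunct2, THEN conjunct2, THEN conjunct1])
  show "y \<in> fibre E p \<Longrightarrow> x + y \<in> fibre E p"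
    by (rule ax[THEN conjunct2, THEN conjunct2, THEN conjunct2, THEN conjunct2, THEN bspec, THEN conjunct1])
qed

lemma cvb_section_fibre:
  assumes "complex_vector_bundle A E" "open U" "smooth_sec E U s" "p \<in> U"
  shows "s p \<in> fibre E p"
  using assms(1)[unfolded complex_vector_bundle_def, THEN conjunct2, THEN conjunct1, THEN spec, THEN spec,
      THEN mp, OF assms(2), THEN iffD1, OF assms(3), THEN bspec, OF assms(4)]
  by (rule conjunct1)

text \<open>The bundle axioms do not mention negatives, but negatives in the ambient group stay in the
  fibre.\<close>

lemma scal_minus_one:
  assumes "complex_vector_bundle A E" "x \<in> fibre E p"
  shows "scal E (- 1) x = - x" "scal E (- 1) x \<in> fibre E p"
proof -
  note ax = cvb_fibre[OF assms]
  have "scal E 0 x = 0" using ax(3)[of 0 0] by simp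
  then have "x + scal E (- 1) x = 0" using ax(3)[of 1 "-1"] ax(2) by simp
  then show "scal E (- 1) x = - x" by (simp add: add_eq_0_iff)
  show "scal E (- 1) x \<in> fibre E p" by (rule ax(1))
qed

text \<open>An equation between sections of \<open>E\<close> holds once the fibrewise injective \<open>\<Phi>\<close> maps it to an equation
  between sections of \<open>F\<close>. The premise on \<open>brack\<close> places the left-hand sides in the fibres of \<open>E\<close>, where
  injectivity is available.\<close>

lemma lie_algebroid_transport:
  fixes E :: "('a, 'e::ab_group_add) lie_algebroid" and F :: "('a, 'f::ab_group_add) lie_algebroid"
  assumes F: "complex_lie_algebroid A F" and cvb: "complex_vector_bundle A E"
    and iso: "lie_algebroid_iso E F \<Phi>"
    and brack: "\<And>s t p. s \<in> global_sections E \<Longrightarrow> t \<in> global_sections E \<Longrightarrow> brack E s t p \<in> fibre E p"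
    and add: "\<And>s t. s \<in> global_sections E \<Longrightarrow> t \<in> global_sections E \<Longrightarrow> s + t \<in> global_sections E"
    and scale: "\<And>f s. smooth_fun A UNIV f \<Longrightarrow> s \<in> global_sections E \<Longrightarrow>
      (\<lambda>p. scal E (f p) (s p)) \<in> global_sections E"
  shows "complex_lie_algebroid A E"
proof -
  note I = iso[unfolded lie_algebroid_iso_def]
  note I1 = I[THEN conjunct1, THEN spec]
  have bij: "bij_betw (\<Phi> p) (fibre E p) (fibre F p)" for p by (rule I1[THEN conjunct1])
  note I2 = I1[THEN conjunct2, THEN bspec]
  have lin: "x \<in> fibre E p \<Longrightarrow> \<Phi> p (scal E c x) = scal F c (\<Phi> p x)"
    "x \<in> fibre E p \<Longrightarrow> y \<in> fibre E p \<Longrightarrow> \<Phi> p (x + y) = \<Phi> p x + \<Phi> p y" for p x y c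
    by (rule I2[THEN conjunct1, THEN spec], assumption)
      (rule I2[THEN conjunct2, THEN conjunct1, THEN bspec], assumption, assumption)
  have anchor: "anchor E p x = anchor F p (\<Phi> p x)" if "x \<in> fibre E p" for p x
    by (rule I2[THEN conjunct2, THEN conjunct2, symmetric]) (rule that)
  have smooth: "smooth_sec F U (\<lambda>p. \<Phi> p (s p)) = smooth_sec E U s"
    if "open U" "\<And>p. p \<in> U \<Longrightarrow> s p \<in> fibre E p" for U s
    by (rule I[THEN conjunct2, THEN conjunct1, THEN spec, THEN spec, THEN mp]) (use that in blast)
  have br: "\<Phi> p (brack E s t p) = brack F (\<lambda>p. \<Phi> p (s p)) (\<lambda>p. \<Phi> p (t p)) p"
    if "s \<in> global_sections E" "t \<in> global_sections E" for s t p
    by (rule fun_cong[OF I[THEN conjunct2, THEN conjunct2, THEN bspec, THEN bspec, OF that]])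
  have inj: "x = y" if "x \<in> fibre E p" "y \<in> fibre E p" "\<Phi> p x = \<Phi> p y" for p x y
    using bij that by (auto simp: bij_betw_def inj_on_def)
  have into: "\<Phi> p x \<in> fibre F p" if "x \<in> fibre E p" for p x
    using bij that by (auto simp: bij_betw_def)
  have Eadd: "x + y \<in> fibre E p" if "x \<in> fibre E p" "y \<in> fibre E p" for x y p
    by (rule cvb_fibre(4)[OF cvb that])
  have Escal: "scal E c x \<in> fibre E p" if "x \<in> fibre E p" for x c p by (rule cvb_fibre(1)[OF cvb that])
  have fib: "s p \<in> fibre E p" if "open U" "smooth_sec E U s" "p \<in> U" for U s p
    by (rule cvb_section_fibre[OF cvb that])
  have glob: "s p \<in> fibre E p" if "s \<in> global_sections E" for s p
    using fib[OF open_UNIV] that by simp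
  have glob\<Phi>: "(\<lambda>p. \<Phi> p (s p)) \<in> global_sections F" if "s \<in> global_sections E" for s
    using smooth[OF open_UNIV, of s] glob[OF that] that by simp
  have \<Phi>_uminus: "\<Phi> p (- x) = - \<Phi> p x" and uminus_fib: "- x \<in> fibre E p" if "x \<in> fibre E p" for p x
  proof -
    have cvbF: "complex_vector_bundle A F" by (rule F[unfolded complex_lie_algebroid_def, THEN conjunct1])
    show "- x \<in> fibre E p" using scal_minus_one[OF cvb that] by simp
    show "\<Phi> p (- x) = - \<Phi> p x"
      using scal_minus_one(1)[OF cvb that] scal_minus_one(1)[OF cvbF into[OF that]] lin(1)[OF that, of "-1"]
      by simp
  qed
  note F' = F[unfolded complex_lie_algebroid_def, THEN conjunct2]
  note F1 = F'[THEN conjunct1, THEN spec, THEN bspec]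
    and F2 = F'[THEN conjunct2, THEN conjunct1, THEN spec, THEN spec, THEN mp, OF conjI]
    and F3 = F'[THEN conjunct2, THEN conjunct2, THEN bspec, THEN bspec]
  note Fax = F1[THEN conjunct1] F1[THEN conjunct2, THEN conjunct1, THEN spec]
    F1[THEN conjunct2, THEN conjunct2, THEN bspec] F2
  note Fbr = F3[THEN conjunct1] F3[THEN conjunct2, THEN conjunct1]
    F3[THEN conjunct2, THEN conjunct2, THEN conjunct1, THEN spec]
    F3[THEN conjunct2, THEN conjunct2, THEN conjunct2, THEN conjunct2, THEN conjunct2, THEN spec]
  note F4 = F3[THEN conjunct2, THEN conjunct2, THEN conjunct2, THEN conjunct1, THEN bspec]
  note Fbr2 = F4[THEN conjunct1] F4[THEN conjunct2]
  note Fleib = F3[THEN conjunct2, THEN conjunct2, THEN conjunct2, THEN conjunct2, THEN conjunct1,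
      THEN spec, THEN mp]
  have closed: "brack E s t \<in> global_sections E" if "s \<in> global_sections E" "t \<in> global_sections E" for s t
    using smooth[OF open_UNIV, of "brack E s t"] brack[OF that] Fbr(1)[OF glob\<Phi>[OF that(1)] glob\<Phi>[OF that(2)]]
      br[OF that] by simp
  show ?thesis
    unfolding complex_lie_algebroid_def
  proof (intro conjI ballI allI impI cvb; (elim conjE)?)
    fix p x y c assume x: "x \<in> fibre E p"
    show "anchor E p x \<in> tangent A p" using anchor[OF x] Fax(1)[OF into[OF x]] by simp
    show "anchor E p (scal E c x) = (\<lambda>f. c * anchor E p x f)"
      using anchor[OF x] anchor[OF Escal[OF x]] lin(1)[OF x] Fax(2)[OF into[OF x]] by simp
    assume y: "y \<in> fibre E p"
    show "anchor E p (x + y) = anchor E p x + anchor E p y"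
      using anchor[OF x] anchor[OF y] anchor[OF Eadd[OF x y]] lin(2)[OF x y] Fax(3)[OF into[OF x] into[OF y]]
      by simp
  next
    fix U s assume U: "open U" "smooth_sec E U s"
    have "smooth_sec F U (\<lambda>p. \<Phi> p (s p))" using smooth[OF U(1), of s] fib[OF U] U(2) by simp
    from Fax(4)[OF U(1) this] show "vector_field A U (\<lambda>p. anchor E p (s p))"
      by (rule vf_cong[rotated]) (simp add: anchor[OF fib[OF U]])
  next
    fix s t assume s: "s \<in> global_sections E" and t: "t \<in> global_sections E"
    show "brack E s t \<in> global_sections E" by (rule closed[OF s t])
    show "brack E t s = - brack E s t"
    proof
      fix p
      have "\<Phi> p (brack E t s p) = \<Phi> p (- brack E s t p)"
        unfolding \<Phi>_uminus[OF brack[OF s t]] br[OF s t] br[OF t s]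
          Fbr(2)[OF glob\<Phi>[OF s] glob\<Phi>[OF t]] by simp
      then show "brack E t s p = (- brack E s t) p"
        using inj[OF brack[OF t s] uminus_fib[OF brack[OF s t]]] by simp
    qed
    have leib: "brack E s (\<lambda>p. scal E (f p) (t p)) p =
        scal E (f p) (brack E s t p) + scal E (anchor E p (s p) f) (t p)" if f: "smooth_fun A UNIV f" for f p
    proof (rule inj[of _ p])
      show "brack E s (\<lambda>p. scal E (f p) (t p)) p \<in> fibre E p" by (rule brack[OF s scale[OF f t]])
      note b = brack[OF s t, of p] and g = glob[OF t, of p]
      show "scal E (f p) (brack E s t p) + scal E (anchor E p (s p) f) (t p) \<in> fibre E p"
        by (intro Eadd Escal b g)
      have "\<Phi> p (scal E (f p) (brack E s t p) + scal E (anchor E p (s p) f) (t p)) =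
          scal F (f p) (\<Phi> p (brack E s t p)) + scal F (anchor F p (\<Phi> p (s p)) f) (\<Phi> p (t p))"
        using lin(2)[OF Escal[OF b] Escal[OF g]] lin(1)[OF b] lin(1)[OF g] anchor[OF glob[OF s]] by simp
      moreover have "\<Phi> p (brack E s (\<lambda>p. scal E (f p) (t p)) p) =
          brack F (\<lambda>p. \<Phi> p (s p)) (\<lambda>p. scal F (f p) (\<Phi> p (t p))) p"
        using br[OF s scale[OF f t]] lin(1)[OF glob[OF t]] by simp
      ultimately show "\<Phi> p (brack E s (\<lambda>p. scal E (f p) (t p)) p) =
          \<Phi> p (scal E (f p) (brack E s t p) + scal E (anchor E p (s p) f) (t p))"
        by (simp add: Fleib[OF glob\<Phi>[OF s] glob\<Phi>[OF t] f] br[OF s t])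
    qed
    show "brack E s (\<lambda>p. scal E (f p) (t p)) =
        (\<lambda>p. scal E (f p) (brack E s t p) + scal E (anchor E p (s p) f) (t p))" if "smooth_fun A UNIV f" for f
      by (rule ext) (rule leib[OF that])
    show "brack E s (\<lambda>p. scal E c (t p)) = (\<lambda>p. scal E c (brack E s t p))" for c
    proof
      fix p
      have c: "(\<lambda>p. scal E c (t p)) \<in> global_sections E" by (rule scale[OF smooth_fun_const[OF open_UNIV] t])
      note b = brack[OF s t, of p]
      show "brack E s (\<lambda>p. scal E c (t p)) p = scal E c (brack E s t p)"
        by (rule inj[OF brack[OF s c] Escal[OF b]])
          (simp add: br[OF s c] br[OF s t] lin(1)[OF b] lin(1)[OF glob[OF t]]
            fun_cong[OF Fbr(3)[OF glob\<Phi>[OF s] glob\<Phi>[OF t]]])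
    qed
    show "anchor E p (brack E s t p) = vf_bracket A (\<lambda>q. anchor E q (s q)) (\<lambda>q. anchor E q (t q)) p" for p
      using anchor[OF brack[OF s t]] br[OF s t] Fbr(4)[OF glob\<Phi>[OF s] glob\<Phi>[OF t]]
        anchor[OF glob[OF s]] anchor[OF glob[OF t]] by simp
    fix u assume u: "u \<in> global_sections E"
    note gs = glob\<Phi>[OF s] and gt = glob\<Phi>[OF t] and gu = glob\<Phi>[OF u]
    show "brack E s (t + u) = brack E s t + brack E s u"
    proof
      fix p
      have \<Phi>tu: "(\<lambda>p. \<Phi> p ((t + u) p)) = (\<lambda>p. \<Phi> p (t p)) + (\<lambda>p. \<Phi> p (u p))"
        using lin(2)[OF glob[OF t] glob[OF u]] by (simp add: fun_eq_iff)
      have "\<Phi> p (brack E s (t + u) p) = \<Phi> p ((brack E s t + brack E s u) p)"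
        unfolding br[OF s add[OF t u]] unfolding \<Phi>tu Fbr2(1)[OF gs gt gu] unfolding plus_fun_apply
          lin(2)[OF brack[OF s t] brack[OF s u]] br[OF s t] br[OF s u] ..
      then show "brack E s (t + u) p = (brack E s t + brack E s u) p"
        by (intro inj[OF brack[OF s add[OF t u]]]) (simp_all add: Eadd[OF brack[OF s t] brack[OF s u]])
    qed
    show "brack E s (brack E t u) + brack E t (brack E u s) + brack E u (brack E s t) = 0"
    proof
      fix p
      have \<Phi>br: "(\<lambda>p. \<Phi> p (brack E x y p)) = brack F (\<lambda>p. \<Phi> p (x p)) (\<lambda>p. \<Phi> p (y p))"
        if "x \<in> global_sections E" "y \<in> global_sections E" for x y
        by (rule ext) (rule br[OF that])
      let ?b1 = "brack E s (brack E t u)" and ?b2 = "brack E t (brack E u s)" and ?b3 = "brack E u (brack E s t)"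
      have f1: "?b1 p \<in> fibre E p" by (rule brack[OF s closed[OF t u]])
      have f2: "?b2 p \<in> fibre E p" by (rule brack[OF t closed[OF u s]])
      have f3: "?b3 p \<in> fibre E p" by (rule brack[OF u closed[OF s t]])
      have "\<Phi> p (?b1 p + ?b2 p + ?b3 p) = 0"
        unfolding lin(2)[OF Eadd[OF f1 f2] f3] lin(2)[OF f1 f2] br[OF s closed[OF t u]]
          br[OF t closed[OF u s]] br[OF u closed[OF s t]] \<Phi>br[OF t u] \<Phi>br[OF u s] \<Phi>br[OF s t]
        using fun_cong[OF Fbr2(2)[OF gs gt gu], of p] by simp
      moreover have z: "0 \<in> fibre E p" using Eadd[OF f1 uminus_fib[OF f1]] by simp
      moreover have "\<Phi> p 0 = 0" using lin(2)[OF z z] by simp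
      ultimately have "?b1 p + ?b2 p + ?b3 p = 0"
        by (intro inj[OF Eadd[OF Eadd[OF f1 f2] f3] z]) simp
      then show "(?b1 + ?b2 + ?b3) p = 0 p" by simp
    qed
  qed
qed

section \<open>Graph bundles\<close>

text \<open>Bundle maps from 1-forms to (1,0)-vectors. The zero map and \<open>\<pi>\<^sup>\<sharp>\<close> are the two instances
  of interest; their graph bundles below are the matched pair \<open>T\<^sup>0\<^sup>,\<^sup>1 \<oplus> (T\<^sup>1\<^sup>,\<^sup>0)\<^sup>*\<close> and the
  Dirac structure, so that both vector bundles are obtained from one construction.\<close>

definition type10_map :: "('a \<Rightarrow> 'a covec \<Rightarrow> 'a tvec) \<Rightarrow> bool" where
  "type10_map h \<longleftrightarrow>
     (\<forall>p. \<forall>\<alpha>\<in>cotangent A p. h p \<alpha> \<in> T10 A p \<and> (\<forall>c. h p (\<lambda>v. c * \<alpha> v) = (\<lambda>f. c * h p \<alpha> f)) \<and>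
       (\<forall>\<beta>\<in>cotangent A p. h p (\<alpha> + \<beta>) = h p \<alpha> + h p \<beta>)) \<and>
     (\<forall>U \<alpha>. open U \<and> one_form A U \<alpha> \<longrightarrow> vector_field A U (\<lambda>p. h p (\<alpha> p)))"

definition graph_bundle :: "('a \<Rightarrow> 'a covec \<Rightarrow> 'a tvec) \<Rightarrow> 'a \<Rightarrow> 'a gvec set" where
  "graph_bundle h p = {x. snd x \<in> T10_dual A p \<and> fst x - h p (snd x) \<in> T01 A p}"

lemma type10_map_zero: "type10_map (\<lambda>p \<alpha>. 0)"
  by (simp add: type10_map_def T10_zero vf_zero) (simp add: zero_fun_def)

context
  fixes h :: "'a \<Rightarrow> 'a covec \<Rightarrow> 'a tvec"
  assumes h: "type10_map h"
begin

lemma h_T10: "\<alpha> \<in> cotangent A p \<Longrightarrow> h p \<alpha> \<in> T10 A p"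
  and h_scale: "\<alpha> \<in> cotangent A p \<Longrightarrow> h p (\<lambda>v. c * \<alpha> v) = (\<lambda>f. c * h p \<alpha> f)"
  and h_add: "\<alpha> \<in> cotangent A p \<Longrightarrow> \<beta> \<in> cotangent A p \<Longrightarrow> h p (\<alpha> + \<beta>) = h p \<alpha> + h p \<beta>"
  and h_vf: "open U \<Longrightarrow> one_form A U \<alpha>' \<Longrightarrow> vector_field A U (\<lambda>p. h p (\<alpha>' p))"
  using h by (simp_all add: type10_map_def)

lemma h_sum:
  assumes "\<And>i. i \<in> I \<Longrightarrow> \<alpha> i \<in> cotangent A p"
  shows "h p (\<lambda>v. \<Sum>i\<in>I. c i * \<alpha> i v) = (\<lambda>f. \<Sum>i\<in>I. c i * h p (\<alpha> i) f)"
  using assms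
proof (induction I rule: infinite_finite_induct)
  case (insert i I)
  have "h p (\<lambda>v. \<Sum>i\<in>insert i I. c i * \<alpha> i v) = h p ((\<lambda>v. c i * \<alpha> i v) + (\<lambda>v. \<Sum>i\<in>I. c i * \<alpha> i v))"
    using insert.hyps by (simp add: plus_fun_def)
  also have "\<dots> = h p (\<lambda>v. c i * \<alpha> i v) + h p (\<lambda>v. \<Sum>i\<in>I. c i * \<alpha> i v)"
    by (intro h_add cotangent_scale cot_sum) (use insert.prems in auto)
  finally show ?case using insert h_scale[of "\<alpha> i" p "c i"] by (simp add: fun_eq_iff)
qed (use h_scale[OF cotangent_zero, of p 0] in \<open>simp_all add: zero_fun_def\<close>)

lemma graph_bundle_gfibre: "x \<in> graph_bundle h p \<Longrightarrow> x \<in> gfibre A p"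
  using tangent_add[OF T01_tangent T10_tangent[OF h_T10[OF T10_dual_cot]], of "fst x - h p (snd x)" p "snd x"]
  by (simp add: graph_bundle_def gfibre_def mem_Times_iff T10_dual_cot)

lemma h_zero: "h p 0 = 0"
  using h_scale[OF cotangent_zero, of p 0] by (simp add: zero_fun_def)

lemma graph_bundle_zero: "0 \<in> graph_bundle h p"
  by (simp add: graph_bundle_def h_zero T10_dual_zero T01_zero)

lemma graph_bundle_add: "x \<in> graph_bundle h p \<Longrightarrow> y \<in> graph_bundle h p \<Longrightarrow> x + y \<in> graph_bundle h p"
  using T01_add[of "fst x - h p (snd x)" p "fst y - h p (snd y)"]
  by (simp add: graph_bundle_def T10_dual_add T10_dual_cot h_add algebra_simps)

lemma graph_bundle_scale: "x \<in> graph_bundle h p \<Longrightarrow> gscale c x \<in> graph_bundle h p"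
  using T01_scale[of "fst x - h p (snd x)" p c]
  by (simp add: graph_bundle_def T10_dual_scale T10_dual_cot h_scale fun_diff_def algebra_simps)

lemma graph_bundle_sum:
  "(\<And>i. i \<in> I \<Longrightarrow> x i \<in> graph_bundle h p) \<Longrightarrow> (\<Sum>i\<in>I. gscale (c i) (x i)) \<in> graph_bundle h p"
  by (induction I rule: infinite_finite_induct) (auto intro: graph_bundle_add graph_bundle_scale graph_bundle_zero)

lemma graph_bundle_uminus: "x \<in> graph_bundle h p \<Longrightarrow> - x \<in> graph_bundle h p"
  using graph_bundle_scale[of x p "-1"] by (simp add: gscale_def uminus_prod_def fun_Compl_def)

definition graph_frame :: "'a set \<Rightarrow> ('a \<Rightarrow> complex ^ 'n) \<Rightarrow> 'n + 'n \<Rightarrow> 'a \<Rightarrow> 'a gvec" where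
  "graph_frame V \<phi> i q = (case i of
      Inl k \<Rightarrow> (h q (differential A (coord \<phi> (Inl k)) q), differential A (coord \<phi> (Inl k)) q)
    | Inr k \<Rightarrow> (frame V \<phi> (Inr k) q, 0))"

lemma graph_frame_simps:
  "graph_frame V \<phi> (Inl k) q = (h q (differential A (coord \<phi> (Inl k)) q), differential A (coord \<phi> (Inl k)) q)"
  "graph_frame V \<phi> (Inr k) q = (frame V \<phi> (Inr k) q, 0)"
  by (simp_all add: graph_frame_def)

lemma graph_frame_gsection:
  assumes V: "(V, \<phi>) \<in> A" shows "gsection A V (graph_frame V \<phi> i)"
proof -
  note op = chart_open[OF V]
  have dz: "one_form A V (differential A (coord \<phi> j))" for j
    by (rule differential_form[OF op coord_smooth[OF V]])
  show ?thesis
    by (cases i) (simp_all add: gsection_def graph_frame_def h_vf[OF op dz] dz frame_vector_field[OF V] form_zero[OF op])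
qed

lemma graph_frame_in:
  assumes V: "(V, \<phi>) \<in> A" "q \<in> V" shows "graph_frame V \<phi> i q \<in> graph_bundle h q"
  by (cases i) (simp_all add: graph_frame_def graph_bundle_def dz_T10_dual[OF V] T01_zero T10_dual_zero
      frame_T01[OF V] h_zero)

end

text \<open>The coefficients of \<open>x\<close> with respect to \<open>graph_frame\<close>. They do not involve \<open>h\<close>, since \<open>h\<close> has values of type
  (1,0), on which the antiholomorphic coordinates vanish.\<close>

definition graph_coeff :: "'a set \<Rightarrow> ('a \<Rightarrow> complex ^ 'n) \<Rightarrow> 'n + 'n \<Rightarrow> 'a \<Rightarrow> 'a gvec \<Rightarrow> complex" where
  "graph_coeff V \<phi> i q x = (case i of
      Inl k \<Rightarrow> snd x (frame V \<phi> (Inl k) q) | Inr k \<Rightarrow> fst x (coord \<phi> (Inr k)))"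

lemma graph_coeff_sum:
  "graph_coeff V \<phi> j q (\<Sum>i\<in>I. gscale (c i) (e i)) = (\<Sum>i\<in>I. c i * graph_coeff V \<phi> j q (e i))"
  unfolding sum_gscale by (cases j) (simp_all add: graph_coeff_def)

lemma graph_coeff_smooth:
  assumes V: "(V, \<phi>) \<in> A" and U: "open U" "U \<subseteq> V" and s: "gsection A U s"
  shows "smooth_fun A U (\<lambda>q. graph_coeff V \<phi> i q (s q))"
proof (cases i)
  case (Inl k)
  show ?thesis unfolding graph_coeff_def Inl sum.case
    by (rule form_smooth[OF gsection_fpart[OF s] U(1) order_refl vf_subset[OF frame_vector_field[OF V] U(2)]])
next
  case (Inr k)
  show ?thesis unfolding graph_coeff_def Inr sum.case
    by (rule vf_smooth[OF gsection_vpart[OF s] U(1) order_refl smooth_fun_subset[OF coord_smooth[OF V] U(2)]])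
qed

context
  fixes h :: "'a \<Rightarrow> 'a covec \<Rightarrow> 'a tvec"
  assumes h: "type10_map h"
begin

lemma graph_coeff_frame:
  assumes V: "(V, \<phi>) \<in> A" "q \<in> V"
  shows "graph_coeff V \<phi> i q (graph_frame h V \<phi> j q) = (if i = j then 1 else 0)"
proof -
  have "h q (differential A (coord \<phi> (Inl k)) q) (coord \<phi> (Inr l)) = 0" for k l
    using h_T10[OF h differential_cot] T10_iff[OF V] by blast
  then show ?thesis
    by (cases i; cases j)
      (simp_all add: graph_coeff_def graph_frame_simps[OF h] frame_coord[OF V] frame_tangent[OF V])
qed

lemma graph_expand:
  assumes V: "(V, \<phi>) \<in> A" "q \<in> V" and x: "x \<in> graph_bundle h q"
  shows "x = (\<Sum>i\<in>UNIV. gscale (graph_coeff V \<phi> i q x) (graph_frame h V \<phi> i q))"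
proof -
  obtain v \<alpha> where x_eq: "x = (v, \<alpha>)" by (cases x)
  have \<alpha>: "\<alpha> \<in> T10_dual A q" and z: "v - h q \<alpha> \<in> T01 A q"
    using x by (simp_all add: x_eq graph_bundle_def)
  let ?z = "v - h q \<alpha>"
  let ?a = "\<lambda>k. \<alpha> (frame V \<phi> (Inl k) q)" and ?dz = "\<lambda>k. differential A (coord \<phi> (Inl k)) q"
  have \<alpha>_eq: "\<alpha> = (\<lambda>w. \<Sum>k\<in>UNIV. ?a k * ?dz k w)"
  proof -
    have "\<alpha> (frame V \<phi> (Inr k) q) = 0" for k using \<alpha> T10_dual_iff[OF V] by blast
    then show ?thesis
      by (intro trans[OF cot_expand_form[OF V T10_dual_cot[OF \<alpha>]]]) (simp add: sum_UNIV_Plus)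
  qed
  have hr: "h q \<alpha> (coord \<phi> (Inr k)) = 0" for k
    using h_T10[OF h T10_dual_cot[OF \<alpha>]] T10_iff[OF V] by blast
  have "?z (coord \<phi> (Inl k)) = 0" for k using z T01_iff[OF V] by blast
  then have z_eq: "?z = (\<lambda>f. \<Sum>k\<in>UNIV. v (coord \<phi> (Inr k)) * frame V \<phi> (Inr k) q f)"
    by (intro trans[OF tangent_expand[OF V T01_tangent[OF z]]]) (simp add: sum_UNIV_Plus hr)
  have h\<alpha>: "h q \<alpha> = (\<lambda>f. \<Sum>k\<in>UNIV. ?a k * h q (?dz k) f)"
    by (rule trans[OF arg_cong[OF \<alpha>_eq, of "h q"] h_sum[OF h differential_cot]])
  have v_eq: "v f = (\<Sum>k\<in>UNIV. ?a k * h q (?dz k) f) +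
      (\<Sum>k\<in>UNIV. v (coord \<phi> (Inr k)) * frame V \<phi> (Inr k) q f)" for f
    using fun_cong[OF h\<alpha>, of f] fun_cong[OF z_eq, of f] by (simp add: algebra_simps)
  show ?thesis
    unfolding sum_gscale sum_UNIV_Plus
  proof (rule prod_eqI)
    show "fst x = fst (\<lambda>f. (\<Sum>k\<in>UNIV. graph_coeff V \<phi> (Inl k) q x * fst (graph_frame h V \<phi> (Inl k) q) f) +
          (\<Sum>k\<in>UNIV. graph_coeff V \<phi> (Inr k) q x * fst (graph_frame h V \<phi> (Inr k) q) f),
        \<lambda>w. (\<Sum>k\<in>UNIV. graph_coeff V \<phi> (Inl k) q x * snd (graph_frame h V \<phi> (Inl k) q) w) +
          (\<Sum>k\<in>UNIV. graph_coeff V \<phi> (Inr k) q x * snd (graph_frame h V \<phi> (Inr k) q) w))"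
      unfolding x_eq fst_conv
      by (rule ext, rule trans[OF v_eq]) (simp add: graph_coeff_def graph_frame_simps[OF h])
    show "snd x = snd (\<lambda>f. (\<Sum>k\<in>UNIV. graph_coeff V \<phi> (Inl k) q x * fst (graph_frame h V \<phi> (Inl k) q) f) +
          (\<Sum>k\<in>UNIV. graph_coeff V \<phi> (Inr k) q x * fst (graph_frame h V \<phi> (Inr k) q) f),
        \<lambda>w. (\<Sum>k\<in>UNIV. graph_coeff V \<phi> (Inl k) q x * snd (graph_frame h V \<phi> (Inl k) q) w) +
          (\<Sum>k\<in>UNIV. graph_coeff V \<phi> (Inr k) q x * snd (graph_frame h V \<phi> (Inr k) q) w))"
      unfolding x_eq snd_conv
      by (rule ext, rule trans[OF fun_cong[OF \<alpha>_eq]]) (simp add: graph_coeff_def graph_frame_simps[OF h])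
  qed
qed

text \<open>The frame indexed by two copies of the coordinate indices is renumbered by an initial segment of the
  natural numbers; the coefficient functions give existence, uniqueness and smoothness of the
  coefficients at once.\<close>

lemma graph_bundle_cvb:
  assumes E: "fibre E = graph_bundle h" "scal E = gscale"
    "\<And>U s. smooth_sec E U s \<longleftrightarrow> gsection A U s \<and> (\<forall>p\<in>U. s p \<in> graph_bundle h p)"
  shows "complex_vector_bundle A E"
  unfolding complex_vector_bundle_def E
proof (intro conjI allI impI ballI)
  fix p :: 'a and x y :: "'a gvec" and c d :: complex
  show "0 \<in> graph_bundle h p" by (rule graph_bundle_zero[OF h])
  assume x: "x \<in> graph_bundle h p"
  show "gscale c x \<in> graph_bundle h p" by (rule graph_bundle_scale[OF h x])
  show "gscale 1 x = x" "gscale (c + d) x = gscale c x + gscale d x" "gscale (c * d) x = gscale c (gscale d x)"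
    "gscale c (x + y) = gscale c x + gscale c y"
    by (simp_all add: prod_eq_iff fun_eq_iff algebra_simps)
  assume "y \<in> graph_bundle h p"
  with x show "x + y \<in> graph_bundle h p" by (rule graph_bundle_add[OF h])
next
  fix U :: "'a set" and s assume U: "open U"
  show "(gsection A U s \<and> (\<forall>p\<in>U. s p \<in> graph_bundle h p)) =
      (\<forall>p\<in>U. s p \<in> graph_bundle h p \<and> (\<exists>V. open V \<and> p \<in> V \<and> V \<subseteq> U \<and> gsection A V s \<and> (\<forall>p\<in>V. s p \<in> graph_bundle h p)))"
    (is "?L = ?R")
  proof
    assume ?L then show ?R using U by blast
  next
    assume R: ?R
    have "gsection A U s" by (rule gsection_local) (use R in blast)
    with R show ?L by blast
  qed
next
  fix p :: 'a
  obtain V \<phi> where V: "(V, \<phi>) \<in> A" "p \<in> V" by (rule chart_exists)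
  define r where "r = card (UNIV :: ('n + 'n) set)"
  obtain b :: "nat \<Rightarrow> 'n + 'n" where b: "bij_betw b {..<r} UNIV"
    unfolding r_def using ex_bij_betw_nat_finite[of "UNIV :: ('n + 'n) set"] by (auto simp: atLeast0LessThan)
  let ?e = "\<lambda>i. graph_frame h V \<phi> (b i)"
  have reindex: "(\<Sum>i<r. g (b i)) = (\<Sum>j\<in>UNIV. g j)" for g :: "'n + 'n \<Rightarrow> 'a gvec"
    by (rule sum.reindex_bij_betw[OF b])
  have coeff: "c i = graph_coeff V \<phi> (b i) q (\<Sum>i<r. gscale (c i) (?e i q))" if "i < r" "q \<in> V" for c i q
  proof -
    have inj: "b i = b j \<longleftrightarrow> i = j" if "j < r" for j
      using b \<open>i < r\<close> that by (auto simp: bij_betw_def inj_on_def)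
    have "graph_coeff V \<phi> (b i) q (\<Sum>i<r. gscale (c i) (?e i q)) = (\<Sum>j<r. c j * (if b i = b j then 1 else 0))"
      unfolding graph_coeff_sum graph_coeff_frame[OF V(1) that(2)] ..
    also have "\<dots> = (\<Sum>j<r. if j = i then c j else 0)"
      by (rule sum.cong[OF refl]) (use inj in auto)
    finally show ?thesis using that by simp
  qed
  have expand: "x = (\<Sum>i<r. gscale (graph_coeff V \<phi> (b i) q x) (?e i q))" if "q \<in> V" "x \<in> graph_bundle h q" for q x
    by (rule trans[OF graph_expand[OF V(1) that] reindex[symmetric]])
  have "\<exists>!c. (\<forall>i\<ge>r. c i = 0) \<and> x = (\<Sum>i<r. gscale (c i) (?e i q))" if q: "q \<in> V" "x \<in> graph_bundle h q" for q x
  proof (rule ex1I)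
    let ?c = "\<lambda>i. if i < r then graph_coeff V \<phi> (b i) q x else 0"
    show "(\<forall>i\<ge>r. ?c i = 0) \<and> x = (\<Sum>i<r. gscale (?c i) (?e i q))" using expand[OF q] by simp
    fix c assume c: "(\<forall>i\<ge>r. c i = 0) \<and> x = (\<Sum>i<r. gscale (c i) (?e i q))"
    show "c = ?c"
    proof
      fix i show "c i = ?c i" using c coeff[OF _ q(1), of i c] by (cases "i < r") auto
    qed
  qed
  moreover have "(gsection A W s \<and> (\<forall>p\<in>W. s p \<in> graph_bundle h p)) \<longleftrightarrow>
      (\<exists>c. (\<forall>i<r. smooth_fun A W (c i)) \<and> (\<forall>q\<in>W. s q = (\<Sum>i<r. gscale (c i q) (?e i q))))"
    if W: "open W" "W \<subseteq> V" for W s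
  proof
    assume s: "gsection A W s \<and> (\<forall>p\<in>W. s p \<in> graph_bundle h p)"
    show "\<exists>c. (\<forall>i<r. smooth_fun A W (c i)) \<and> (\<forall>q\<in>W. s q = (\<Sum>i<r. gscale (c i q) (?e i q)))"
      by (intro exI[of _ "\<lambda>i q. graph_coeff V \<phi> (b i) q (s q)"] conjI allI impI ballI
          graph_coeff_smooth[OF V(1) W] expand) (use s W in auto)
  next
    assume "\<exists>c. (\<forall>i<r. smooth_fun A W (c i)) \<and> (\<forall>q\<in>W. s q = (\<Sum>i<r. gscale (c i q) (?e i q)))"
    then obtain c where c: "\<And>i. i < r \<Longrightarrow> smooth_fun A W (c i)"
      "\<And>q. q \<in> W \<Longrightarrow> s q = (\<Sum>i<r. gscale (c i q) (?e i q))" by blast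
    have "gsection A W (gcomb {..<r} c ?e)"
      by (rule gsection_gcomb) (use c gsection_subset[OF graph_frame_gsection[OF h V(1)] W(2)] in auto)
    then have "gsection A W s"
      by (rule gsection_cong[rotated]) (simp add: c(2) sum_gscale gcomb_def)
    moreover have "s q \<in> graph_bundle h q" if "q \<in> W" for q
      unfolding c(2)[OF that] by (intro graph_bundle_sum[OF h] graph_frame_in[OF h V(1)]) (use that W in auto)
    ultimately show "gsection A W s \<and> (\<forall>p\<in>W. s p \<in> graph_bundle h p)" by blast
  qed
  ultimately show "\<exists>U (r::nat) e. open U \<and> p \<in> U \<and>
        (\<forall>q\<in>U. (\<forall>i<r. e i q \<in> graph_bundle h q) \<and>
           (\<forall>x\<in>graph_bundle h q. \<exists>!c. (\<forall>i\<ge>r. c i = 0) \<and> x = (\<Sum>i<r. gscale (c i) (e i q)))) \<and>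
        (\<forall>V s. open V \<and> V \<subseteq> U \<longrightarrow> (gsection A V s \<and> (\<forall>p\<in>V. s p \<in> graph_bundle h p)) =
           (\<exists>c. (\<forall>i<r. smooth_fun A V (c i)) \<and>
                (\<forall>q\<in>V. s q = (\<Sum>i<r. gscale (c i q) (e i q)))))"
    using chart_open[OF V(1)] V(2) graph_frame_in[OF h V(1)]
    by (intro exI[of _ V] exI[of _ r] exI[of _ ?e]) auto
qed

end

text \<open>For exact forms, the Lie derivative along \<open>Z\<close> of \<open>dg\<close> is \<open>d (Z g)\<close>, and the other two terms \<open>- d (W f)\<close> and
  \<open>d (df W)\<close> cancel.\<close>

lemma courant_exact:
  assumes U: "open U" "p \<in> U" and Z: "vector_field A U Z" and W: "vector_field A U W"
    and f: "smooth_fun A U f" and g: "smooth_fun A U g"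
    and iso: "isotropic_on U (\<lambda>q. (Z q, differential A f q)) (\<lambda>q. (W q, differential A g q))"
  shows "snd (courant_bracket A (\<lambda>q. (Z q, differential A f q)) (\<lambda>q. (W q, differential A g q)) p) =
    differential A (\<lambda>q. Z q g) p"
proof (rule cot_eqI[OF U _ differential_cot])
  let ?s = "\<lambda>q. (Z q, differential A f q)" and ?t = "\<lambda>q. (W q, differential A g q)"
  have s: "gsection A U ?s" and t: "gsection A U ?t"
    by (simp_all add: gsection_def Z W differential_form[OF U(1) f] differential_form[OF U(1) g])
  show "snd (courant_bracket A ?s ?t p) \<in> cotangent A p"
    by (rule form_cot[OF gsection_fpart[OF gsection_courant[OF U(1) s t]] U(2)])
  fix T Y assume T: "open T" "p \<in> T" "T \<subseteq> U" and Y: "vector_field A T Y"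
  note ZT = vf_subset[OF Z T(3)] and WT = vf_subset[OF W T(3)]
  note fT = smooth_fun_subset[OF f T(3)] and gT = smooth_fun_subset[OF g T(3)]
  note sm = smooth_atI[OF T(1,2)]
  have germ: "v (\<lambda>q. differential A k q (X q)) = v (\<lambda>q. X q k)"
    if "v \<in> tangent A p" "vector_field A T X" "smooth_fun A T k" for v X k
    by (rule tangent_germ[OF that(1) T(1,2)
          form_smooth[OF differential_form[OF T(1) that(3)] T(1) order_refl that(2)]])
      (simp add: vf_tangent[OF that(2)])
  \<comment> \<open>the Lie derivative of an exact form, evaluated on \<open>Y\<close>\<close>
  have swap: "v p (\<lambda>q. differential A k q (Y q)) - differential A k p (vf_bracket A v Y p) = Y p (\<lambda>q. v q k)"
    if v: "vector_field A T v" and k: "smooth_fun A T k" for v k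
    using germ[OF vf_tangent[OF v T(2)] Y k]
    by (simp add: vf_bracket_tangent[OF T(1,2) v Y] vf_bracket_apply[OF sm[OF k]])
  have "snd (courant_bracket A ?s ?t p) (Y p) =
      Z p (\<lambda>q. differential A g q (Y q)) - differential A g p (vf_bracket A Z Y p)
      - (W p (\<lambda>q. differential A f q (Y q)) - differential A f p (vf_bracket A W Y p))
      + Y p (\<lambda>q. differential A f q (W q))"
    using courant_fpart_apply[OF T(1,2) gsection_subset[OF s T(3)] gsection_subset[OF t T(3)]
        isotropic_on_subset[OF iso T(3)] Y] by simp
  also have "\<dots> = Y p (\<lambda>q. Z q g)"
    unfolding swap[OF ZT gT] swap[OF WT fT] germ[OF vf_tangent[OF Y T(2)] WT fT] by simp
  finally show "snd (courant_bracket A ?s ?t p) (Y p) = differential A (\<lambda>q. Z q g) p (Y p)"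
    by (simp add: vf_tangent[OF Y T(2)])
qed

lemma differential_const_germ:
  assumes "open U" "p \<in> U" "\<And>q. q \<in> U \<Longrightarrow> f q = c"
  shows "differential A f p = 0"
proof
  fix v
  have "v f = 0" if v: "v \<in> tangent A p"
    using tangent_germ[OF v assms(1,2) smooth_fun_const[OF assms(1), of c], of f] assms(3)
      tangent_const_fun[OF v, of c] by simp
  then show "differential A f p v = 0 v" by (simp add: differential_def)
qed

lemma differential_zero: "differential A (\<lambda>q. 0) p = 0"
  by (rule differential_const_germ[OF open_UNIV]) auto

end

context holomorphic_poisson_manifold
begin

section \<open>The Dirac structure of a holomorphic Poisson structure\<close>

lemma type10_sharp: "type10_map (sharp A \<pi>)"
  unfolding type10_map_def
  by (simp add: pi_sharp_T10 sharp_scale[OF pi_bivector] sharp_add[OF pi_bivector] pi_sharp_vf)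

abbreviation L where "L \<equiv> graph_bundle (sharp A \<pi>)"

lemmas L_gfibre = graph_bundle_gfibre[OF type10_sharp]
  and L_add = graph_bundle_add[OF type10_sharp]
  and L_uminus = graph_bundle_uminus[OF type10_sharp]
  and L_sum = graph_bundle_sum[OF type10_sharp]

text \<open>Forms of type (1,0) do not see the (0,1)-part of \<open>x\<close>.\<close>

lemma L_pairing:
  assumes x: "x \<in> L p" and \<alpha>: "\<alpha> \<in> T10_dual A p" shows "\<alpha> (fst x) = \<pi> p (snd x) \<alpha>"
proof -
  have x': "snd x \<in> cotangent A p" "fst x - sharp A \<pi> p (snd x) \<in> T01 A p"
    using x by (auto simp: graph_bundle_def T10_dual_cot)
  note \<alpha>' = T10_dual_cot[OF \<alpha>]
  have "\<alpha> (fst x) = \<alpha> ((fst x - sharp A \<pi> p (snd x)) + sharp A \<pi> p (snd x))" by simp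
  also have "\<dots> = \<alpha> (fst x - sharp A \<pi> p (snd x)) + \<alpha> (sharp A \<pi> p (snd x))"
    by (intro cot_add[OF \<alpha>'] T01_tangent[OF x'(2)] pi_sharp_tangent x'(1))
  finally show ?thesis by (simp add: T10_dual_T01[OF \<alpha> x'(2)] pi_sharp_pairing[OF x'(1) \<alpha>'])
qed

lemma L_isotropic:
  assumes "x \<in> L p" "y \<in> L p" shows "snd x (fst y) + snd y (fst x) = 0"
proof -
  have d: "snd x \<in> T10_dual A p" "snd y \<in> T10_dual A p" using assms by (auto simp: graph_bundle_def)
  show ?thesis
    using L_pairing[OF assms(1) d(2)] L_pairing[OF assms(2) d(1)]
      pi_commute[OF T10_dual_cot[OF d(1)] T10_dual_cot[OF d(2)]] by simp
qed

text \<open>Orthogonality to all \<open>(Z, 0)\<close> forces the form part to have type (1,0). Orthogonality to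
  \<open>(\<pi>\<^sup>\<sharp>dz\<^sub>k, dz\<^sub>k)\<close> then says that the vector part and \<open>\<pi>\<^sup>\<sharp>\<close> of the form part agree on
  \<open>z\<^sub>k\<close>, hence differ by a vector of type (0,1).\<close>

lemma L_maximal: "L p = {x \<in> gfibre A p. \<forall>y\<in>L p. gpairing x y = 0}"
proof (intro equalityI subsetI CollectI conjI ballI)
  fix x y assume "x \<in> L p" "y \<in> L p"
  then show "gpairing x y = 0" using L_isotropic by (simp add: gpairing_def)
next
  fix x assume "x \<in> {x \<in> gfibre A p. \<forall>y\<in>L p. gpairing x y = 0}"
  then have x: "fst x \<in> tangent A p" "snd x \<in> cotangent A p"
    and orth: "\<And>y. y \<in> L p \<Longrightarrow> snd x (fst y) + snd y (fst x) = 0"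
    by (auto simp: gfibre_def gpairing_def)
  have "snd x z = 0" if "z \<in> T01 A p" for z
    using orth[of "(z, 0)"] that h_zero[OF type10_sharp] by (simp add: graph_bundle_def T10_dual_zero)
  then have sx: "snd x \<in> T10_dual A p" using x(2) by (simp add: T10_dual_def)
  obtain V \<phi> where V: "(V, \<phi>) \<in> A" "p \<in> V" by (rule chart_exists)
  have "(fst x - sharp A \<pi> p (snd x)) (coord \<phi> (Inl k)) = 0" for k
  proof -
    let ?dz = "differential A (coord \<phi> (Inl k)) p"
    have "(sharp A \<pi> p ?dz, ?dz) \<in> L p"
      by (simp add: graph_bundle_def dz_T10_dual[OF V] T01_zero)
    from orth[OF this] have "snd x (sharp A \<pi> p ?dz) + ?dz (fst x) = 0" by simp
    then have "fst x (coord \<phi> (Inl k)) = - \<pi> p ?dz (snd x)"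
      using pi_sharp_pairing[OF differential_cot x(2)] x(1) by (simp add: add_eq_0_iff)
    also have "\<dots> = sharp A \<pi> p (snd x) (coord \<phi> (Inl k))"
      using pi_commute[OF x(2) differential_cot] by (simp add: pi_sharp_apply[OF x(2)])
    finally show ?thesis by simp
  qed
  then have "fst x - sharp A \<pi> p (snd x) \<in> T01 A p"
    unfolding T01_iff[OF V] using tangent_diff[OF x(1) pi_sharp_tangent[OF x(2)]] by blast
  then show "x \<in> L p" using sx by (simp add: graph_bundle_def)
qed (rule L_gfibre)

abbreviation L_frame where "L_frame \<equiv> graph_frame (sharp A \<pi>)"

lemmas L_frame_simps = graph_frame_simps[OF type10_sharp]
  and L_frame_gsection = graph_frame_gsection[OF type10_sharp]
  and L_frame_in = graph_frame_in[OF type10_sharp]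

lemma L_isotropic_on:
  "(\<And>q. q \<in> U \<Longrightarrow> s q \<in> L q) \<Longrightarrow> (\<And>q. q \<in> U \<Longrightarrow> t q \<in> L q) \<Longrightarrow> isotropic_on U s t"
  unfolding isotropic_on_def by (rule ballI) (rule L_isotropic)

text \<open>The frame of \<open>L\<close> has exact form parts, \<open>dz\<^sub>k\<close> or \<open>0\<close>, so \<open>courant_exact\<close> applies.\<close>

lemma L_frame_bracket_fpart:
  assumes V: "(V, \<phi>) \<in> A" "p \<in> V"
  shows "snd (courant_bracket A (L_frame V \<phi> i) (L_frame V \<phi> (Inl k)) p) =
      differential A (\<lambda>q. fst (L_frame V \<phi> i q) (coord \<phi> (Inl k))) p"
    and "snd (courant_bracket A (L_frame V \<phi> i) (L_frame V \<phi> (Inr k)) p) = 0"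
proof -
  note op = chart_open[OF V(1)]
  define f where "f = (\<lambda>i::'n + 'n. case i of Inl k \<Rightarrow> coord \<phi> (Inl k) | Inr k \<Rightarrow> (\<lambda>q. 0))"
  have fr: "L_frame V \<phi> i = (\<lambda>q. (fst (L_frame V \<phi> i q), differential A (f i) q))" for i
    by (cases i) (simp_all add: L_frame_simps f_def differential_zero fun_eq_iff prod_eq_iff)
  have f: "smooth_fun A V (f i)" for i
    by (cases i) (simp_all add: f_def coord_smooth[OF V(1)] op)
  have iso: "isotropic_on V (L_frame V \<phi> i) (L_frame V \<phi> j)" for i j
    by (rule L_isotropic_on) (rule L_frame_in[OF V(1)], assumption)+
  have *: "snd (courant_bracket A (L_frame V \<phi> i) (L_frame V \<phi> j) p) =
      differential A (\<lambda>q. fst (L_frame V \<phi> i q) (f j)) p" for j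
    by (subst fr[of i], subst fr[of j], rule courant_exact[OF op V(2) _ _ f f])
      (use gsection_vpart[OF L_frame_gsection[OF V(1)]] iso[of i j] fr[of i] fr[of j] in simp_all)
  show "snd (courant_bracket A (L_frame V \<phi> i) (L_frame V \<phi> (Inl k)) p) =
      differential A (\<lambda>q. fst (L_frame V \<phi> i q) (coord \<phi> (Inl k))) p"
    using *[of "Inl k"] by (simp add: f_def)
  have "differential A (\<lambda>q. fst (L_frame V \<phi> i q) (\<lambda>q. 0)) p = 0"
    by (rule differential_const_germ[OF op V(2)])
      (rule tangent_const_fun[OF vf_tangent[OF gsection_vpart[OF L_frame_gsection[OF V(1)]]]])
  then show "snd (courant_bracket A (L_frame V \<phi> i) (L_frame V \<phi> (Inr k)) p) = 0"
    using *[of "Inr k"] by (simp add: f_def)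
qed

text \<open>Two antiholomorphic frame vectors commute. For a mixed pair, the form part vanishes, and the vector part
  has type (0,1) because the coefficients of \<open>\<pi>\<close> are holomorphic. For two holomorphic indices, the form
  part is \<open>d (\<pi>(dz\<^sub>k, dz\<^sub>l))\<close>, of type (1,0) by holomorphy, and the vector part is its Hamiltonian field.\<close>

lemma L_frame_bracket:
  assumes V: "(V, \<phi>) \<in> A" "p \<in> V"
  shows "courant_bracket A (L_frame V \<phi> i) (L_frame V \<phi> j) p \<in> L p"
proof -
  note op = chart_open[OF V(1)] and vf = frame_vector_field[OF V(1)]
  have dz: "one_form A V (differential A (coord \<phi> k))" for k
    by (rule differential_form[OF op coord_smooth[OF V(1)]])
  let ?dz = "\<lambda>k. differential A (coord \<phi> (Inl k))"
  have sh: "vector_field A V (\<lambda>q. sharp A \<pi> q (?dz k q))" for k by (rule pi_sharp_vf[OF op dz])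
  have mixed: "courant_bracket A (L_frame V \<phi> (Inr k)) (L_frame V \<phi> (Inl l)) p \<in> L p" for k l
  proof -
    have "differential A (\<lambda>q. frame V \<phi> (Inr k) q (coord \<phi> (Inl l))) p = 0"
      by (rule differential_const_germ[OF op V(2), of _ 0]) (simp add: frame_coord[OF V(1)])
    then have s: "snd (courant_bracket A (L_frame V \<phi> (Inr k)) (L_frame V \<phi> (Inl l)) p) = 0"
      using L_frame_bracket_fpart(1)[OF V, of "Inr k" l] by (simp add: L_frame_simps)
    let ?b = "vf_bracket A (frame V \<phi> (Inr k)) (\<lambda>q. sharp A \<pi> q (?dz l q)) p"
    have "?b (coord \<phi> (Inl m)) = 0" for m
    proof -
      have "sharp A \<pi> p (?dz l p) (\<lambda>q. frame V \<phi> (Inr k) q (coord \<phi> (Inl m))) = sharp A \<pi> p (?dz l p) (\<lambda>q. 0)"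
        by (rule tangent_germ[OF pi_sharp_tangent[OF differential_cot] op V(2)
              vf_smooth[OF vf op order_refl coord_smooth[OF V(1)]]]) (simp add: frame_coord[OF V(1)])
      moreover have "(\<lambda>q. sharp A \<pi> q (?dz l q) (coord \<phi> (Inl m))) = (\<lambda>q. \<pi> q (?dz l q) (?dz m q))"
        by (rule ext) (rule pi_sharp_apply[OF differential_cot])
      ultimately show ?thesis
        unfolding vf_bracket_apply[OF coord_smooth_at[OF V]]
        by (simp add: pi_coefficients_holomorphic[OF V] tangent_const_fun[OF pi_sharp_tangent[OF differential_cot]])
    qed
    then have "?b \<in> T01 A p" unfolding T01_iff[OF V] using vf_bracket_tangent[OF op V(2) vf sh] by blast
    then show ?thesis
      using s by (simp add: graph_bundle_def courant_vpart L_frame_simps T10_dual_zero h_zero[OF type10_sharp])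
  qed
  show ?thesis
  proof (cases i; cases j)
    fix k l assume i: "i = Inr k" and j: "j = Inr l"
    show ?thesis unfolding i j
      by (simp add: graph_bundle_def L_frame_bracket_fpart(2)[OF V] courant_vpart T10_dual_zero
          h_zero[OF type10_sharp]) (simp add: L_frame_simps frame_bracket[OF V] T01_zero)
  next
    fix k l assume i: "i = Inr k" and j: "j = Inl l"
    show ?thesis unfolding i j by (rule mixed)
  next
    fix k l assume i: "i = Inl k" and j: "j = Inr l"
    show ?thesis unfolding i j
      using L_uminus[OF mixed[of l k]]
        courant_commute[OF op V(2) L_frame_gsection[OF V(1)] L_frame_gsection[OF V(1)], of "Inr l" "Inl k"]
      by simp
  next
    fix k l assume i: "i = Inl k" and j: "j = Inl l"
    let ?br = "\<lambda>q. \<pi> q (?dz k q) (?dz l q)"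
    have "(\<lambda>q. sharp A \<pi> q (?dz k q) (coord \<phi> (Inl l))) = ?br"
      by (rule ext) (rule pi_sharp_apply[OF differential_cot])
    then have s: "snd (courant_bracket A (L_frame V \<phi> (Inl k)) (L_frame V \<phi> (Inl l)) p) = differential A ?br p"
      using L_frame_bracket_fpart(1)[OF V, of "Inl k" l] by (simp add: L_frame_simps)
    have v: "fst (courant_bracket A (L_frame V \<phi> (Inl k)) (L_frame V \<phi> (Inl l)) p) =
        sharp A \<pi> p (differential A ?br p)"
      unfolding courant_vpart L_frame_simps fst_conv
      by (rule hamiltonian_bracket[OF op V(2) coord_smooth[OF V(1)] coord_smooth[OF V(1)]])
    have "differential A ?br p \<in> T10_dual A p"
      unfolding T10_dual_iff[OF V]
      by (simp add: differential_cot frame_tangent[OF V] pi_coefficients_holomorphic[OF V])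
    then show ?thesis unfolding i j by (simp add: graph_bundle_def s v T01_zero)
  qed
qed

lemma L_lincomb2:
  assumes "\<And>i. i \<in> I \<Longrightarrow> x i \<in> L p" "\<And>i. i \<in> I \<Longrightarrow> y i \<in> L p"
  shows "((\<lambda>f. \<Sum>i\<in>I. c i * fst (x i) f + d i * fst (y i) f), (\<lambda>v. \<Sum>i\<in>I. c i * snd (x i) v + d i * snd (y i) v)) \<in> L p"
proof -
  have "(\<Sum>i\<in>I. gscale (c i) (x i)) + (\<Sum>i\<in>I. gscale (d i) (y i)) \<in> L p"
    by (intro L_add L_sum assms)
  then show ?thesis by (simp add: sum_gscale plus_fun_def sum.distrib)
qed

text \<open>Expand both sections in the frame. The Leibniz rule is available in the second argument of the bracket
  only; antisymmetry gives it in the first, so the frame expansions are inserted one after the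
  other.\<close>

lemma L_involutive:
  assumes U: "open U" "p \<in> U" and s: "gsection A U s" "\<And>q. q \<in> U \<Longrightarrow> s q \<in> L q"
    and t: "gsection A U t" "\<And>q. q \<in> U \<Longrightarrow> t q \<in> L q"
  shows "courant_bracket A s t p \<in> L p"
proof -
  obtain V \<phi> where V: "(V, \<phi>) \<in> A" "p \<in> V" by (rule chart_exists)
  define D where "D = U \<inter> V"
  have D: "open D" "p \<in> D" "D \<subseteq> U" "D \<subseteq> V" using U V chart_open[OF V(1)] by (auto simp: D_def)
  let ?e = "L_frame V \<phi>"
  let ?a = "\<lambda>i q. graph_coeff V \<phi> i q (s q)" and ?b = "\<lambda>i q. graph_coeff V \<phi> i q (t q)"
  note sD = gsection_subset[OF s(1) D(3)] and tD = gsection_subset[OF t(1) D(3)]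
  have e: "gsection A D (?e i)" for i by (rule gsection_subset[OF L_frame_gsection[OF V(1)] D(4)])
  have a: "smooth_fun A D (?a i)" and b: "smooth_fun A D (?b i)" for i
    by (rule graph_coeff_smooth[OF V(1) D(1,4) sD], rule graph_coeff_smooth[OF V(1) D(1,4) tD])
  have eL: "?e i q \<in> L q" if "q \<in> D" for i q using L_frame_in[OF V(1)] that D(4) by blast
  have s_eq: "s q = gcomb UNIV ?a ?e q" and t_eq: "t q = gcomb UNIV ?b ?e q" if "q \<in> D" for q
    using graph_expand[OF type10_sharp V(1) _ s(2), of q] graph_expand[OF type10_sharp V(1) _ t(2), of q] that D
    by (auto simp: gcomb_def sum_gscale)
  let ?S = "gcomb UNIV ?a ?e" and ?T = "gcomb UNIV ?b ?e"
  have S: "gsection A D ?S" and T: "gsection A D ?T" by (rule gsection_gcomb[OF a e], rule gsection_gcomb[OF b e])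
  have TL: "?T q \<in> L q" if "q \<in> D" for q using t_eq[OF that] t(2)[of q] that D(3) by auto
  have iso: "isotropic_on D x y" if "\<And>q. q \<in> D \<Longrightarrow> x q \<in> L q" "\<And>q. q \<in> D \<Longrightarrow> y q \<in> L q" for x y
    by (rule L_isotropic_on) (use that in auto)
  have iso_ee: "isotropic_on D (?e i) (?e j)" for i j by (rule iso) (rule eL, assumption)+
  have iso_Te: "isotropic_on D ?T (?e i)" for i by (rule iso) (rule TL, assumption, rule eL, assumption)
  have 1: "courant_bracket A (?e i) ?T p \<in> L p" for i
    unfolding courant_gcomb[OF D(1,2) e b e iso_ee]
    by (rule L_lincomb2) (rule L_frame_bracket[OF V], rule eL[OF D(2)])
  have 2: "courant_bracket A ?T (?e i) p \<in> L p" for i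
    using L_uminus[OF 1[of i]] courant_commute[OF D(1,2) e T, of i] by simp
  have "courant_bracket A ?T ?S p \<in> L p"
    unfolding courant_gcomb[OF D(1,2) T a e iso_Te]
    by (rule L_lincomb2) (rule 2, rule eL[OF D(2)])
  then have "courant_bracket A ?S ?T p \<in> L p"
    using L_uminus courant_commute[OF D(1,2) T S] by fastforce
  moreover have "courant_bracket A s t p = courant_bracket A ?S ?T p"
    by (rule courant_cong[OF D(1,2) sD S tD T s_eq t_eq iso]) (use s(2) t(2) D(3) in auto)
  ultimately show ?thesis by simp
qed

lemma L_vector_bundle: "complex_vector_bundle A (courant_algebroid_of A L)"
  by (rule graph_bundle_cvb[OF type10_sharp]) simp_all

lemma L_lie_algebroid: "complex_lie_algebroid A (courant_algebroid_of A L)"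
proof (rule courant_lie_algebroid[OF L_vector_bundle])
  show "x \<in> gfibre A p" if "x \<in> L p" for p x by (rule L_gfibre[OF that])
  show "snd x (fst y) + snd y (fst x) = 0" if "x \<in> L p" "y \<in> L p" for p x y by (rule L_isotropic[OF that])
  show "courant_bracket A s t p \<in> L p"
    if "gsection A UNIV s" "gsection A UNIV t" "\<And>q. s q \<in> L q" "\<And>q. t q \<in> L q" for s t p
    by (rule L_involutive[OF open_UNIV UNIV_I that(1,3,2,4)])
qed

lemma L_sections_involutive:
  assumes "s \<in> global_sections (courant_algebroid_of A L)" "t \<in> global_sections (courant_algebroid_of A L)"
  shows "courant_bracket A s t \<in> global_sections (courant_algebroid_of A L)"
  using assms gsection_courant[OF open_UNIV, of s t] L_involutive[OF open_UNIV UNIV_I, of s t] by simp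

lemma L_dirac: "dirac_structure A L"
  unfolding dirac_structure_def
  by (intro conjI ballI allI L_vector_bundle L_maximal L_sections_involutive)

section \<open>The isomorphism with the matched pair\<close>

lemma matched_pair_simps [simp]:
  "fibre (matched_pair_algebroid A P) = (\<lambda>p. T01 A p \<times> T10_dual A p)"
  "scal (matched_pair_algebroid A P) = gscale"
  "smooth_sec (matched_pair_algebroid A P) U s =
    (gsection A U s \<and> (\<forall>p\<in>U. s p \<in> T01 A p \<times> T10_dual A p))"
  "anchor (matched_pair_algebroid A P) p x = fst x + sharp A P p (snd x)"
  by (simp_all add: matched_pair_algebroid_def)

lemma graph_bundle_zero_map: "graph_bundle (\<lambda>p \<alpha>. 0) = (\<lambda>p. T01 A p \<times> T10_dual A p)"
  by (auto simp: graph_bundle_def fun_eq_iff mem_Times_iff)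

lemma matched_pair_vector_bundle: "complex_vector_bundle A (matched_pair_algebroid A \<pi>)"
  by (rule graph_bundle_cvb[OF type10_map_zero]) (simp_all add: graph_bundle_zero_map)

text \<open>The isomorphism; its values fill out \<open>L\<close>, and its inverse subtracts \<open>\<pi>\<^sup>\<sharp>\<close> of the form part.\<close>

definition to_L :: "'a \<Rightarrow> 'a gvec \<Rightarrow> 'a gvec" where
  "to_L p x = (fst x + sharp A \<pi> p (snd x), snd x)"

lemma to_L_in: "x \<in> T01 A p \<times> T10_dual A p \<Longrightarrow> to_L p x \<in> L p"
  by (auto simp: to_L_def graph_bundle_def)

lemma to_L_bij: "bij_betw (to_L p) (T01 A p \<times> T10_dual A p) (L p)"
  by (rule bij_betwI[where g = "\<lambda>x. (fst x - sharp A \<pi> p (snd x), snd x)"])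
    (auto simp: to_L_def graph_bundle_def)

lemma to_L_gsection:
  assumes "open U"
  shows "gsection A U (\<lambda>p. to_L p (s p)) \<longleftrightarrow> gsection A U s"
proof
  assume s: "gsection A U s"
  show "gsection A U (\<lambda>p. to_L p (s p))"
    using vf_add[OF assms gsection_vpart[OF s] pi_sharp_vf[OF assms gsection_fpart[OF s]]] gsection_fpart[OF s]
    by (simp add: gsection_def to_L_def)
next
  assume s: "gsection A U (\<lambda>p. to_L p (s p))"
  then have f: "one_form A U (fpart s)" and v: "vector_field A U (\<lambda>p. fst (s p) + sharp A \<pi> p (snd (s p)))"
    by (simp_all add: gsection_def to_L_def)
  show "gsection A U s"
    using vf_diff[OF assms v pi_sharp_vf[OF assms f]] f by (simp add: gsection_def)
qed

lemma lie_deriv_add_left: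
  assumes U: "open U" "p \<in> U" and Z: "vector_field A U Z" and W: "vector_field A U W" and \<eta>: "one_form A U \<eta>"
  shows "lie_deriv A (\<lambda>q. Z q + W q) \<eta> p = lie_deriv A Z \<eta> p + lie_deriv A W \<eta> p"
proof (rule cot_eqI[OF U])
  note ZW = vf_add[OF U(1) Z W]
  show "lie_deriv A (\<lambda>q. Z q + W q) \<eta> p \<in> cotangent A p" by (rule lie_deriv_cot[OF U ZW \<eta>])
  show "lie_deriv A Z \<eta> p + lie_deriv A W \<eta> p \<in> cotangent A p"
    by (intro cotangent_add lie_deriv_cot[OF U _ \<eta>] Z W)
  fix T Y assume T: "open T" "p \<in> T" "T \<subseteq> U" and Y: "vector_field A T Y"
  note sub = vf_subset[OF Z T(3)] vf_subset[OF W T(3)] vf_subset[OF ZW T(3)] form_subset[OF \<eta> T(3)]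
  note eval = lie_deriv_eval[OF T(1,2) _ sub(4) Y]
  show "lie_deriv A (\<lambda>q. Z q + W q) \<eta> p (Y p) = (lie_deriv A Z \<eta> p + lie_deriv A W \<eta> p) (Y p)"
    unfolding plus_fun_apply eval[OF sub(1)] eval[OF sub(2)] eval[OF sub(3)]
      vf_bracket_add_left[OF T(1,2) Y sub(1,2)]
      cot_add[OF form_cot[OF sub(4) T(2)] vf_bracket_tangent[OF T(1,2) sub(1) Y] vf_bracket_tangent[OF T(1,2) sub(2) Y]]
    by simp
qed

text \<open>The form parts agree since \<open>\<xi>\<^sub>1 (V\<^sub>2) - \<xi>\<^sub>2 (V\<^sub>1) = - 2 \<pi>(\<xi>\<^sub>1, \<xi>\<^sub>2)\<close> for the vector parts
  \<open>V\<^sub>i = Z\<^sub>i + \<pi>\<^sup>\<sharp>\<xi>\<^sub>i\<close>. For the vector parts only the (0,1)-components have to be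
  compared, because the Courant bracket lies in \<open>L\<close> and is therefore determined by its form part and its
  (0,1)-component. The projection to that component keeps \<open>[Z\<^sub>1, Z\<^sub>2]\<close>, turns the mixed brackets into the
  two connection terms, and kills the bracket of the two (1,0)-fields.\<close>

lemma to_L_brack:
  assumes s: "gsection A UNIV s" "\<And>q. s q \<in> T01 A q \<times> T10_dual A q"
    and t: "gsection A UNIV t" "\<And>q. t q \<in> T01 A q \<times> T10_dual A q"
  shows "brack (matched_pair_algebroid A \<pi>) s t p \<in> T01 A p \<times> T10_dual A p"
    and "to_L p (brack (matched_pair_algebroid A \<pi>) s t p) =
      courant_bracket A (\<lambda>q. to_L q (s q)) (\<lambda>q. to_L q (t q)) p"
proof -
  note U = open_UNIV[where 'a = 'a] UNIV_I[of p]
  let ?Z1 = "vpart s" and ?Z2 = "vpart t" and ?\<xi>1 = "fpart s" and ?\<xi>2 = "fpart t"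
  let ?X1 = "\<lambda>q. sharp A \<pi> q (?\<xi>1 q)" and ?X2 = "\<lambda>q. sharp A \<pi> q (?\<xi>2 q)"
  let ?C = "courant_bracket A (\<lambda>q. to_L q (s q)) (\<lambda>q. to_L q (t q)) p"
  let ?B = "brack (matched_pair_algebroid A \<pi>) s t p"
  note Z = gsection_vpart[OF s(1)] gsection_vpart[OF t(1)] and \<xi> = gsection_fpart[OF s(1)] gsection_fpart[OF t(1)]
  note X = pi_sharp_vf[OF U(1) \<xi>(1)] pi_sharp_vf[OF U(1) \<xi>(2)]
  have types: "?Z1 q \<in> T01 A q" "?\<xi>1 q \<in> T10_dual A q" "?Z2 q \<in> T01 A q" "?\<xi>2 q \<in> T10_dual A q" for q
    using s(2)[of q] t(2)[of q] by (auto simp: mem_Times_iff)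
  note cot = T10_dual_cot[OF types(2)] T10_dual_cot[OF types(4)]
  have tans: "vf_bracket A Z W p \<in> tangent A p" if "vector_field A UNIV Z" "vector_field A UNIV W" for Z W
    by (rule vf_bracket_tangent[OF U that])
  have C: "?C \<in> L p"
    by (rule L_involutive[OF U]) (use to_L_gsection[OF U(1)] s t to_L_in in auto)
  have C_tan: "fst ?C \<in> tangent A p" "snd ?C \<in> T10_dual A p" "fst ?C - sharp A \<pi> p (snd ?C) \<in> T01 A p"
    using C L_gfibre[OF C] by (auto simp: graph_bundle_def gfibre_def)
  have sm: "smooth_at A p (\<lambda>q. \<pi> q (?\<xi>1 q) (?\<xi>2 q))"
    by (rule smooth_atI[OF U pi_smooth[OF U(1) \<xi>]])
  have fB: "snd ?B = snd ?C"
  proof -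
    have V1: "(\<lambda>q. fst (to_L q (s q))) = (\<lambda>q. ?Z1 q + ?X1 q)" and V2: "(\<lambda>q. fst (to_L q (t q))) = (\<lambda>q. ?Z2 q + ?X2 q)"
      by (simp_all add: to_L_def)
    have F: "(\<lambda>q. snd (to_L q (s q))) = ?\<xi>1" "(\<lambda>q. snd (to_L q (t q))) = ?\<xi>2" by (simp_all add: to_L_def)
    have pairing: "(\<lambda>q. snd (to_L q (s q)) (fst (to_L q (t q))) - snd (to_L q (t q)) (fst (to_L q (s q)))) =
        (\<lambda>q. (- 2) * \<pi> q (?\<xi>1 q) (?\<xi>2 q))"
    proof
      fix q
      show "snd (to_L q (s q)) (fst (to_L q (t q))) - snd (to_L q (t q)) (fst (to_L q (s q))) =
          (- 2) * \<pi> q (?\<xi>1 q) (?\<xi>2 q)"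
        using L_pairing[OF to_L_in[OF s(2)] types(4)] L_pairing[OF to_L_in[OF t(2)] types(2)]
          pi_commute[OF cot] by (simp add: to_L_def)
    qed
    have d: "(\<lambda>v. 1 / 2 * differential A (\<lambda>q. (- 2) * \<pi> q (?\<xi>1 q) (?\<xi>2 q)) p v) =
        - differential A (\<lambda>q. \<pi> q (?\<xi>1 q) (?\<xi>2 q)) p"
    proof
      fix v
      show "1 / 2 * differential A (\<lambda>q. (- 2) * \<pi> q (?\<xi>1 q) (?\<xi>2 q)) p v =
          (- differential A (\<lambda>q. \<pi> q (?\<xi>1 q) (?\<xi>2 q)) p) v"
        using tangent_cmult_fun[OF _ sm, of v "- 2"] by (simp add: differential_def)
    qed
    have "snd ?C = lie_deriv A (\<lambda>q. ?Z1 q + ?X1 q) ?\<xi>2 p - lie_deriv A (\<lambda>q. ?Z2 q + ?X2 q) ?\<xi>1 p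
        + (\<lambda>v. 1 / 2 * differential A (\<lambda>q. (- 2) * \<pi> q (?\<xi>1 q) (?\<xi>2 q)) p v)"
      unfolding courant_bracket_def Let_def snd_conv pairing unfolding V1 V2 F ..
    also have "\<dots> = snd ?B"
      unfolding d lie_deriv_add_left[OF U Z(1) X(1) \<xi>(2)] lie_deriv_add_left[OF U Z(2) X(2) \<xi>(1)]
      by (simp add: matched_pair_algebroid_def Let_def poisson_bracket_forms_def nabla_vec_form_def algebra_simps)
    finally show ?thesis ..
  qed
  have Z12: "vf_bracket A ?Z1 ?Z2 p \<in> T01 A p" by (rule T01_involutive[OF U Z]) (simp_all add: types)
  have X12: "vf_bracket A ?X1 ?X2 p \<in> T10 A p"
    by (rule T10_involutive[OF U X]) (simp_all add: pi_sharp_T10 cot)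
  have fst_C: "fst ?C = (vf_bracket A ?Z1 ?Z2 p + vf_bracket A ?X1 ?Z2 p) + (vf_bracket A ?X1 ?X2 p - vf_bracket A ?X2 ?Z1 p)"
  proof -
    have "fst ?C = vf_bracket A (\<lambda>q. ?Z1 q + ?X1 q) (\<lambda>q. ?Z2 q + ?X2 q) p"
      unfolding courant_vpart by (simp add: to_L_def)
    also have "\<dots> = vf_bracket A ?Z1 ?Z2 p + vf_bracket A ?Z1 ?X2 p + (vf_bracket A ?X1 ?Z2 p + vf_bracket A ?X1 ?X2 p)"
      unfolding vf_bracket_add_left[OF U vf_add[OF U(1) Z(2) X(2)] Z(1) X(1)]
        vf_bracket_add[OF U Z(1) Z(2) X(2)] vf_bracket_add[OF U X(1) Z(2) X(2)] ..
    finally show ?thesis by (simp add: vf_bracket_commute[of ?Z1 ?X2])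
  qed
  have pr: "pr01 A p (fst ?C) = vf_bracket A ?Z1 ?Z2 p + pr01 A p (vf_bracket A ?X1 ?Z2 p) - pr01 A p (vf_bracket A ?X2 ?Z1 p)"
    unfolding fst_C
      pr01_add[OF tangent_add[OF tans[OF Z] tans[OF X(1) Z(2)]] tangent_diff[OF tans[OF X] tans[OF X(2) Z(1)]]]
      pr01_add[OF tans[OF Z] tans[OF X(1) Z(2)]] pr01_diff[OF tans[OF X] tans[OF X(2) Z(1)]]
      pr01_T01[OF Z12] pr01_T10[OF X12] by simp
  have vB: "fst ?B = pr01 A p (fst ?C)"
    unfolding pr by (simp add: matched_pair_algebroid_def Let_def nabla_form_vec_def)
  have pr': "pr01 A p (fst ?C) = fst ?C - sharp A \<pi> p (snd ?C)"
    by (rule pr01_unique[OF C_tan(3)]) (simp add: pi_sharp_T10 T10_dual_cot[OF C_tan(2)])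
  show "?B \<in> T01 A p \<times> T10_dual A p"
    using vB pr' fB C_tan by (simp add: mem_Times_iff)
  show "to_L p ?B = ?C"
    unfolding to_L_def[of p ?B] fB vB pr' by (rule prod_eqI) simp_all
qed

lemma to_L_iso: "lie_algebroid_iso (matched_pair_algebroid A \<pi>) (courant_algebroid_of A L) to_L"
  unfolding lie_algebroid_iso_def matched_pair_simps courant_algebroid_simps
proof (intro conjI allI ballI impI; (elim conjE)?)
  fix p show "bij_betw (to_L p) (T01 A p \<times> T10_dual A p) (L p)" by (rule to_L_bij)
  fix x y c assume "x \<in> T01 A p \<times> T10_dual A p"
  then have x: "snd x \<in> cotangent A p" by (auto simp: T10_dual_cot)
  show "to_L p (gscale c x) = gscale c (to_L p x)"
    using sharp_scale[OF pi_bivector x] by (simp add: to_L_def prod_eq_iff fun_eq_iff algebra_simps)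
  show "fst (to_L p x) = fst x + sharp A \<pi> p (snd x)" by (simp add: to_L_def)
  assume "y \<in> T01 A p \<times> T10_dual A p"
  then have y: "snd y \<in> cotangent A p" by (auto simp: T10_dual_cot)
  show "to_L p (x + y) = to_L p x + to_L p y"
    using sharp_add[OF pi_bivector x y] by (simp add: to_L_def prod_eq_iff algebra_simps)
next
  fix U s assume U: "open U" and s: "\<forall>p\<in>U. s p \<in> T01 A p \<times> T10_dual A p"
  have "\<forall>p\<in>U. to_L p (s p) \<in> L p" using s to_L_in by blast
  then show "(gsection A U (\<lambda>p. to_L p (s p)) \<and> (\<forall>p\<in>U. to_L p (s p) \<in> L p)) =
      (gsection A U s \<and> (\<forall>p\<in>U. s p \<in> T01 A p \<times> T10_dual A p))"
    using s to_L_gsection[OF U, of s] by blast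
next
  fix s t assume "s \<in> {s. gsection A UNIV s \<and> (\<forall>p\<in>UNIV. s p \<in> T01 A p \<times> T10_dual A p)}"
    "t \<in> {s. gsection A UNIV s \<and> (\<forall>p\<in>UNIV. s p \<in> T01 A p \<times> T10_dual A p)}"
  then have st: "gsection A UNIV s" "\<And>q. s q \<in> T01 A q \<times> T10_dual A q"
    "gsection A UNIV t" "\<And>q. t q \<in> T01 A q \<times> T10_dual A q" by blast+
  show "(\<lambda>p. to_L p (brack (matched_pair_algebroid A \<pi>) s t p)) =
      courant_bracket A (\<lambda>p. to_L p (s p)) (\<lambda>p. to_L p (t p))"
    by (rule ext) (rule to_L_brack(2)[OF st])
qed

lemma matched_pair_lie_algebroid: "complex_lie_algebroid A (matched_pair_algebroid A \<pi>)"
proof (rule lie_algebroid_transport[OF L_lie_algebroid matched_pair_vector_bundle to_L_iso])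
  let ?E = "matched_pair_algebroid A \<pi>"
  fix s assume "s \<in> global_sections ?E"
  then have s: "gsection A UNIV s" "\<And>q. s q \<in> T01 A q \<times> T10_dual A q" by auto
  { fix f assume f: "smooth_fun A UNIV f"
    have "gscale (f q) (s q) \<in> T01 A q \<times> T10_dual A q" for q
      using graph_bundle_scale[OF type10_map_zero, of "s q" q] s(2) by (simp add: graph_bundle_zero_map)
    then show "(\<lambda>p. scal ?E (f p) (s p)) \<in> global_sections ?E"
      using gsection_scale[OF f s(1)] by simp }
  fix t assume "t \<in> global_sections ?E"
  then have t: "gsection A UNIV t" "\<And>q. t q \<in> T01 A q \<times> T10_dual A q" by auto
  show "brack ?E s t p \<in> fibre ?E p" for p using to_L_brack(1)[OF s t] by simp
  have "s q + t q \<in> T01 A q \<times> T10_dual A q" for q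
    using graph_bundle_add[OF type10_map_zero, of "s q" q "t q"] s(2) t(2) by (simp add: graph_bundle_zero_map)
  then show "s + t \<in> global_sections ?E"
    using gsection_add[OF open_UNIV s(1) t(1)] by (simp add: plus_fun_def)
qed

lemma matched_pair_isomorphic:
  "isomorphic_lie_algebroids A (matched_pair_algebroid A \<pi>) (courant_algebroid_of A L)"
  unfolding isomorphic_lie_algebroids_def
  using matched_pair_lie_algebroid L_lie_algebroid to_L_iso by blast

section \<open>The generalized complex structure\<close>

context
  fixes \<pi>R \<pi>I :: "'a bivector"
  assumes piR: "real_bivector_field A \<pi>R" and piI: "real_bivector_field A \<pi>I"
    and pi_Re_Im: "\<And>p \<alpha> \<beta>. \<alpha> \<in> cotangent A p \<Longrightarrow> \<beta> \<in> cotangent A p \<Longrightarrow>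
      \<pi> p \<alpha> \<beta> = \<pi>R p \<alpha> \<beta> + \<i> * \<pi>I p \<alpha> \<beta>"
begin

lemma piI_bivector: "bivector_field A \<pi>I"
  using piI by (simp add: real_bivector_field_def)

lemma real_bivector_cnj:
  assumes "real_bivector_field A P" "\<alpha> \<in> cotangent A p" "\<beta> \<in> cotangent A p"
  shows "P p (cnj_covec \<alpha>) (cnj_covec \<beta>) = cnj (P p \<alpha> \<beta>)"
  using assms(1)[unfolded real_bivector_field_def, THEN conjunct2, THEN spec, THEN bspec, OF assms(2),
      THEN bspec, OF assms(3)] .

text \<open>Taking the imaginary part of \<open>\<pi>\<close>, where the conjugate bivector is \<open>\<alpha>, \<beta> \<mapsto> cnj (\<pi> (cnj \<alpha>, cnj \<beta>))\<close>.\<close>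

lemma piI_eq:
  assumes \<alpha>: "\<alpha> \<in> cotangent A p" and \<beta>: "\<beta> \<in> cotangent A p"
  shows "\<pi>I p \<alpha> \<beta> = (- \<i> / 2) * (\<pi> p \<alpha> \<beta> - cnj (\<pi> p (cnj_covec \<alpha>) (cnj_covec \<beta>)))"
  unfolding pi_Re_Im[OF \<alpha> \<beta>] pi_Re_Im[OF cotangent_cnj[OF \<alpha>] cotangent_cnj[OF \<beta>]]
    real_bivector_cnj[OF piR \<alpha> \<beta>] real_bivector_cnj[OF piI \<alpha> \<beta>]
  by (simp add: complex_eq_iff)

text \<open>The conjugate of a (1,0)-form annihilates (1,0)-vectors, so the conjugate term in \<open>piI_eq\<close> vanishes.\<close>

lemma piI_sharp_T10_dual:
  assumes \<alpha>: "\<alpha> \<in> T10_dual A p"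
  shows "sharp A \<pi>I p \<alpha> = (\<lambda>f. (- \<i> / 2) * sharp A \<pi> p \<alpha> f)"
proof (rule sharp_eqI[OF piI_bivector])
  note \<alpha>' = T10_dual_cot[OF \<alpha>]
  show "\<alpha> \<in> cotangent A p" by (rule \<alpha>')
  show "(\<lambda>f. (- \<i> / 2) * sharp A \<pi> p \<alpha> f) \<in> tangent A p"
    by (intro tangent_scale pi_sharp_tangent \<alpha>')
  fix \<beta> assume \<beta>: "\<beta> \<in> cotangent A p"
  have "cnj_covec \<alpha> v = 0" if "v \<in> T10 A p" for v
    using T10_dual_T01[OF \<alpha> cnj_T10[OF that]] by (simp add: cnj_covec_def)
  then have "\<pi> p (cnj_covec \<alpha>) (cnj_covec \<beta>) = 0"
    by (intro pi_type cotangent_cnj \<alpha>' \<beta>)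
  then show "\<beta> (\<lambda>f. (- \<i> / 2) * sharp A \<pi> p \<alpha> f) = \<pi>I p \<alpha> \<beta>"
    unfolding cot_scale[OF \<beta> pi_sharp_tangent[OF \<alpha>']] pi_sharp_pairing[OF \<alpha>' \<beta>] piI_eq[OF \<alpha>' \<beta>] by simp
qed

text \<open>The form \<open>J\<^sup>*\<alpha> - i \<alpha>\<close> annihilates (1,0)-vectors.\<close>

lemma pi_Jdual:
  assumes \<alpha>: "\<alpha> \<in> cotangent A p" and \<beta>: "\<beta> \<in> cotangent A p"
  shows "\<pi> p \<beta> (Jdual A p \<alpha>) = \<i> * \<pi> p \<beta> \<alpha>"
proof -
  let ?\<gamma> = "Jdual A p \<alpha> + (\<lambda>v. (- \<i>) * \<alpha> v)"
  note J = Jdual_cot[OF \<alpha>] and s = cotangent_scale[OF \<alpha>, of "- \<i>"]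
  have \<gamma>: "?\<gamma> \<in> cotangent A p" by (rule cotangent_add[OF J s])
  have "?\<gamma> v = 0" if "v \<in> T10 A p" for v
  proof -
    have "Jmap A p v = (\<lambda>f. \<i> * v f)" using that by (simp add: T10_def)
    then show ?thesis
      using cot_scale[OF \<alpha> T10_tangent[OF that], of \<i>] by (simp add: Jdual_apply[OF T10_tangent[OF that]])
  qed
  then have "\<pi> p ?\<gamma> \<beta> = 0" by (rule pi_type[OF \<gamma> \<beta>])
  then have "\<pi> p \<beta> ?\<gamma> = 0" using pi_commute[OF \<gamma> \<beta>] by simp
  then show ?thesis
    unfolding biv_add[OF pi_bivector \<beta> J s] biv_scale[OF pi_bivector \<beta> \<alpha>] by simp
qed

text \<open>Both \<open>\<pi>\<close> and its conjugate have this symmetry, with factors \<open>i\<close> and \<open>- i\<close>. It is the compatibility of \<open>J\<close> with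
  \<open>\<pi>\<^sub>I\<close> that makes \<open>JJ4\<close> square to \<open>-1\<close> and preserve the pairing.\<close>

lemma piI_Jdual:
  assumes \<alpha>: "\<alpha> \<in> cotangent A p" and \<beta>: "\<beta> \<in> cotangent A p"
  shows "\<pi>I p (Jdual A p \<beta>) \<alpha> = \<pi>I p \<beta> (Jdual A p \<alpha>)"
proof -
  have *: "\<pi>I p \<beta> (Jdual A p \<alpha>) = (1/2) * (\<pi> p \<beta> \<alpha> + cnj (\<pi> p (cnj_covec \<beta>) (cnj_covec \<alpha>)))"
    if \<alpha>: "\<alpha> \<in> cotangent A p" and \<beta>: "\<beta> \<in> cotangent A p" for \<alpha> \<beta>
    unfolding piI_eq[OF \<beta> Jdual_cot[OF \<alpha>]] Jdual_cnj[OF \<alpha>, symmetric] pi_Jdual[OF \<alpha> \<beta>]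
      pi_Jdual[OF cotangent_cnj[OF \<alpha>] cotangent_cnj[OF \<beta>]]
    by (simp add: complex_eq_iff field_simps)
  show ?thesis
    unfolding biv_commute[OF piI_bivector \<alpha> Jdual_cot[OF \<beta>]] *[OF \<alpha> \<beta>] *[OF \<beta> \<alpha>]
      pi_commute[OF \<alpha> \<beta>] pi_commute[OF cotangent_cnj[OF \<alpha>] cotangent_cnj[OF \<beta>]]
    by (simp add: field_simps)
qed

lemma piI_sharp_Jdual:
  assumes \<alpha>: "\<alpha> \<in> cotangent A p"
  shows "sharp A \<pi>I p (Jdual A p \<alpha>) = Jmap A p (sharp A \<pi>I p \<alpha>)"
proof (rule sharp_eqI[OF piI_bivector Jdual_cot[OF \<alpha>]])
  note t = sharp_tangent[OF piI_bivector \<alpha>]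
  show "Jmap A p (sharp A \<pi>I p \<alpha>) \<in> tangent A p" by (rule Jmap_tangent[OF t])
  fix \<beta> assume \<beta>: "\<beta> \<in> cotangent A p"
  show "\<beta> (Jmap A p (sharp A \<pi>I p \<alpha>)) = \<pi>I p (Jdual A p \<alpha>) \<beta>"
    unfolding Jdual_apply[OF t, symmetric] sharp_pairing[OF piI_bivector \<alpha> Jdual_cot[OF \<beta>]]
      piI_Jdual[OF \<beta> \<alpha>] ..
qed

lemma piI_sharp_cnj:
  assumes \<alpha>: "\<alpha> \<in> cotangent A p"
  shows "sharp A \<pi>I p (cnj_covec \<alpha>) = cnj_vec (sharp A \<pi>I p \<alpha>)"
proof (rule sharp_eqI[OF piI_bivector cotangent_cnj[OF \<alpha>]])
  note t = sharp_tangent[OF piI_bivector \<alpha>]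
  show "cnj_vec (sharp A \<pi>I p \<alpha>) \<in> tangent A p" by (rule tangent_cnj[OF t])
  fix \<beta> assume \<beta>: "\<beta> \<in> cotangent A p"
  have "\<beta> (cnj_vec (sharp A \<pi>I p \<alpha>)) = cnj (cnj_covec \<beta> (sharp A \<pi>I p \<alpha>))"
    by (simp add: cnj_covec_def)
  also have "\<dots> = \<pi>I p (cnj_covec \<alpha>) \<beta>"
    using sharp_pairing[OF piI_bivector \<alpha> cotangent_cnj[OF \<beta>]]
      real_bivector_cnj[OF piI \<alpha> cotangent_cnj[OF \<beta>]] by simp
  finally show "\<beta> (cnj_vec (sharp A \<pi>I p \<alpha>)) = \<pi>I p (cnj_covec \<alpha>) \<beta>" .
qed

text \<open>The form part of the eigenvalue equation says \<open>J\<^sup>*\<alpha> = i \<alpha>\<close>, that is, \<open>\<alpha>\<close> has type (1,0). The vector part is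
  compared on coordinates: on \<open>z\<^sub>k\<close> it reads \<open>i v - 2i \<pi>\<^sup>\<sharp>\<alpha> = - i v\<close>, and on the conjugate of \<open>z\<^sub>k\<close> it
  holds for every \<open>v\<close>.\<close>

lemma JJ4_eigenbundle: "minus_i_eigenbundle A (JJ4 A \<pi>I) = L"
proof (rule ext, rule set_eqI)
  fix p and x :: "'a gvec"
  obtain v \<alpha> where x: "x = (v, \<alpha>)" by (cases x)
  obtain V \<phi> where V: "(V, \<phi>) \<in> A" "p \<in> V" by (rule chart_exists)
  have eig: "x \<in> minus_i_eigenbundle A (JJ4 A \<pi>I) p \<longleftrightarrow> v \<in> tangent A p \<and> \<alpha> \<in> cotangent A p \<and>
      Jmap A p v + (\<lambda>f. 4 * sharp A \<pi>I p \<alpha> f) = (\<lambda>f. - \<i> * v f) \<and> - Jdual A p \<alpha> = (\<lambda>w. - \<i> * \<alpha> w)"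
    by (auto simp: minus_i_eigenbundle_def gfibre_def JJ4_def gscale_def x)
  have dual: "- Jdual A p \<alpha> = (\<lambda>w. - \<i> * \<alpha> w) \<longleftrightarrow> \<alpha> \<in> T10_dual A p" if \<alpha>: "\<alpha> \<in> cotangent A p"
  proof -
    have J: "Jdual A p \<alpha> (frame V \<phi> i p) = J_factor i * \<alpha> (frame V \<phi> i p)" for i
    proof -
      have "Jmap A p (frame V \<phi> i p) = (\<lambda>f. J_factor i * frame V \<phi> i p f)"
        using frame_T10[OF V] frame_T01[OF V] by (cases i) (simp_all add: T10_def T01_def)
      then show ?thesis
        by (simp add: Jdual_apply[OF frame_tangent[OF V]] cot_scale[OF \<alpha> frame_tangent[OF V]])
    qed
    have "- Jdual A p \<alpha> = (\<lambda>w. - \<i> * \<alpha> w) \<longleftrightarrow>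
        (\<forall>i. - (J_factor i * \<alpha> (frame V \<phi> i p)) = - \<i> * \<alpha> (frame V \<phi> i p))"
    proof
      assume eq: "- Jdual A p \<alpha> = (\<lambda>w. - \<i> * \<alpha> w)"
      show "\<forall>i. - (J_factor i * \<alpha> (frame V \<phi> i p)) = - \<i> * \<alpha> (frame V \<phi> i p)"
        unfolding J[symmetric] using fun_cong[OF eq] by simp
    next
      assume eq: "\<forall>i. - (J_factor i * \<alpha> (frame V \<phi> i p)) = - \<i> * \<alpha> (frame V \<phi> i p)"
      show "- Jdual A p \<alpha> = (\<lambda>w. - \<i> * \<alpha> w)"
        by (rule cot_eqI_frame[OF V cotangent_uminus[OF Jdual_cot[OF \<alpha>]] cotangent_scale[OF \<alpha>]])
          (simp only: uminus_apply J eq)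
    qed
    also have "\<dots> \<longleftrightarrow> (\<forall>k. \<alpha> (frame V \<phi> (Inr k) p) = 0)"
      by (auto simp: J_factor_def add_eq_0_iff2 neg_eq_iff_add_eq_0 split: sum.splits)
    finally show ?thesis unfolding T10_dual_iff[OF V] using \<alpha> by blast
  qed
  have vec: "Jmap A p v + (\<lambda>f. 4 * sharp A \<pi>I p \<alpha> f) = (\<lambda>f. - \<i> * v f) \<longleftrightarrow> v - sharp A \<pi> p \<alpha> \<in> T01 A p"
    if v: "v \<in> tangent A p" and \<alpha>: "\<alpha> \<in> T10_dual A p"
  proof -
    note sh = pi_sharp_tangent[OF T10_dual_cot[OF \<alpha>]]
    let ?u = "Jmap A p v + (\<lambda>f. 4 * sharp A \<pi>I p \<alpha> f)"
    have u_eq: "?u (coord \<phi> i) = J_factor i * v (coord \<phi> i) - 2 * \<i> * sharp A \<pi> p \<alpha> (coord \<phi> i)" for i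
      by (simp add: Jmap_coord[OF v V] piI_sharp_T10_dual[OF \<alpha>])
    have u: "?u \<in> tangent A p"
      by (intro tangent_add Jmap_tangent[OF v] tangent_scale sharp_tangent[OF piI_bivector] T10_dual_cot[OF \<alpha>])
    have r: "sharp A \<pi> p \<alpha> (coord \<phi> (Inr k)) = 0" for k
      using pi_sharp_T10[OF T10_dual_cot[OF \<alpha>]] T10_iff[OF V] by blast
    have "?u = (\<lambda>f. - \<i> * v f) \<longleftrightarrow> (\<forall>i. ?u (coord \<phi> i) = - \<i> * v (coord \<phi> i))"
    proof
      assume eq: "\<forall>i. ?u (coord \<phi> i) = - \<i> * v (coord \<phi> i)"
      show "?u = (\<lambda>f. - \<i> * v f)"
        by (rule tangent_eqI[OF V u tangent_scale[OF v]]) (use eq in blast)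
    next
      assume eq: "?u = (\<lambda>f. - \<i> * v f)"
      show "\<forall>i. ?u (coord \<phi> i) = - \<i> * v (coord \<phi> i)" using fun_cong[OF eq] by blast
    qed
    also have "\<dots> \<longleftrightarrow> (\<forall>k. (v - sharp A \<pi> p \<alpha>) (coord \<phi> (Inl k)) = 0)"
    proof -
      have "?u (coord \<phi> (Inr k)) = - \<i> * v (coord \<phi> (Inr k))" for k unfolding u_eq r by simp
      moreover have "?u (coord \<phi> (Inl k)) = - \<i> * v (coord \<phi> (Inl k)) \<longleftrightarrow>
          (v - sharp A \<pi> p \<alpha>) (coord \<phi> (Inl k)) = 0" for k
        unfolding u_eq by (auto simp: complex_eq_iff)
      ultimately show ?thesis by (metis sum.exhaust)
    qed
    finally show ?thesis unfolding T01_iff[OF V] using tangent_diff[OF v sh] by blast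
  qed
  show "x \<in> minus_i_eigenbundle A (JJ4 A \<pi>I) p \<longleftrightarrow> x \<in> L p"
  proof
    assume "x \<in> minus_i_eigenbundle A (JJ4 A \<pi>I) p"
    then show "x \<in> L p" using eig dual vec by (simp add: graph_bundle_def x)
  next
    assume xL: "x \<in> L p"
    then have "v \<in> tangent A p" "\<alpha> \<in> T10_dual A p" "v - sharp A \<pi> p \<alpha> \<in> T01 A p"
      using L_gfibre[OF xL] by (auto simp: graph_bundle_def gfibre_def x)
    then show "x \<in> minus_i_eigenbundle A (JJ4 A \<pi>I) p"
      using eig dual[OF T10_dual_cot] vec by (simp add: T10_dual_cot)
  qed
qed

lemma JJ4_gfibre: "x \<in> gfibre A p \<Longrightarrow> JJ4 A \<pi>I p x \<in> gfibre A p"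
  unfolding gfibre_def JJ4_def
  by (auto intro!: tangent_add Jmap_tangent tangent_scale sharp_tangent[OF piI_bivector] cotangent_uminus Jdual_cot)

lemma JJ4_cnj:
  assumes "x \<in> gfibre A p" shows "JJ4 A \<pi>I p (gcnj x) = gcnj (JJ4 A \<pi>I p x)"
proof -
  have x: "fst x \<in> tangent A p" "snd x \<in> cotangent A p" using assms by (auto simp: gfibre_def)
  show ?thesis
    unfolding JJ4_def gcnj_def fst_conv snd_conv Jmap_cnj[OF x(1)] piI_sharp_cnj[OF x(2)] Jdual_cnj[OF x(2)]
    by (simp add: fun_eq_iff cnj_vec_def cnj_covec_def)
qed

lemma JJ4_square:
  assumes "x \<in> gfibre A p" shows "JJ4 A \<pi>I p (JJ4 A \<pi>I p x) = - x"
proof -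
  have x: "fst x \<in> tangent A p" "snd x \<in> cotangent A p" using assms by (auto simp: gfibre_def)
  note s = sharp_tangent[OF piI_bivector x(2)]
  have neg: "sharp A \<pi>I p (- Jdual A p (snd x)) = - Jmap A p (sharp A \<pi>I p (snd x))"
    using sharp_scale[OF piI_bivector Jdual_cot[OF x(2)], of "-1"]
    by (simp add: fun_Compl_def piI_sharp_Jdual[OF x(2)])
  show ?thesis
    unfolding JJ4_def fst_conv snd_conv neg Jdual_uminus Jdual_Jdual[OF x(2)]
      Jmap_add[OF Jmap_tangent[OF x(1)] tangent_scale[OF s]] Jmap_Jmap[OF x(1)] Jmap_scale[OF s]
    by (simp add: prod_eq_iff fun_eq_iff)
qed

lemma JJ4_add:
  assumes "x \<in> gfibre A p" "y \<in> gfibre A p"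
  shows "JJ4 A \<pi>I p (x + y) = JJ4 A \<pi>I p x + JJ4 A \<pi>I p y"
proof -
  have x: "fst x \<in> tangent A p" "snd x \<in> cotangent A p" and y: "fst y \<in> tangent A p" "snd y \<in> cotangent A p"
    using assms by (auto simp: gfibre_def)
  show ?thesis
    unfolding JJ4_def fst_add snd_add Jmap_add[OF x(1) y(1)] sharp_add[OF piI_bivector x(2) y(2)] Jdual_add
    by (simp add: prod_eq_iff fun_eq_iff algebra_simps)
qed

lemma JJ4_scale:
  assumes "x \<in> gfibre A p" shows "JJ4 A \<pi>I p (gscale c x) = gscale c (JJ4 A \<pi>I p x)"
proof -
  have x: "fst x \<in> tangent A p" "snd x \<in> cotangent A p" using assms by (auto simp: gfibre_def)
  show ?thesis
    unfolding JJ4_def gscale_simps Jmap_scale[OF x(1)] sharp_scale[OF piI_bivector x(2)] Jdual_scale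
    by (simp add: prod_eq_iff fun_eq_iff algebra_simps)
qed

lemma JJ4_pairing:
  assumes "x \<in> gfibre A p" "y \<in> gfibre A p"
  shows "gpairing (JJ4 A \<pi>I p x) (JJ4 A \<pi>I p y) = gpairing x y"
proof -
  have *: "(- Jdual A p \<alpha>) (Jmap A p w + (\<lambda>f. 4 * sharp A \<pi>I p \<beta> f)) = \<alpha> w - 4 * \<pi>I p \<beta> (Jdual A p \<alpha>)"
    if \<alpha>: "\<alpha> \<in> cotangent A p" and \<beta>: "\<beta> \<in> cotangent A p" and w: "w \<in> tangent A p" for \<alpha> \<beta> w
  proof -
    note J = Jdual_cot[OF \<alpha>] and s = sharp_tangent[OF piI_bivector \<beta>]
    show ?thesis
      using cot_add[OF J Jmap_tangent[OF w] tangent_scale[OF s, of 4]] cot_scale[OF J s, of 4]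
        sharp_pairing[OF piI_bivector \<beta> J]
      by (simp add: Jdual_apply[OF Jmap_tangent[OF w]] Jmap_Jmap[OF w] cot_uminus_vec[OF \<alpha> w])
  qed
  have x: "fst x \<in> tangent A p" "snd x \<in> cotangent A p" and y: "fst y \<in> tangent A p" "snd y \<in> cotangent A p"
    using assms by (auto simp: gfibre_def)
  have neg: "\<pi>I p (snd y) (Jdual A p (snd x)) = - \<pi>I p (snd x) (Jdual A p (snd y))"
    using biv_commute[OF piI_bivector x(2) Jdual_cot[OF y(2)]] piI_Jdual[OF x(2) y(2)] by simp
  then show ?thesis
    unfolding gpairing_def JJ4_def fst_conv snd_conv *[OF x(2) y(2,1)] *[OF y(2) x(2,1)]
    by (simp add: neg algebra_simps)
qed

lemma JJ4_gsection:
  assumes U: "open U" and s: "gsection A U s" shows "gsection A U (\<lambda>p. JJ4 A \<pi>I p (s p))"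
  unfolding gsection_def JJ4_def fst_conv snd_conv
  by (intro conjI vf_add vf_scale Jmap_vf sharp_vf[OF piI_bivector] form_uminus Jdual_form U
      smooth_fun_const gsection_vpart[OF s] gsection_fpart[OF s])

lemma JJ4_generalized_complex: "generalized_complex_structure A (JJ4 A \<pi>I)"
  unfolding generalized_complex_structure_def Let_def JJ4_eigenbundle
  by (intro conjI allI ballI impI; (elim conjE)?)
    (rule JJ4_gfibre JJ4_cnj JJ4_square JJ4_scale JJ4_add JJ4_pairing JJ4_gsection L_sections_involutive; assumption)+

end

end

theorem theorem4p21:
  fixes A :: "('a::{t2_space, second_countable_topology}, 'n::finite) atlas"
    and \<pi> \<pi>R \<pi>I :: "'a bivector"
  assumes "complex_atlas A"
    and "holomorphic_poisson A \<pi>"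
    and "real_bivector_field A \<pi>R"
    and "real_bivector_field A \<pi>I"
    and "\<And>p \<alpha> \<beta>. \<alpha> \<in> cotangent A p \<Longrightarrow> \<beta> \<in> cotangent A p \<Longrightarrow>
           \<pi> p \<alpha> \<beta> = \<pi>R p \<alpha> \<beta> + \<i> * \<pi>I p \<alpha> \<beta>"
  shows "generalized_complex_structure A (JJ4 A \<pi>I) \<and>
         dirac_structure A (minus_i_eigenbundle A (JJ4 A \<pi>I)) \<and>
         isomorphic_lie_algebroids A
           (matched_pair_algebroid A \<pi>)
           (courant_algebroid_of A (minus_i_eigenbundle A (JJ4 A \<pi>I)))"
proof -
  interpret holomorphic_poisson_manifold A \<pi>
    by unfold_locales (rule assms(1), rule assms(2))
  have eigenbundle: "minus_i_eigenbundle A (JJ4 A \<pi>I) = L"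
    by (rule JJ4_eigenbundle[OF assms(3,4)]) (rule assms(5))
  have "generalized_complex_structure A (JJ4 A \<pi>I)"
    by (rule JJ4_generalized_complex[OF assms(3,4)]) (rule assms(5))
  with L_dirac matched_pair_isomorphic show ?thesis
    unfolding eigenbundle by blast
qed

end
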